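(* Let $T=(V,E,F)$ be a triangulation of a surface. Suppose $\phi:|T|\to\mathbb C$ is a geodesic homeomorphism and $\phi':|T|\to\mathbb C$ is a geodesic embedding, with induced PL metrics $l=l(\phi)$ and $l'=l(\phi')$, such that (a) $l$ and $l'$ are both uniformly nondegenerate; (b) $l$ is uniformly Delaunay and $l'$ is Delaunay; (c) $l'=u*l$ for some $u\in\mathbb R^V$. Then $u$ is constant on $V$, i.e. $l$ and $l'$ differ by a constant scaling.
   Context: $T=(V,E,F)$ is a simplicial triangulation of a surface with vertex set $V$, edge set $E$, face set $F$; $|T|$ is its underlying space. A PL metric on $T$ is a function $l:E\to\mathbb R_{>0}$ such that for every face $\triangle ijk\in F$ the numbers $l_{ij},l_{jk},l_{ik}$ are side lengths of a nondegenerate Euclidean triangle. For $u\in\mathbb R^V$, $u*l$ denotes the function $(u*l)_{ij}=e^{(u_i+u_j)/2}l_{ij}$; two PL metrics $l,l'$ are discretely conformal if $l'=u*l$ for some $u\in\mathbb R^V$. Given a PL metric $l$, $\theta^i_{jk}$ denotes the inner angle at $i$ of the Euclidean triangle $\triangle ijk$ with side lengths given by $l$. The metric $l$ is uniformly nondegenerate (with constant $\epsilon>0$) if $\theta^i_{jk}\ge\epsilon$ for all faces and all corners; Delaunay if $\theta^{k_1}_{ij}+\theta^{k_2}_{ij}\le\pi$ for every pair of adjacent triangles $\triangle ijk_1,\triangle ijk_2\in F$; uniformly Delaunay if there is $\epsilon>0$ with $\theta^{k_1}_{ij}+\theta^{k_2}_{ij}\le\pi-\epsilon$ for every such pair. A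 map $\phi:|T|\to\mathbb C$ is a geodesic embedding if it maps each edge $ij$ to the straight segment between $\phi(i)$ and $\phi(j)$ and maps $|T|$ homeomorphically onto its image; it is a geodesic homeomorphism if moreover it is surjective onto $\mathbb C$. A geodesic embedding $\phi$ induces the PL metric $l(\phi)_{ij}=|\phi(i)-\phi(j)|$. *)

theory Defs
  imports "HOL-Analysis.Analysis"
begin

definition simplicial_complex2 :: "'v set \<Rightarrow> 'v set set \<Rightarrow> 'v set set \<Rightarrow> bool" where
  "simplicial_complex2 V E F \<longleftrightarrow>
     (\<forall>f\<in>F. f \<subseteq> V \<and> card f = 3) \<and>
     E = {e. card e = 2 \<and> (\<exists>f\<in>F. e \<subseteq> f)} \<and>
     V = \<Union>F"

text \<open>Geometric realization |T|, as points in barycentric coordinates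
  (functions V -> R, with the product topology).\<close>
definition realization :: "'v set set \<Rightarrow> ('v \<Rightarrow> real) set" where
  "realization F = {x. (\<forall>v. 0 \<le> x v) \<and>
      (\<exists>f\<in>F. {v. x v \<noteq> 0} \<subseteq> f \<and> sum x f = 1)}"

definition vert :: "'v \<Rightarrow> ('v \<Rightarrow> real)" where
  "vert i = (\<lambda>v. if v = i then 1 else 0)"

definition edge_realization :: "'v set set \<Rightarrow> 'v \<Rightarrow> 'v \<Rightarrow> ('v \<Rightarrow> real) set" where
  "edge_realization F i j = {x \<in> realization F. {v. x v \<noteq> 0} \<subseteq> {i, j}}"

definition surface_triangulation :: "'v set \<Rightarrow> 'v set set \<Rightarrow> 'v set set \<Rightarrow> bool" where
  "surface_triangulation V E F \<longleftrightarrow> simplicial_complex2 V E F \<and>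
     (\<forall>x\<in>realization F. \<exists>U. openin (top_of_set (realization F)) U \<and> x \<in> U \<and>
         U homeomorphic (ball (0::complex) 1))"

definition geodesic_embedding :: "'v set \<Rightarrow> 'v set set \<Rightarrow> 'v set set \<Rightarrow> (('v \<Rightarrow> real) \<Rightarrow> complex) \<Rightarrow> bool" where
  "geodesic_embedding V E F \<phi> \<longleftrightarrow>
     (\<forall>i j. {i, j} \<in> E \<longrightarrow>
        \<phi> ` edge_realization F i j = closed_segment (\<phi> (vert i)) (\<phi> (vert j))) \<and>
     (\<exists>g. homeomorphism (realization F) (\<phi> ` realization F) \<phi> g)"

definition geodesic_homeomorphism :: "'v set \<Rightarrow> 'v set set \<Rightarrow> 'v set set \<Rightarrow> (('v \<Rightarrow> real) \<Rightarrow> complex) \<Rightarrow> bool" where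
  "geodesic_homeomorphism V E F \<phi> \<longleftrightarrow>
     geodesic_embedding V E F \<phi> \<and> \<phi> ` realization F = UNIV"

text \<open>PL metrics are represented as functions l i j (only values on edges matter).\<close>
definition induced_metric :: "(('v \<Rightarrow> real) \<Rightarrow> complex) \<Rightarrow> 'v \<Rightarrow> 'v \<Rightarrow> real" where
  "induced_metric \<phi> i j = cmod (\<phi> (vert i) - \<phi> (vert j))"

definition conf_action :: "('v \<Rightarrow> real) \<Rightarrow> ('v \<Rightarrow> 'v \<Rightarrow> real) \<Rightarrow> 'v \<Rightarrow> 'v \<Rightarrow> real" where
  "conf_action u l i j = exp ((u i + u j) / 2) * l i j"

text \<open>Inner angle at i of the triangle ijk with side lengths given by l
  (law of cosines).\<close>
definition inner_angle :: "('v \<Rightarrow> 'v \<Rightarrow> real) \<Rightarrow> 'v \<Rightarrow> 'v \<Rightarrow> 'v \<Rightarrow> real" where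
  "inner_angle l i j k =
     arccos (((l i j)\<^sup>2 + (l i k)\<^sup>2 - (l j k)\<^sup>2) / (2 * l i j * l i k))"

definition uniformly_nondegenerate :: "'v set set \<Rightarrow> ('v \<Rightarrow> 'v \<Rightarrow> real) \<Rightarrow> bool" where
  "uniformly_nondegenerate F l \<longleftrightarrow> (\<exists>\<epsilon>>0. \<forall>i j k. {i, j, k} \<in> F \<and> i \<noteq> j \<and> j \<noteq> k \<and> i \<noteq> k
      \<longrightarrow> inner_angle l i j k \<ge> \<epsilon>)"

definition delaunay :: "'v set set \<Rightarrow> ('v \<Rightarrow> 'v \<Rightarrow> real) \<Rightarrow> bool" where
  "delaunay F l \<longleftrightarrow> (\<forall>i j k1 k2. {i, j, k1} \<in> F \<and> {i, j, k2} \<in> F \<and>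
      i \<noteq> j \<and> k1 \<noteq> k2 \<and> k1 \<notin> {i, j} \<and> k2 \<notin> {i, j}
      \<longrightarrow> inner_angle l k1 i j + inner_angle l k2 i j \<le> pi)"

definition uniformly_delaunay :: "'v set set \<Rightarrow> ('v \<Rightarrow> 'v \<Rightarrow> real) \<Rightarrow> bool" where
  "uniformly_delaunay F l \<longleftrightarrow> (\<exists>\<epsilon>>0. \<forall>i j k1 k2. {i, j, k1} \<in> F \<and> {i, j, k2} \<in> F \<and>
      i \<noteq> j \<and> k1 \<noteq> k2 \<and> k1 \<notin> {i, j} \<and> k2 \<notin> {i, j}
      \<longrightarrow> inner_angle l k1 i j + inner_angle l k2 i j \<le> pi - \<epsilon>)"

end

theory Submission
  imports Defs
begin

text \<open>
  Write \<open>\<delta>\<close> for the change of the angles under \<open>l \<mapsto> u * l\<close>. Both angle sums at a vertex are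
  \<open>2\<pi>\<close>, so \<open>\<delta>\<close> sums to zero around every vertex, while inside a triangle the sine law and the
  positivity of the form \<open>\<Sum> cot \<theta>\<^sub>i \<delta>\<^sub>i\<^sup>2\<close> on \<open>\<Sum> \<delta>\<^sub>i = 0\<close> (followed along the straight path of
  angles) give \<open>- \<Sum> \<delta>\<^sub>i u\<^sub>i \<ge> c (osc u)\<^sup>2\<close>. Thus \<open>u\<close> is a discrete solution of a uniformly elliptic
  equation in divergence form. For small \<open>e\<close> the same holds for the subsolution
  \<open>exp (e u / 2)\<close>, with constants that do not depend on \<open>e\<close>. Testing on discs and bounding the oscillation on
  circles by length--area makes its energy on the disc of radius \<open>R\<close> grow at least like \<open>R\<^sup>\<alpha>\<close>, \<open>\<alpha>\<close>
  independent of \<open>e\<close>, unless it vanishes. A Caccioppoli estimate bounds the same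
  energy by a constant times \<open>D(R)\<^sup>e\<close>, where \<open>D(R)\<close> is the radius of the image of the disc under
  the quasiconformal map \<open>\<phi>' \<circ> \<phi>\<^sup>-\<^sup>1\<close>; a second length--area argument shows that \<open>D\<close> grows
  polynomially. Letting \<open>e\<close> be small forces the energy to vanish.
\<close>

text \<open>No bound on \<open>u\<close> is available, so a Liouville theorem for bounded solutions
  cannot be applied to it. What is available is that \<open>exp (2 * u)\<close> acts as the area
  density of the comparison map; interpolating between the exponents 0 and 2 turns an area bound
  into a bound on small exponentials. This helps only if the growth rate from below survives as
  \<open>e\<close> tends to 0. It does because the energy of a face and its boundary flux carry the
  same factor \<open>1 / e\<close>, which cancels. The Caccioppoli constant may depend on
  \<open>e\<close>, since only growth rates in \<open>R\<close> are compared. A second obstacle is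
  that faces have no common size. Bounded degree makes neighbours comparable, and a face at distance
  \<open>r\<close> from a base vertex has size at most of order \<open>1 + r\<close>, so faces
  meeting a disc stay in a fixed dilate of it and lengths and areas can be replaced by sums of
  diameters and of their squares. The image of \<open>\<phi>'\<close> may be a proper part of the
  plane, so the size bound has to be proved without assuming that the faces cover
  everything.\<close>

section \<open>Interval covers and oscillation over connected sets\<close>

text \<open>Discrete coarea inequality behind the length-area arguments: integrate the hypothesis
  over \<open>r\<close> and exchange sum and integral; each interval contributes at most its
  length.\<close>

lemma weighted_interval_cover:
  fixes lo hi x :: "'i \<Rightarrow> real"
  assumes fin: "finite I" and x0: "\<And>i. i \<in> I \<Longrightarrow> 0 \<le> x i"
    and lh: "\<And>i. i \<in> I \<Longrightarrow> lo i \<le> hi i" and ab: "a \<le> b"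
    and cov: "\<And>r. a < r \<Longrightarrow> r < b \<Longrightarrow> q \<le> (\<Sum>i\<in>{i\<in>I. lo i \<le> r \<and> r \<le> hi i}. x i)"
  shows "q * (b - a) \<le> (\<Sum>i\<in>I. x i * (hi i - lo i))"
proof -
  let ?g = "\<lambda>r. \<Sum>i\<in>I. x i * indicator ({lo i..hi i} \<inter> {a<..<b}) r"
  have meas: "measure lborel ({lo i..hi i} \<inter> {a<..<b}) \<le> hi i - lo i" if "i \<in> I" for i
  proof -
    have "measure lborel ({lo i..hi i} \<inter> {a<..<b}) \<le> measure lborel {lo i..hi i}"
      by (rule measure_mono_fmeasurable) (auto simp: fmeasurable_def emeasure_lborel_Icc_eq)
    thus ?thesis using lh[OF that] by simp
  qed
  have fm: "{lo i..hi i} \<inter> {a<..<b} \<in> fmeasurable lborel" for i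
    by (rule fmeasurable_Int_fmeasurable) (auto simp: fmeasurable_def emeasure_lborel_Icc_eq)
  have int1: "has_bochner_integral lborel ?g (\<Sum>i\<in>I. x i * measure lborel ({lo i..hi i} \<inter> {a<..<b}))"
    by (intro has_bochner_integral_sum has_bochner_integral_mult_right has_bochner_integral_real_indicator)
       (use fm in \<open>auto simp: fmeasurable_def\<close>)
  have int2: "has_bochner_integral lborel (\<lambda>r. q * indicator {a<..<b} r) (q * measure lborel {a<..<b})"
    by (intro has_bochner_integral_mult_right has_bochner_integral_real_indicator) (use ab in auto)
  have le: "q * indicator {a<..<b} r \<le> ?g r" for r
  proof (cases "r \<in> {a<..<b}")
    case True
    have "?g r = (\<Sum>i\<in>I. if lo i \<le> r \<and> r \<le> hi i then x i else 0)"
      using True by (intro sum.cong) (auto simp: indicator_def)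
    also have "\<dots> = (\<Sum>i\<in>{i\<in>I. lo i \<le> r \<and> r \<le> hi i}. x i)"
      using fin by (simp add: sum.inter_filter)
    finally show ?thesis using cov[of r] True by simp
  next
    case False
    thus ?thesis by (auto intro!: sum_nonneg mult_nonneg_nonneg x0)
  qed
  have "q * measure lborel {a<..<b} \<le> (\<Sum>i\<in>I. x i * measure lborel ({lo i..hi i} \<inter> {a<..<b}))"
    using le
    by (metis (no_types, lifting) has_bochner_integral_iff int1 int2 integral_mono)
  also have "\<dots> \<le> (\<Sum>i\<in>I. x i * (hi i - lo i))"
    by (intro sum_mono mult_left_mono meas x0)
  finally show ?thesis using ab by simp
qed

lemma interval_cover_length:
  fixes lo hi :: "'i \<Rightarrow> real"
  assumes fin: "finite I" and lh: "\<And>i. i \<in> I \<Longrightarrow> lo i \<le> hi i" and ab: "a \<le> b"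
    and cov: "\<And>r. a < r \<Longrightarrow> r < b \<Longrightarrow> \<exists>i\<in>I. lo i \<le> r \<and> r \<le> hi i"
  shows "b - a \<le> (\<Sum>i\<in>I. hi i - lo i)"
proof -
  have "1 * (b - a) \<le> (\<Sum>i\<in>I. 1 * (hi i - lo i))"
  proof (rule weighted_interval_cover[OF fin _ lh ab])
    fix r assume "a < r" "r < b"
    then obtain i where "i \<in> {i\<in>I. lo i \<le> r \<and> r \<le> hi i}" using cov by auto
    hence "card {i\<in>I. lo i \<le> r \<and> r \<le> hi i} > 0" using fin by (auto simp: card_gt_0_iff)
    thus "1 \<le> (\<Sum>i\<in>{i\<in>I. lo i \<le> r \<and> r \<le> hi i}. (1::real))" by simp
  qed auto
  thus ?thesis by simp
qed

text \<open>If the value intervals did not chain up, a gap value would split the cover of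
  \<open>X\<close> into two disjoint closed parts.\<close>

lemma connected_cover_oscillation:
  fixes X :: "'a::topological_space set" and lo hi :: "'i \<Rightarrow> real"
  assumes con: "connected X" and fin: "finite I" and cl: "\<And>i. i \<in> I \<Longrightarrow> closed (A i)"
    and cov: "X \<subseteq> (\<Union>i\<in>I. A i)"
    and lh: "\<And>i. i \<in> I \<Longrightarrow> lo i \<le> hi i"
    and link: "\<And>i j. i \<in> I \<Longrightarrow> j \<in> I \<Longrightarrow> A i \<inter> A j \<inter> X \<noteq> {} \<Longrightarrow> lo i \<le> hi j"
    and ij: "i0 \<in> I" "j0 \<in> I" "A i0 \<inter> X \<noteq> {}" "A j0 \<inter> X \<noteq> {}"
  shows "hi i0 - lo j0 \<le> (\<Sum>i\<in>I. hi i - lo i)"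
proof (rule ccontr)
  assume neg: "\<not> ?thesis"
  have nn: "0 \<le> (\<Sum>i\<in>I. hi i - lo i)" by (intro sum_nonneg) (use lh in auto)
  have "\<exists>r. lo j0 < r \<and> r < hi i0 \<and> (\<forall>i\<in>I. \<not> (lo i \<le> r \<and> r \<le> hi i))"
  proof (rule ccontr)
    assume "\<not> ?thesis"
    hence "hi i0 - lo j0 \<le> (\<Sum>i\<in>I. hi i - lo i)"
      using neg nn by (intro interval_cover_length fin lh) auto
    thus False using neg by simp
  qed
  then obtain r where r: "lo j0 < r" "r < hi i0" and gap: "\<And>i. i \<in> I \<Longrightarrow> \<not> (lo i \<le> r \<and> r \<le> hi i)"
    by blast
  define L where "L = (\<Union>i\<in>{i\<in>I. hi i < r}. A i)"
  define U where "U = (\<Union>i\<in>{i\<in>I. r < lo i}. A i)"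
  have "closed L" "closed U" unfolding L_def U_def using fin cl by (auto intro!: closed_UN)
  moreover have "X \<subseteq> L \<union> U" using cov gap unfolding L_def U_def by fastforce
  moreover have "L \<inter> U \<inter> X = {}"
  proof (rule ccontr)
    assume "L \<inter> U \<inter> X \<noteq> {}"
    then obtain i j where "i \<in> I" "hi i < r" "j \<in> I" "r < lo j" "A j \<inter> A i \<inter> X \<noteq> {}"
      unfolding L_def U_def by blast
    with link[of j i] show False by auto
  qed
  moreover have "U \<inter> X \<noteq> {}"
  proof -
    have "r < lo i0" using gap[OF ij(1)] r by auto
    thus ?thesis using ij unfolding U_def by blast
  qed
  moreover have "L \<inter> X \<noteq> {}"
  proof -
    have "hi j0 < r" using gap[OF ij(2)] r by auto
    thus ?thesis using ij unfolding L_def by blast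
  qed
  ultimately show False using con unfolding connected_closed by blast
qed

section \<open>Angle variation in a single triangle\<close>

text \<open>\<open>(cot \<alpha> + cot \<beta>) q = (cot \<alpha> x - cot \<beta> y)\<^sup>2 + (x + y)\<^sup>2\<close> for the form \<open>q\<close> below.\<close>

lemma cot_form_ge:
  fixes x y z :: real
  assumes ang: "0 < \<alpha>" "0 < \<beta>" "0 < \<gamma>" "\<alpha> + \<beta> + \<gamma> = pi" and s: "x + y + z = 0"
    and sg: "0 < \<sigma>" "\<sigma> \<le> sin \<alpha>" "\<sigma> \<le> sin \<beta>"
  shows "\<sigma>\<^sup>2 * z\<^sup>2 \<le> cot \<alpha> * x\<^sup>2 + cot \<beta> * y\<^sup>2 + cot \<gamma> * z\<^sup>2"
proof -
  have sp: "sin \<alpha> > 0" "sin \<beta> > 0" using sg by auto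
  have sg0: "sin \<gamma> > 0" using ang by (intro sin_gt_zero) auto
  have g: "\<gamma> = pi - (\<alpha> + \<beta>)" using ang by simp
  have sing: "sin \<gamma> = sin \<alpha> * cos \<beta> + cos \<alpha> * sin \<beta>"
    unfolding g by (simp add: sin_diff sin_add)
  have cosg: "cos \<gamma> = sin \<alpha> * sin \<beta> - cos \<alpha> * cos \<beta>"
    unfolding g by (simp add: cos_diff cos_add)
  have z: "z = -(x + y)" using s by simp
  let ?q = "cot \<alpha> * x\<^sup>2 + cot \<beta> * y\<^sup>2 + cot \<gamma> * z\<^sup>2"
  have "?q * (sin \<alpha> * sin \<beta> * sin \<gamma>) =
      cos \<alpha> * sin \<beta> * sin \<gamma> * x\<^sup>2 + cos \<beta> * sin \<alpha> * sin \<gamma> * y\<^sup>2 + cos \<gamma> * sin \<alpha> * sin \<beta> * z\<^sup>2"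
    using sp sg0 by (simp add: cot_def field_simps)
  also have "\<dots> = (cos \<alpha> * sin \<beta> * x - cos \<beta> * sin \<alpha> * y)\<^sup>2 + (sin \<alpha> * sin \<beta> * z)\<^sup>2"
    unfolding sing cosg z by (simp add: algebra_simps power2_eq_square)
  finally have "(sin \<alpha> * sin \<beta> * z)\<^sup>2 \<le> ?q * (sin \<alpha> * sin \<beta> * sin \<gamma>)" by simp
  hence "(sin \<alpha> * sin \<beta>) * (sin \<alpha> * sin \<beta> * z\<^sup>2) \<le> (sin \<alpha> * sin \<beta>) * (?q * sin \<gamma>)"
    by (simp add: power2_eq_square algebra_simps)
  hence 1: "sin \<alpha> * sin \<beta> * z\<^sup>2 \<le> ?q * sin \<gamma>"
    using sp by (simp add: mult_le_cancel_left_pos)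
  have "\<sigma>\<^sup>2 * z\<^sup>2 \<le> sin \<alpha> * sin \<beta> * z\<^sup>2"
    unfolding power2_eq_square[of \<sigma>] using sg sp by (intro mult_right_mono mult_mono) auto
  hence 2: "\<sigma>\<^sup>2 * z\<^sup>2 \<le> ?q * sin \<gamma>" using 1 by simp
  hence "0 \<le> ?q * sin \<gamma>" by (rule order_trans[rotated]) simp
  hence "0 \<le> ?q" using sg0 by (simp add: zero_le_mult_iff)
  hence "?q * sin \<gamma> \<le> ?q * 1" by (intro mult_left_mono) auto
  thus ?thesis using 2 by simp
qed

text \<open>Adding the three cyclic versions of \<open>cot_form_ge\<close> costs the factor
  1/3.\<close>

lemma cot_form_ge_all:
  fixes x y z :: real
  assumes ang: "0 < \<alpha>" "0 < \<beta>" "0 < \<gamma>" "\<alpha> + \<beta> + \<gamma> = pi" and s: "x + y + z = 0"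
    and sg: "0 < \<sigma>" "\<sigma> \<le> sin \<alpha>" "\<sigma> \<le> sin \<beta>" "\<sigma> \<le> sin \<gamma>"
  shows "\<sigma>\<^sup>2 / 3 * (x\<^sup>2 + y\<^sup>2 + z\<^sup>2) \<le> cot \<alpha> * x\<^sup>2 + cot \<beta> * y\<^sup>2 + cot \<gamma> * z\<^sup>2"
proof -
  have "\<sigma>\<^sup>2 * z\<^sup>2 \<le> cot \<alpha> * x\<^sup>2 + cot \<beta> * y\<^sup>2 + cot \<gamma> * z\<^sup>2"
    using cot_form_ge[of \<alpha> \<beta> \<gamma> x y z \<sigma>] assms by simp
  moreover have "\<sigma>\<^sup>2 * x\<^sup>2 \<le> cot \<beta> * y\<^sup>2 + cot \<gamma> * z\<^sup>2 + cot \<alpha> * x\<^sup>2"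
    using cot_form_ge[of \<beta> \<gamma> \<alpha> y z x \<sigma>] assms by (simp add: algebra_simps)
  moreover have "\<sigma>\<^sup>2 * y\<^sup>2 \<le> cot \<gamma> * z\<^sup>2 + cot \<alpha> * x\<^sup>2 + cot \<beta> * y\<^sup>2"
    using cot_form_ge[of \<gamma> \<alpha> \<beta> z x y \<sigma>] assms by (simp add: algebra_simps)
  ultimately show ?thesis by (simp add: algebra_simps)
qed

lemma sin_between_ge:
  assumes "\<epsilon> \<le> \<theta>" "\<theta> \<le> pi - \<epsilon>" "0 < \<epsilon>"
  shows "sin \<epsilon> \<le> sin \<theta>"
proof (cases "\<theta> \<le> pi/2")
  case True
  thus ?thesis using assms by (intro sin_monotone_2pi_le) auto
next
  case False
  have "sin \<epsilon> \<le> sin (pi - \<theta>)" using assms False by (intro sin_monotone_2pi_le) auto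
  thus ?thesis by simp
qed

lemma ln_sin_diff:
  assumes e: "0 < \<epsilon>" and t: "\<epsilon> \<le> \<theta>" "\<theta> \<le> pi - \<epsilon>" and t': "\<epsilon> \<le> \<theta>'" "\<theta>' \<le> pi - \<epsilon>"
  shows "\<bar>ln (sin \<theta>') - ln (sin \<theta>)\<bar> \<le> 1 / sin \<epsilon> * \<bar>\<theta>' - \<theta>\<bar>"
proof -
  have sp: "sin x > 0" if "x \<in> {\<epsilon>..pi - \<epsilon>}" for x using that e by (intro sin_gt_zero) auto
  have "\<epsilon> \<le> pi - \<epsilon>" using t by simp
  hence se: "sin \<epsilon> > 0" using sp[of \<epsilon>] by auto
  have "norm (ln (sin \<theta>') - ln (sin \<theta>)) \<le> 1 / sin \<epsilon> * norm (\<theta>' - \<theta>)"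
  proof (rule field_differentiable_bound[where S = "{\<epsilon>..pi - \<epsilon>}" and f' = "\<lambda>x. cos x / sin x"])
    fix x assume x: "x \<in> {\<epsilon>..pi - \<epsilon>}"
    show "((\<lambda>x. ln (sin x)) has_field_derivative cos x / sin x) (at x within {\<epsilon>..pi - \<epsilon>})"
      using sp[OF x] by (auto intro!: derivative_eq_intros)
    have "sin \<epsilon> \<le> sin x" using x e by (intro sin_between_ge) auto
    moreover have "\<bar>cos x\<bar> \<le> 1" by simp
    ultimately show "norm (cos x / sin x) \<le> 1 / sin \<epsilon>"
      using sp[OF x] se by (auto simp: norm_divide intro!: frac_le)
  qed (use t t' in auto)
  thus ?thesis by simp
qed

text \<open>The derivative of \<open>ln (sin \<theta>)\<close> is \<open>cot \<theta>\<close>, and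
  angle triples bounded below by \<open>\<epsilon>\<close> form a convex set. So the mean value
  theorem on the segment reduces the claim to the cotangent form at one intermediate
  triangle.\<close>

lemma ln_sin_monotone_form:
  fixes \<alpha> \<beta> \<gamma> \<alpha>' \<beta>' \<gamma>' \<epsilon> :: real
  assumes e: "0 < \<epsilon>" and a: "\<epsilon> \<le> \<alpha>" "\<epsilon> \<le> \<beta>" "\<epsilon> \<le> \<gamma>" "\<alpha> + \<beta> + \<gamma> = pi"
    and a': "\<epsilon> \<le> \<alpha>'" "\<epsilon> \<le> \<beta>'" "\<epsilon> \<le> \<gamma>'" "\<alpha>' + \<beta>' + \<gamma>' = pi"
  shows "(sin \<epsilon>)\<^sup>2 / 3 * ((\<alpha>' - \<alpha>)\<^sup>2 + (\<beta>' - \<beta>)\<^sup>2 + (\<gamma>' - \<gamma>)\<^sup>2) \<le>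
    (\<alpha>' - \<alpha>) * (ln (sin \<alpha>') - ln (sin \<alpha>)) + (\<beta>' - \<beta>) * (ln (sin \<beta>') - ln (sin \<beta>))
    + (\<gamma>' - \<gamma>) * (ln (sin \<gamma>') - ln (sin \<gamma>))"
proof -
  define x y z where "x = \<alpha>' - \<alpha>" and "y = \<beta>' - \<beta>" and "z = \<gamma>' - \<gamma>"
  have xyz: "x + y + z = 0" unfolding x_def y_def z_def using a a' by linarith
  define \<Phi> where "\<Phi> t = x * ln (sin (\<alpha> + t * x)) + y * ln (sin (\<beta> + t * y)) + z * ln (sin (\<gamma> + t * z))" for t
  have ge: "\<epsilon> \<le> p + t * (p' - p)" if "\<epsilon> \<le> p" "\<epsilon> \<le> p'" "0 \<le> t" "t \<le> 1" for t p p' :: real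
  proof -
    have "(1 - t) * \<epsilon> + t * \<epsilon> \<le> (1 - t) * p + t * p'"
      using that by (intro add_mono mult_left_mono) auto
    thus ?thesis by (simp add: algebra_simps)
  qed
  have bnd: "\<epsilon> \<le> \<alpha> + t * x" "\<epsilon> \<le> \<beta> + t * y" "\<epsilon> \<le> \<gamma> + t * z" if "0 \<le> t" "t \<le> 1" for t
    unfolding x_def y_def z_def using ge a a' that by auto
  have sm: "(\<alpha> + t * x) + (\<beta> + t * y) + (\<gamma> + t * z) = pi" for t
  proof -
    have "(\<alpha> + t * x) + (\<beta> + t * y) + (\<gamma> + t * z) = (\<alpha> + \<beta> + \<gamma>) + t * (x + y + z)" by (simp add: algebra_simps)
    thus ?thesis using xyz a by simp
  qed
  have up: "\<alpha> + t * x \<le> pi - \<epsilon>" "\<beta> + t * y \<le> pi - \<epsilon>" "\<gamma> + t * z \<le> pi - \<epsilon>" if "0 \<le> t" "t \<le> 1" for t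
    using bnd[OF that] sm[of t] e by linarith+
  have spos: "sin (\<alpha> + t * x) > 0" "sin (\<beta> + t * y) > 0" "sin (\<gamma> + t * z) > 0" if "0 \<le> t" "t \<le> 1" for t
    using bnd[OF that] up[OF that] e by (auto intro!: sin_gt_zero)
  have "\<exists>t>0. t < 1 \<and> \<Phi> 1 - \<Phi> 0 = (1 - 0) * (cot (\<alpha> + t * x) * x\<^sup>2 + cot (\<beta> + t * y) * y\<^sup>2 + cot (\<gamma> + t * z) * z\<^sup>2)"
  proof (rule MVT2)
    fix t :: real assume t: "0 \<le> t" "t \<le> 1"
    show "(\<Phi> has_real_derivative cot (\<alpha> + t * x) * x\<^sup>2 + cot (\<beta> + t * y) * y\<^sup>2 + cot (\<gamma> + t * z) * z\<^sup>2) (at t)"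
      unfolding \<Phi>_def cot_def power2_eq_square
      using spos[OF t] by (auto intro!: derivative_eq_intros simp: field_simps)
  qed simp
  then obtain t where t: "0 < t" "t < 1"
    and \<Phi>: "\<Phi> 1 - \<Phi> 0 = cot (\<alpha> + t * x) * x\<^sup>2 + cot (\<beta> + t * y) * y\<^sup>2 + cot (\<gamma> + t * z) * z\<^sup>2" by auto
  have t01: "0 \<le> t" "t \<le> 1" using t by auto
  have se: "sin \<epsilon> > 0" using e a by (intro sin_gt_zero) auto
  have "(sin \<epsilon>)\<^sup>2 / 3 * (x\<^sup>2 + y\<^sup>2 + z\<^sup>2) \<le> \<Phi> 1 - \<Phi> 0"
    unfolding \<Phi> using bnd[OF t01] up[OF t01] sm[of t] e xyz se
    by (intro cot_form_ge_all sin_between_ge) auto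
  thus ?thesis unfolding \<Phi>_def x_def y_def z_def by (simp add: algebra_simps)
qed

text \<open>Taking logarithms in the sine laws of the two triangles gives the relation
  \<open>u\<close>; \<open>K\<close> collects what is common to the three vertices and drops out of
  \<open>D\<close> because the angle changes sum to zero. The four conclusions are coercivity of
  \<open>D\<close> in the angle changes and in the differences of \<open>u\<close>, an a priori
  bound on these differences, and the converse control of the angle changes by them.\<close>

lemma angle_variation_abs:
  fixes \<alpha> \<beta> \<gamma> \<alpha>' \<beta>' \<gamma>' \<epsilon> K u1 u2 u3 :: real
  assumes e: "0 < \<epsilon>" and a: "\<epsilon> \<le> \<alpha>" "\<epsilon> \<le> \<beta>" "\<epsilon> \<le> \<gamma>" "\<alpha> + \<beta> + \<gamma> = pi"
    and a': "\<epsilon> \<le> \<alpha>'" "\<epsilon> \<le> \<beta>'" "\<epsilon> \<le> \<gamma>'" "\<alpha>' + \<beta>' + \<gamma>' = pi"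
    and u: "u1 = K - 2 * (ln (sin \<alpha>') - ln (sin \<alpha>))" "u2 = K - 2 * (ln (sin \<beta>') - ln (sin \<beta>))"
      "u3 = K - 2 * (ln (sin \<gamma>') - ln (sin \<gamma>))"
  defines "D \<equiv> - ((\<alpha>' - \<alpha>) * u1 + (\<beta>' - \<beta>) * u2 + (\<gamma>' - \<gamma>) * u3)"
  shows "2 * (sin \<epsilon>)\<^sup>2 / 3 * ((\<alpha>' - \<alpha>)\<^sup>2 + (\<beta>' - \<beta>)\<^sup>2 + (\<gamma>' - \<gamma>)\<^sup>2) \<le> D"
    and "(sin \<epsilon>)^4 / 12 * (u1 - u2)\<^sup>2 \<le> D"
    and "\<bar>u1 - u2\<bar> \<le> 4 * pi / sin \<epsilon>"
    and "\<bar>u1 - u2\<bar> \<le> b \<Longrightarrow> \<bar>u1 - u3\<bar> \<le> b \<Longrightarrow> \<bar>\<alpha>' - \<alpha>\<bar> \<le> 3 / (sin \<epsilon>)\<^sup>2 * b"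
proof -
  have se: "sin \<epsilon> > 0" using e a by (intro sin_gt_zero) auto
  define x y z where "x = \<alpha>' - \<alpha>" and "y = \<beta>' - \<beta>" and "z = \<gamma>' - \<gamma>"
  define L1 L2 L3 where "L1 = ln (sin \<alpha>') - ln (sin \<alpha>)" and "L2 = ln (sin \<beta>') - ln (sin \<beta>)"
    and "L3 = ln (sin \<gamma>') - ln (sin \<gamma>)"
  have xyz: "x + y + z = 0" unfolding x_def y_def z_def using a a' by linarith
  have uu: "u1 = K - 2 * L1" "u2 = K - 2 * L2" "u3 = K - 2 * L3" using u unfolding L1_def L2_def L3_def by auto
  have form: "(sin \<epsilon>)\<^sup>2 / 3 * (x\<^sup>2 + y\<^sup>2 + z\<^sup>2) \<le> x * L1 + y * L2 + z * L3"
    using ln_sin_monotone_form[OF e a a'] unfolding x_def y_def z_def L1_def L2_def L3_def .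
  have D: "D = 2 * (x * L1 + y * L2 + z * L3)"
  proof -
    have "D = 2 * (x * L1 + y * L2 + z * L3) - K * (x + y + z)"
      unfolding D_def uu x_def[symmetric] y_def[symmetric] z_def[symmetric] by (simp add: algebra_simps)
    thus ?thesis using xyz by simp
  qed
  have 1: "2 * (sin \<epsilon>)\<^sup>2 / 3 * (x\<^sup>2 + y\<^sup>2 + z\<^sup>2) \<le> D" using form D by simp
  thus "2 * (sin \<epsilon>)\<^sup>2 / 3 * ((\<alpha>' - \<alpha>)\<^sup>2 + (\<beta>' - \<beta>)\<^sup>2 + (\<gamma>' - \<gamma>)\<^sup>2) \<le> D"
    unfolding x_def y_def z_def .
  have L: "\<bar>L1\<bar> \<le> 1 / sin \<epsilon> * \<bar>x\<bar>" "\<bar>L2\<bar> \<le> 1 / sin \<epsilon> * \<bar>y\<bar>"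
    unfolding L1_def L2_def x_def y_def using a a' e by (intro ln_sin_diff; linarith)+
  have u12: "\<bar>u1 - u2\<bar> \<le> 2 / sin \<epsilon> * (\<bar>x\<bar> + \<bar>y\<bar>)"
  proof -
    have "\<bar>u1 - u2\<bar> \<le> 2 * (\<bar>L1\<bar> + \<bar>L2\<bar>)" unfolding uu by simp
    also have "\<dots> \<le> 2 * (1 / sin \<epsilon> * \<bar>x\<bar> + 1 / sin \<epsilon> * \<bar>y\<bar>)" using L by simp
    finally show ?thesis by (simp add: algebra_simps add_divide_distrib)
  qed
  have "\<bar>x\<bar> \<le> pi" "\<bar>y\<bar> \<le> pi" unfolding x_def y_def using a a' e by auto
  hence "2 / sin \<epsilon> * (\<bar>x\<bar> + \<bar>y\<bar>) \<le> 2 / sin \<epsilon> * (2 * pi)" using se by (intro mult_left_mono) auto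
  thus "\<bar>u1 - u2\<bar> \<le> 4 * pi / sin \<epsilon>" using u12 by simp
  have "(u1 - u2)\<^sup>2 \<le> (2 / sin \<epsilon> * (\<bar>x\<bar> + \<bar>y\<bar>))\<^sup>2"
    using u12 by (metis abs_ge_zero power2_abs power_mono)
  also have "\<dots> = 4 / (sin \<epsilon>)\<^sup>2 * (\<bar>x\<bar> + \<bar>y\<bar>)\<^sup>2"
    unfolding power_mult_distrib power_divide by simp
  also have "\<dots> \<le> 4 / (sin \<epsilon>)\<^sup>2 * (2 * (x\<^sup>2 + y\<^sup>2 + z\<^sup>2))"
  proof (rule mult_left_mono)
    have "(\<bar>x\<bar> + \<bar>y\<bar>)\<^sup>2 + (\<bar>x\<bar> - \<bar>y\<bar>)\<^sup>2 = 2 * (x\<^sup>2 + y\<^sup>2)" by (simp add: power2_eq_square algebra_simps)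
    thus "(\<bar>x\<bar> + \<bar>y\<bar>)\<^sup>2 \<le> 2 * (x\<^sup>2 + y\<^sup>2 + z\<^sup>2)" by (smt (verit) zero_le_power2)
  qed (use se in auto)
  finally have "(sin \<epsilon>)^4 / 12 * (u1 - u2)\<^sup>2 \<le> (sin \<epsilon>)^4 / 12 * (4 / (sin \<epsilon>)\<^sup>2 * (2 * (x\<^sup>2 + y\<^sup>2 + z\<^sup>2)))"
    using se by (intro mult_left_mono) auto
  also have "\<dots> = 2 * (sin \<epsilon>)\<^sup>2 / 3 * (x\<^sup>2 + y\<^sup>2 + z\<^sup>2)"
    using se by (simp add: field_simps power2_eq_square power4_eq_xxxx)
  finally show "(sin \<epsilon>)^4 / 12 * (u1 - u2)\<^sup>2 \<le> D" using 1 by simp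
  assume b: "\<bar>u1 - u2\<bar> \<le> b" "\<bar>u1 - u3\<bar> \<le> b"
  \<comment> \<open>With zero total angle change \<open>u1\<close> can be subtracted, so
    \<open>D\<close> is at most linear in the angle changes with factor \<open>b\<close>; against
    its quadratic lower bound this bounds the angle changes by a multiple of
    \<open>b\<close>.\<close>
  have "D = y * (u1 - u2) + z * (u1 - u3) - (x + y + z) * u1"
    unfolding D_def x_def[symmetric] y_def[symmetric] z_def[symmetric] by (simp add: algebra_simps)
  hence "D \<le> \<bar>y\<bar> * \<bar>u1 - u2\<bar> + \<bar>z\<bar> * \<bar>u1 - u3\<bar>"
    using xyz by (simp flip: abs_mult)
  also have "\<dots> \<le> \<bar>y\<bar> * b + \<bar>z\<bar> * b" using b by (intro add_mono mult_left_mono) auto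
  also have "\<dots> = (\<bar>y\<bar> + \<bar>z\<bar>) * b" by (simp add: algebra_simps)
  finally have Db: "2 * (sin \<epsilon>)\<^sup>2 / 3 * (x\<^sup>2 + y\<^sup>2 + z\<^sup>2) \<le> (\<bar>y\<bar> + \<bar>z\<bar>) * b" using 1 by simp
  let ?t = "\<bar>y\<bar> + \<bar>z\<bar>"
  have yz: "?t\<^sup>2 \<le> 2 * (x\<^sup>2 + y\<^sup>2 + z\<^sup>2)"
  proof -
    have "(\<bar>y\<bar> + \<bar>z\<bar>)\<^sup>2 + (\<bar>y\<bar> - \<bar>z\<bar>)\<^sup>2 = 2 * (y\<^sup>2 + z\<^sup>2)" by (simp add: power2_eq_square algebra_simps)
    thus ?thesis by (smt (verit) zero_le_power2)
  qed
  have "(sin \<epsilon>)\<^sup>2 / 3 * ?t\<^sup>2 \<le> (sin \<epsilon>)\<^sup>2 / 3 * (2 * (x\<^sup>2 + y\<^sup>2 + z\<^sup>2))"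
    using yz by (intro mult_left_mono) auto
  also have "\<dots> = 2 * (sin \<epsilon>)\<^sup>2 / 3 * (x\<^sup>2 + y\<^sup>2 + z\<^sup>2)" by algebra
  also have "\<dots> \<le> ?t * b" by (rule Db)
  finally have q: "((sin \<epsilon>)\<^sup>2 / 3 * ?t) * ?t \<le> b * ?t" by (simp add: power2_eq_square mult_ac)
  have "0 \<le> b" using b by linarith
  have "(sin \<epsilon>)\<^sup>2 / 3 * ?t \<le> b"
  proof (cases "?t = 0")
    case True thus ?thesis using \<open>0 \<le> b\<close> by (simp only: True mult_zero_right)
  next
    case False
    hence "?t > 0" by linarith
    thus ?thesis using q by (simp only: mult_le_cancel_right_pos)
  qed
  moreover have "\<bar>x\<bar> \<le> ?t" using xyz by linarith
  ultimately have "(sin \<epsilon>)\<^sup>2 / 3 * \<bar>x\<bar> \<le> b"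
    using mult_left_mono[of "\<bar>x\<bar>" ?t "(sin \<epsilon>)\<^sup>2 / 3"] by fastforce
  thus "\<bar>\<alpha>' - \<alpha>\<bar> \<le> 3 / (sin \<epsilon>)\<^sup>2 * b" unfolding x_def[symmetric] using se by (simp add: field_simps)
qed

section \<open>Oscillation on a face and the abstract flux condition\<close>

definition osc :: "('v \<Rightarrow> real) \<Rightarrow> 'v set \<Rightarrow> real" where
  "osc u f = Max (u ` f) - Min (u ` f)"

lemma abs_diff_le_osc: "finite f \<Longrightarrow> i \<in> f \<Longrightarrow> j \<in> f \<Longrightarrow> \<bar>u i - u j\<bar> \<le> osc u f"
proof -
  assume f: "finite f" "i \<in> f" "j \<in> f"
  have "u i \<le> Max (u ` f)" "u j \<le> Max (u ` f)" "Min (u ` f) \<le> u i" "Min (u ` f) \<le> u j" using f by auto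
  thus ?thesis unfolding osc_def by linarith
qed

lemma osc_nonneg: "finite f \<Longrightarrow> f \<noteq> {} \<Longrightarrow> 0 \<le> osc u f"
  using abs_diff_le_osc[of f _ _ u] by (metis abs_ge_zero all_not_in_conv order_trans)

lemma osc_attained:
  assumes "finite f" "f \<noteq> {}"
  obtains i j where "i \<in> f" "j \<in> f" "osc u f = u i - u j" "u i = Max (u ` f)" "u j = Min (u ` f)"
proof -
  have "Max (u ` f) \<in> u ` f" "Min (u ` f) \<in> u ` f" using assms by (auto intro: Max_in Min_in)
  thus ?thesis using that unfolding osc_def by fastforce
qed

lemma osc_le:
  assumes "finite f" "f \<noteq> {}" "\<And>i j. i \<in> f \<Longrightarrow> j \<in> f \<Longrightarrow> \<bar>u i - u j\<bar> \<le> b"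
  shows "osc u f \<le> b"
  using osc_attained[OF assms(1,2), of u] assms(3) by (metis abs_ge_self order_trans)

text \<open>Interface between the triangle geometry and the elliptic estimates:
  \<open>\<delta>\<close> plays the role of a flux through the face, \<open>c\<close> is its
  ellipticity constant, \<open>C\<close> its upper bound, and \<open>M\<close> limits the jump of
  \<open>u\<close> across one face.\<close>

definition angle_var :: "real \<Rightarrow> real \<Rightarrow> real \<Rightarrow> ('v \<Rightarrow> real) \<Rightarrow> ('v \<Rightarrow> real) \<Rightarrow> 'v set \<Rightarrow> bool" where
  "angle_var c C M u \<delta> f \<longleftrightarrow> card f = 3 \<and> sum \<delta> f = 0 \<and> (\<forall>v\<in>f. \<bar>\<delta> v\<bar> \<le> C * osc u f) \<and>
     c * (osc u f)\<^sup>2 \<le> - (\<Sum>v\<in>f. \<delta> v * u v) \<and> osc u f \<le> M"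

lemma angle_varI:
  assumes e: "0 < \<epsilon>" and f: "card f = 3" and \<theta>: "\<And>v. v \<in> f \<Longrightarrow> \<epsilon> \<le> \<theta> v" "sum \<theta> f = pi"
    and \<theta>': "\<And>v. v \<in> f \<Longrightarrow> \<epsilon> \<le> \<theta>' v" "sum \<theta>' f = pi"
    and u: "\<And>v. v \<in> f \<Longrightarrow> u v = K - 2 * (ln (sin (\<theta>' v)) - ln (sin (\<theta> v)))"
  shows "angle_var ((sin \<epsilon>)^4 / 12) (3 / (sin \<epsilon>)\<^sup>2) (4 * pi / sin \<epsilon>) u (\<lambda>v. \<theta>' v - \<theta> v) f"
proof -
  have fin: "finite f" "f \<noteq> {}" using f by (auto intro: card_ge_0_finite)
  have third: "\<exists>k. k \<noteq> i \<and> k \<noteq> j \<and> f = {i, j, k}" if "i \<in> f" "j \<in> f" "i \<noteq> j" for i j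
  proof -
    have "card (f - {i, j}) = 1" using that f by (subst card_Diff_subset) auto
    then obtain k where "f - {i, j} = {k}" by (auto simp: card_1_singleton_iff)
    thus ?thesis using that by (intro exI[of _ k]) auto
  qed
  let ?D = "- (\<Sum>v\<in>f. (\<theta>' v - \<theta> v) * u v)"
  have se: "sin \<epsilon> > 0"
  proof -
    obtain i j k where "f = {i,j,k}" "i \<noteq> j" "j \<noteq> k" "i \<noteq> k" using f by (auto simp: card_3_iff)
    hence "\<epsilon> < pi" using \<theta>(1)[of i] \<theta>(1)[of j] \<theta>(1)[of k] \<theta>(2) e by simp
    thus ?thesis using e by (intro sin_gt_zero) auto
  qed
  have main: "(sin \<epsilon>)^4 / 12 * (u i - u j)\<^sup>2 \<le> ?D \<and> \<bar>u i - u j\<bar> \<le> 4 * pi / sin \<epsilon> \<and>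
      \<bar>\<theta>' i - \<theta> i\<bar> \<le> 3 / (sin \<epsilon>)\<^sup>2 * osc u f" if ij: "i \<in> f" "j \<in> f" "i \<noteq> j" for i j
  proof -
    obtain k where k: "k \<noteq> i" "k \<noteq> j" "f = {i, j, k}" using third[OF ij] by blast
    have s: "\<theta> i + \<theta> j + \<theta> k = pi" "\<theta>' i + \<theta>' j + \<theta>' k = pi"
      "?D = - ((\<theta>' i - \<theta> i) * u i + (\<theta>' j - \<theta> j) * u j + (\<theta>' k - \<theta> k) * u k)"
      using \<theta>(2) \<theta>'(2) k ij by (simp_all add: add.assoc)
    have kf: "k \<in> f" using k by simp
    note A = angle_variation_abs[OF e \<theta>(1)[OF ij(1)] \<theta>(1)[OF ij(2)] \<theta>(1)[OF kf] s(1)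
        \<theta>'(1)[OF ij(1)] \<theta>'(1)[OF ij(2)] \<theta>'(1)[OF kf] s(2) u[OF ij(1)] u[OF ij(2)] u[OF kf]]
    show ?thesis unfolding s(3)
      using A(2,3) A(4)[OF abs_diff_le_osc[OF fin(1) ij(1,2)] abs_diff_le_osc[OF fin(1) ij(1) kf]] by blast
  qed
  have D0: "0 \<le> ?D \<and> 0 \<le> 4 * pi / sin \<epsilon>"
  proof -
    obtain i j k where "f = {i,j,k}" "i \<noteq> j" using f by (auto simp: card_3_iff)
    hence "(sin \<epsilon>)^4 / 12 * (u i - u j)\<^sup>2 \<le> ?D" using main[of i j] by auto
    moreover have "0 \<le> (sin \<epsilon>)^4 / 12 * (u i - u j)\<^sup>2" by simp
    moreover have "0 \<le> 4 * pi / sin \<epsilon>" using se by simp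
    ultimately show ?thesis by linarith
  qed
  obtain i j where ij: "i \<in> f" "j \<in> f" "osc u f = u i - u j" using osc_attained[OF fin] by metis
  have "(sin \<epsilon>)^4 / 12 * (osc u f)\<^sup>2 \<le> ?D \<and> osc u f \<le> 4 * pi / sin \<epsilon>"
  proof (cases "i = j")
    case True thus ?thesis using ij D0 by simp
  next
    case False thus ?thesis using main[OF ij(1,2) False] ij(3) by auto
  qed
  moreover have "\<bar>\<theta>' v - \<theta> v\<bar> \<le> 3 / (sin \<epsilon>)\<^sup>2 * osc u f" if "v \<in> f" for v
  proof -
    have "f \<noteq> {v}" using f by auto
    then obtain j where "j \<in> f" "j \<noteq> v" using \<open>v \<in> f\<close> by blast
    thus ?thesis using main[of v j] \<open>v \<in> f\<close> by auto
  qed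
  ultimately show ?thesis unfolding angle_var_def using f \<theta> \<theta>' by (simp add: sum_subtractf)
qed

section \<open>Exponential test functions on a triangle\<close>

lemma Max_Min_exp:
  fixes u :: "'v \<Rightarrow> real"
  assumes "finite f" "f \<noteq> {}" "0 \<le> t"
  shows "Max ((\<lambda>v. exp (t * u v)) ` f) = exp (t * Max (u ` f))"
    and "Min ((\<lambda>v. exp (t * u v)) ` f) = exp (t * Min (u ` f))"
proof -
  have m: "mono (\<lambda>x. exp (t * x))" using assms(3) by (auto intro!: monoI mult_left_mono)
  have im: "(\<lambda>v. exp (t * u v)) ` f = (\<lambda>x. exp (t * x)) ` (u ` f)" by (simp add: image_image)
  show "Max ((\<lambda>v. exp (t * u v)) ` f) = exp (t * Max (u ` f))"
    "Min ((\<lambda>v. exp (t * u v)) ` f) = exp (t * Min (u ` f))"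
    unfolding im using mono_Max_commute[OF m] mono_Min_commute[OF m] assms by auto
qed

context
  fixes c C M \<epsilon> :: real and u \<delta> :: "'v \<Rightarrow> real" and f :: "'v set" and w :: "'v \<Rightarrow> real"
  assumes pos: "0 < c" "0 < C" "0 < M" and av: "angle_var c C M u \<delta> f"
    and eps: "0 < \<epsilon>" "\<epsilon> * M \<le> 1" "6 * C * \<epsilon> * M \<le> c"
  defines "w \<equiv> (\<lambda>v. exp (\<epsilon> / 2 * u v))"
begin

lemma fin_f: "finite f" "f \<noteq> {}"
  using av unfolding angle_var_def by (auto intro: card_ge_0_finite)

lemma osc_exp: "osc w f = exp (\<epsilon> / 2 * Min (u ` f)) * (exp (\<epsilon> / 2 * osc u f) - 1)"
proof -
  have "osc w f = exp (\<epsilon> / 2 * Max (u ` f)) - exp (\<epsilon> / 2 * Min (u ` f))"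
    unfolding osc_def w_def using Max_Min_exp[OF fin_f, of "\<epsilon>/2" u] eps by simp
  also have "exp (\<epsilon> / 2 * Max (u ` f)) = exp (\<epsilon> / 2 * Min (u ` f)) * exp (\<epsilon> / 2 * osc u f)"
    unfolding osc_def exp_add[symmetric] by (simp add: algebra_simps)
  finally show ?thesis by (simp add: algebra_simps)
qed

lemma eps_osc: "0 \<le> osc u f" "\<epsilon> * osc u f \<le> 1"
proof -
  show "0 \<le> osc u f" using osc_nonneg fin_f by metis
  have "\<epsilon> * osc u f \<le> \<epsilon> * M" using av eps unfolding angle_var_def by (intro mult_left_mono) auto
  thus "\<epsilon> * osc u f \<le> 1" using eps(2) by (rule order_trans)
qed

text \<open>Subsolution property of the exponential. Expand \<open>exp (\<epsilon> * u v)\<close> to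
  first order at the minimum of \<open>u\<close>: the constant term dies because
  \<open>\<delta>\<close> sums to zero, the linear term is coercive, and the condition
  \<open>6 * C * \<epsilon> * M \<le> c\<close> lets the quadratic remainder eat at most half of it.
  \<open>\<epsilon> * M \<le> 1\<close> validates the exponential bounds.\<close>

lemma exp_weighted_variation:
  "c / (2 * \<epsilon>) * (osc w f)\<^sup>2 \<le> - (\<Sum>v\<in>f. \<delta> v * exp (\<epsilon> * u v))"
proof -
  define m where "m = Min (u ` f)"
  define b where "b = osc u f"
  note A = av[unfolded angle_var_def, folded b_def]
  have b: "0 \<le> b" "\<epsilon> * b \<le> 1" using eps_osc unfolding b_def by auto
  have C0: "C * \<epsilon> * b * 6 \<le> c"
  proof -
    have "(6 * C * \<epsilon>) * b \<le> (6 * C * \<epsilon>) * M" using A pos eps by (intro mult_left_mono) auto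
    thus ?thesis using eps by (simp add: mult_ac)
  qed
  define \<rho> where "\<rho> v = exp (\<epsilon> * (u v - m)) - 1 - \<epsilon> * (u v - m)" for v
  have um: "0 \<le> u v - m" "u v - m \<le> b" if "v \<in> f" for v
    using that fin_f unfolding m_def b_def osc_def by auto
  have \<rho>: "\<bar>\<rho> v\<bar> \<le> (\<epsilon> * b)\<^sup>2" if "v \<in> f" for v
  proof -
    have 0: "0 \<le> \<epsilon> * (u v - m)" using um[OF that] eps by simp
    have 1: "\<epsilon> * (u v - m) \<le> \<epsilon> * b" using um[OF that] eps by (intro mult_left_mono) auto
    have "exp (\<epsilon> * (u v - m)) \<le> 1 + \<epsilon> * (u v - m) + (\<epsilon> * (u v - m))\<^sup>2"
      using 0 1 b by (intro exp_bound) auto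
    moreover have "1 + \<epsilon> * (u v - m) \<le> exp (\<epsilon> * (u v - m))" by (rule exp_ge_add_one_self)
    moreover have "(\<epsilon> * (u v - m))\<^sup>2 \<le> (\<epsilon> * b)\<^sup>2" using 0 1 by (intro power_mono) auto
    ultimately show ?thesis unfolding \<rho>_def by linarith
  qed
  have ex: "exp (\<epsilon> * u v) = exp (\<epsilon> * m) * (1 - \<epsilon> * m + \<epsilon> * u v + \<rho> v)" for v
  proof -
    have "1 - \<epsilon> * m + \<epsilon> * u v + \<rho> v = exp (\<epsilon> * (u v - m))" unfolding \<rho>_def by (simp add: algebra_simps)
    moreover have "\<epsilon> * u v = \<epsilon> * m + \<epsilon> * (u v - m)" by (simp add: algebra_simps)
    ultimately show ?thesis by (metis exp_add)
  qed
  have "(\<Sum>v\<in>f. \<delta> v * exp (\<epsilon> * u v)) =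
      (\<Sum>v\<in>f. exp (\<epsilon> * m) * ((1 - \<epsilon> * m) * \<delta> v + \<epsilon> * (\<delta> v * u v) + \<delta> v * \<rho> v))"
    unfolding ex by (intro sum.cong) (auto simp: algebra_simps)
  also have "\<dots> = exp (\<epsilon> * m) * ((1 - \<epsilon> * m) * sum \<delta> f + \<epsilon> * (\<Sum>v\<in>f. \<delta> v * u v) + (\<Sum>v\<in>f. \<delta> v * \<rho> v))"
    by (simp only: sum_distrib_left[symmetric] sum.distrib)
  finally have eq: "- (\<Sum>v\<in>f. \<delta> v * exp (\<epsilon> * u v)) =
      exp (\<epsilon> * m) * (\<epsilon> * - (\<Sum>v\<in>f. \<delta> v * u v) - (\<Sum>v\<in>f. \<delta> v * \<rho> v))"
    using A by (simp add: algebra_simps)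
  have "(\<Sum>v\<in>f. \<delta> v * \<rho> v) \<le> (\<Sum>v\<in>f. C * b * (\<epsilon> * b)\<^sup>2)"
  proof (rule sum_mono)
    fix v assume v: "v \<in> f"
    have "\<delta> v * \<rho> v \<le> \<bar>\<delta> v\<bar> * \<bar>\<rho> v\<bar>" by (simp flip: abs_mult)
    also have "\<dots> \<le> C * b * (\<epsilon> * b)\<^sup>2" using A v \<rho>[OF v] pos b by (intro mult_mono) auto
    finally show "\<delta> v * \<rho> v \<le> C * b * (\<epsilon> * b)\<^sup>2" .
  qed
  also have "\<dots> = \<epsilon> * b\<^sup>2 * (C * \<epsilon> * b * 3)" using A by (simp add: power2_eq_square mult_ac)
  also have "\<dots> \<le> \<epsilon> * b\<^sup>2 * (c / 2)" using C0 eps by (intro mult_left_mono) auto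
  finally have r: "(\<Sum>v\<in>f. \<delta> v * \<rho> v) \<le> \<epsilon> * b\<^sup>2 * (c / 2)" .
  have "\<epsilon> * (c * b\<^sup>2) \<le> \<epsilon> * - (\<Sum>v\<in>f. \<delta> v * u v)" using A eps by (intro mult_left_mono) auto
  hence "exp (\<epsilon> * m) * (\<epsilon> * b\<^sup>2 * (c / 2)) \<le> exp (\<epsilon> * m) * (\<epsilon> * - (\<Sum>v\<in>f. \<delta> v * u v) - (\<Sum>v\<in>f. \<delta> v * \<rho> v))"
    using r by (intro mult_left_mono) (auto simp: algebra_simps)
  hence low: "exp (\<epsilon> * m) * (\<epsilon> * b\<^sup>2 * (c / 2)) \<le> - (\<Sum>v\<in>f. \<delta> v * exp (\<epsilon> * u v))" unfolding eq .
  have "exp (\<epsilon> / 2 * b) \<le> 1 + \<epsilon> / 2 * b + (\<epsilon> / 2 * b)\<^sup>2" using b eps by (intro exp_bound) auto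
  also have "(\<epsilon> / 2 * b)\<^sup>2 \<le> \<epsilon> / 2 * b"
    unfolding power2_eq_square using b eps by (intro mult_left_le_one_le) auto
  finally have e1: "exp (\<epsilon> / 2 * b) - 1 \<le> \<epsilon> * b" by simp
  have "(osc w f)\<^sup>2 \<le> (exp (\<epsilon> / 2 * m) * (\<epsilon> * b))\<^sup>2"
    unfolding osc_exp b_def[symmetric] m_def[symmetric] using e1 b eps
    by (intro power_mono mult_left_mono mult_nonneg_nonneg) auto
  also have "\<dots> = exp (\<epsilon> * m) * (\<epsilon> * b)\<^sup>2"
    by (simp add: power_mult_distrib flip: exp_of_nat_mult)
  finally have "c / (2 * \<epsilon>) * (osc w f)\<^sup>2 \<le> c / (2 * \<epsilon>) * (exp (\<epsilon> * m) * (\<epsilon> * b)\<^sup>2)"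
    using pos eps by (intro mult_left_mono) auto
  also have "\<dots> = exp (\<epsilon> * m) * (\<epsilon> * b\<^sup>2 * (c / 2))" using eps by (simp add: field_simps power2_eq_square)
  finally show ?thesis using low by linarith
qed

text \<open>Discrete counterpart of the chain rule, by which \<open>w\<close> times the gradient of
  \<open>u\<close> is \<open>2 / \<epsilon>\<close> times the gradient of \<open>w\<close>; the
  remaining factor 3 bounds the ratio of \<open>w\<close> within the face.\<close>

lemma variation_times_exp_le:
  assumes "v \<in> f"
  shows "\<bar>\<delta> v\<bar> * Max (w ` f) \<le> 6 * C / \<epsilon> * osc w f"
proof -
  define m where "m = Min (u ` f)"
  define b where "b = osc u f"
  note A = av[unfolded angle_var_def, folded b_def]
  have b: "0 \<le> b" "\<epsilon> * b \<le> 1" using eps_osc unfolding b_def by auto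
  have Mx: "Max (w ` f) = exp (\<epsilon> / 2 * m) * exp (\<epsilon> / 2 * b)"
    unfolding w_def using Max_Min_exp(1)[OF fin_f, of "\<epsilon>/2" u] eps
    unfolding m_def b_def osc_def exp_add[symmetric] by (simp add: algebra_simps)
  have "exp (\<epsilon> / 2 * b) \<le> exp 1" using b by simp
  also have "exp 1 \<le> (3::real)" using exp_le by simp
  finally have e3: "exp (\<epsilon> / 2 * b) \<le> 3" .
  have "\<epsilon> / 2 * b \<le> exp (\<epsilon> / 2 * b) - 1" using exp_ge_add_one_self[of "\<epsilon> / 2 * b"] by linarith
  hence o: "exp (\<epsilon> / 2 * m) * (\<epsilon> / 2 * b) \<le> osc w f"
    unfolding osc_exp b_def[symmetric] m_def[symmetric] by (intro mult_left_mono) auto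
  have "\<bar>\<delta> v\<bar> * Max (w ` f) \<le> (C * b) * (exp (\<epsilon> / 2 * m) * 3)"
    unfolding Mx using A assms e3 pos b by (intro mult_mono) auto
  also have "\<dots> = 6 * C / \<epsilon> * (exp (\<epsilon> / 2 * m) * (\<epsilon> / 2 * b))" using eps by (simp add: field_simps)
  also have "\<dots> \<le> 6 * C / \<epsilon> * osc w f" using o pos eps by (intro mult_left_mono) auto
  finally show ?thesis .
qed

text \<open>Caccioppoli inequality on one face. Freezing \<open>\<zeta>\<close> at its minimum
  reduces the main term to \<open>exp_weighted_variation\<close>; the error in
  \<open>\<zeta>\<^sup>2\<close> is at most \<open>2 * b * m + b\<^sup>2\<close>, and its part
  linear in \<open>b\<close> is absorbed by Young's inequality.\<close>

lemma exp_weighted_variation_cutoff: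
  assumes z0: "\<And>v. v \<in> f \<Longrightarrow> 0 \<le> \<zeta> v"
  shows "c / (4 * \<epsilon>) * (Min (\<zeta> ` f))\<^sup>2 * (osc w f)\<^sup>2
     - (3 * C * M + 1296 * C\<^sup>2 / (c * \<epsilon>)) * (osc \<zeta> f)\<^sup>2 * (Max (w ` f))\<^sup>2
     \<le> - (\<Sum>v\<in>f. \<delta> v * (\<zeta> v)\<^sup>2 * exp (\<epsilon> * u v))"
proof -
  define m where "m = Min (\<zeta> ` f)"
  define b where "b = osc \<zeta> f"
  define W where "W = Max (w ` f)"
  define \<omega> where "\<omega> = osc w f"
  have m0: "0 \<le> m" unfolding m_def using z0 fin_f by (auto simp: Min_ge_iff)
  have b0: "0 \<le> b" unfolding b_def using osc_nonneg fin_f by metis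
  have o0: "0 \<le> \<omega>" unfolding \<omega>_def using osc_nonneg fin_f by metis
  have W: "w v \<le> W" if "v \<in> f" for v unfolding W_def using that fin_f by auto
  have W0: "0 \<le> W"
  proof -
    obtain v where v: "v \<in> f" using fin_f by blast
    have "0 \<le> w v" unfolding w_def by simp
    thus ?thesis using W[OF v] by simp
  qed
  have ew: "exp (\<epsilon> * u v) = (w v)\<^sup>2" for v unfolding w_def by (simp flip: exp_of_nat_mult)
  have zm: "0 \<le> \<zeta> v - m" "\<zeta> v - m \<le> b" if "v \<in> f" for v
    using that fin_f unfolding m_def b_def osc_def by auto
  have f3: "card f = 3" using av unfolding angle_var_def by simp
  have tm: "\<delta> v * ((\<zeta> v)\<^sup>2 - m\<^sup>2) * exp (\<epsilon> * u v) \<le> 12 * C / \<epsilon> * \<omega> * W * (b * m) + C * M * (b\<^sup>2 * W\<^sup>2)"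
    if v: "v \<in> f" for v
  proof -
    have d1: "\<bar>\<delta> v\<bar> * W \<le> 6 * C / \<epsilon> * \<omega>" using variation_times_exp_le[OF v] unfolding W_def \<omega>_def .
    have d2: "\<bar>\<delta> v\<bar> \<le> C * M"
    proof -
      have "\<bar>\<delta> v\<bar> \<le> C * osc u f" "C * osc u f \<le> C * M"
        using av v pos unfolding angle_var_def by auto
      thus ?thesis by simp
    qed
    have q: "(\<zeta> v)\<^sup>2 - m\<^sup>2 \<le> 2 * (b * m) + b\<^sup>2" "0 \<le> (\<zeta> v)\<^sup>2 - m\<^sup>2"
    proof -
      have "(\<zeta> v)\<^sup>2 - m\<^sup>2 = (\<zeta> v - m) * (2 * m) + (\<zeta> v - m)\<^sup>2" by (simp add: power2_eq_square algebra_simps)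
      moreover have "(\<zeta> v - m) * (2 * m) \<le> b * (2 * m)" "0 \<le> (\<zeta> v - m) * (2 * m)" "(\<zeta> v - m)\<^sup>2 \<le> b\<^sup>2"
        using zm[OF v] m0 by (auto intro!: mult_right_mono power_mono)
      ultimately show "(\<zeta> v)\<^sup>2 - m\<^sup>2 \<le> 2 * (b * m) + b\<^sup>2" "0 \<le> (\<zeta> v)\<^sup>2 - m\<^sup>2" by auto
    qed
    have "\<delta> v * ((\<zeta> v)\<^sup>2 - m\<^sup>2) * exp (\<epsilon> * u v) \<le> \<bar>\<delta> v\<bar> * (2 * (b * m) + b\<^sup>2) * W\<^sup>2"
      unfolding ew using q W[OF v] W0
      by (intro mult_mono power_mono) (auto simp: w_def b0 m0)
    also have "\<dots> = (\<bar>\<delta> v\<bar> * W) * (W * (2 * (b * m))) + \<bar>\<delta> v\<bar> * (b\<^sup>2 * W\<^sup>2)"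
      by (simp add: power2_eq_square algebra_simps)
    also have "\<dots> \<le> (6 * C / \<epsilon> * \<omega>) * (W * (2 * (b * m))) + C * M * (b\<^sup>2 * W\<^sup>2)"
      using d1 d2 W0 b0 m0 by (intro add_mono mult_right_mono) auto
    finally show ?thesis by (simp add: algebra_simps)
  qed
  have "(\<Sum>v\<in>f. \<delta> v * (\<zeta> v)\<^sup>2 * exp (\<epsilon> * u v)) =
      m\<^sup>2 * (\<Sum>v\<in>f. \<delta> v * exp (\<epsilon> * u v)) + (\<Sum>v\<in>f. \<delta> v * ((\<zeta> v)\<^sup>2 - m\<^sup>2) * exp (\<epsilon> * u v))"
    unfolding sum_distrib_left sum.distrib[symmetric] by (intro sum.cong) (auto simp: algebra_simps)
  also have "\<dots> \<le> m\<^sup>2 * - (c / (2 * \<epsilon>) * \<omega>\<^sup>2) + (\<Sum>v\<in>f. 12 * C / \<epsilon> * \<omega> * W * (b * m) + C * M * (b\<^sup>2 * W\<^sup>2))"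
    using exp_weighted_variation tm unfolding \<omega>_def
    by (intro add_mono mult_left_mono sum_mono) auto
  also have "\<dots> = - (c / (2 * \<epsilon>) * m\<^sup>2 * \<omega>\<^sup>2) + (36 * C / \<epsilon> * \<omega> * W * (b * m) + 3 * C * M * (b\<^sup>2 * W\<^sup>2))"
    using f3 by (simp add: algebra_simps)
  finally have S: "(\<Sum>v\<in>f. \<delta> v * (\<zeta> v)\<^sup>2 * exp (\<epsilon> * u v)) \<le>
     - (c / (2 * \<epsilon>) * m\<^sup>2 * \<omega>\<^sup>2) + (36 * C / \<epsilon> * \<omega> * W * (b * m) + 3 * C * M * (b\<^sup>2 * W\<^sup>2))" .
  have "36 * C / \<epsilon> * \<omega> * W * (b * m) \<le> c / (4 * \<epsilon>) * m\<^sup>2 * \<omega>\<^sup>2 + 1296 * C\<^sup>2 / (c * \<epsilon>) * (b\<^sup>2 * W\<^sup>2)"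
  proof -
    \<comment> \<open>The square is weighted so that division by \<open>4 * c * \<epsilon>\<close>
      spends exactly half of the coercive term.\<close>
    have "0 \<le> (c * m * \<omega> - 72 * C * (b * W))\<^sup>2" by simp
    hence "144 * c * C * (m * \<omega> * b * W) \<le> c\<^sup>2 * (m\<^sup>2 * \<omega>\<^sup>2) + 5184 * C\<^sup>2 * (b\<^sup>2 * W\<^sup>2)"
      by (simp add: power2_eq_square algebra_simps)
    hence "144 * c * C * (m * \<omega> * b * W) / (4 * c * \<epsilon>) \<le> (c\<^sup>2 * (m\<^sup>2 * \<omega>\<^sup>2) + 5184 * C\<^sup>2 * (b\<^sup>2 * W\<^sup>2)) / (4 * c * \<epsilon>)"
      using pos eps by (intro divide_right_mono) auto
    thus ?thesis using pos eps by (simp add: field_simps power2_eq_square)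
  qed
  with S have "(\<Sum>v\<in>f. \<delta> v * (\<zeta> v)\<^sup>2 * exp (\<epsilon> * u v)) \<le>
     - (c / (2 * \<epsilon>) * m\<^sup>2 * \<omega>\<^sup>2) + c / (4 * \<epsilon>) * m\<^sup>2 * \<omega>\<^sup>2 + (3 * C * M + 1296 * C\<^sup>2 / (c * \<epsilon>)) * (b\<^sup>2 * W\<^sup>2)"
    by (simp add: algebra_simps)
  also have "- (c / (2 * \<epsilon>) * m\<^sup>2 * \<omega>\<^sup>2) + c / (4 * \<epsilon>) * m\<^sup>2 * \<omega>\<^sup>2 = - (c / (4 * \<epsilon>) * m\<^sup>2 * \<omega>\<^sup>2)"
    using eps by (simp add: field_simps)
  finally show ?thesis unfolding m_def[symmetric] b_def[symmetric] W_def[symmetric] \<omega>_def[symmetric]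
    by (simp add: algebra_simps)
qed

end

section \<open>Euclidean triangles in the complex plane\<close>

definition cross :: "complex \<Rightarrow> complex \<Rightarrow> real" where
  "cross p q = Im (cnj p * q)"

definition vangle :: "complex \<Rightarrow> complex \<Rightarrow> real" where
  "vangle p q = arccos (Re (cnj p * q) / (cmod p * cmod q))"

lemma cross_eq: "cross p q = Re p * Im q - Im p * Re q"
  by (simp add: cross_def)

lemma cross_le: "\<bar>cross p q\<bar> \<le> cmod p * cmod q"
  unfolding cross_def using abs_Im_le_cmod[of "cnj p * q"] by (simp add: norm_mult)

lemma cross_commute: "cross q p = - cross p q"
  by (simp add: cross_eq)

lemma vangle_commute: "vangle q p = vangle p q"
proof -
  have "Re (cnj q * p) = Re (cnj p * q)" by simp
  thus ?thesis unfolding vangle_def by (simp add: mult.commute)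
qed

lemma Re_cnj_le: "\<bar>Re (cnj p * q)\<bar> \<le> cmod p * cmod q"
  using abs_Re_le_cmod[of "cnj p * q"] by (simp add: norm_mult)

lemma vangle_arg_bounds: "-1 \<le> Re (cnj p * q) / (cmod p * cmod q)" "Re (cnj p * q) / (cmod p * cmod q) \<le> 1"
proof -
  have "\<bar>Re (cnj p * q) / (cmod p * cmod q)\<bar> \<le> 1"
    unfolding abs_divide using Re_cnj_le[of p q]
    by (simp only: abs_mult abs_norm_cancel) (rule divide_le_eq_1[THEN iffD2], smt (verit) norm_ge_zero mult_nonneg_nonneg)
  thus "-1 \<le> Re (cnj p * q) / (cmod p * cmod q)" "Re (cnj p * q) / (cmod p * cmod q) \<le> 1" by linarith+
qed

lemma cos_vangle: "cos (vangle p q) = Re (cnj p * q) / (cmod p * cmod q)"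
  unfolding vangle_def using vangle_arg_bounds by (intro cos_arccos)

lemma vangle_bounds: "0 \<le> vangle p q" "vangle p q \<le> pi"
  unfolding vangle_def using vangle_arg_bounds by (auto intro!: arccos_lbound arccos_ubound)

lemma sin_vangle:
  assumes "p \<noteq> 0" "q \<noteq> 0"
  shows "sin (vangle p q) = \<bar>cross p q\<bar> / (cmod p * cmod q)"
proof -
  let ?n = "cmod p * cmod q"
  have n: "?n > 0" using assms by simp
  have sq: "(Re (cnj p * q))\<^sup>2 + (cross p q)\<^sup>2 = ?n\<^sup>2"
    unfolding cross_def using cmod_power2[of "cnj p * q"] by (simp add: norm_mult)
  have "(sin (vangle p q))\<^sup>2 = 1 - (Re (cnj p * q) / ?n)\<^sup>2"
    unfolding sin_squared_eq cos_vangle ..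
  also have "\<dots> = (?n\<^sup>2 - (Re (cnj p * q))\<^sup>2) / ?n\<^sup>2" using assms by (simp add: power_divide diff_divide_distrib)
  also have "\<dots> = (\<bar>cross p q\<bar> / ?n)\<^sup>2" using sq by (simp add: power_divide)
  finally have "(sin (vangle p q))\<^sup>2 = (\<bar>cross p q\<bar> / ?n)\<^sup>2" .
  moreover have "0 \<le> sin (vangle p q)" using vangle_bounds by (rule sin_ge_zero)
  moreover have "0 \<le> \<bar>cross p q\<bar> / ?n" by simp
  ultimately show ?thesis by (rule power2_eq_imp_eq)
qed

lemma inner_angle_eq_vangle:
  "inner_angle (\<lambda>i j. cmod (z i - z j)) i j k = vangle (z j - z i) (z k - z i)"
proof -
  define R where "R = Re (cnj (z j - z i) * (z k - z i))"
  have "((cmod (z i - z j))\<^sup>2 + (cmod (z i - z k))\<^sup>2 - (cmod (z j - z k))\<^sup>2) = 2 * R"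
    unfolding R_def cmod_power2 by (simp add: power2_eq_square algebra_simps)
  thus ?thesis unfolding inner_angle_def vangle_def R_def[symmetric]
    by (simp add: norm_minus_commute[of "z j" "z i"] norm_minus_commute[of "z k" "z i"] mult.assoc)
qed

lemma cross_vertices:
  "cross (c - b) (a - b) = cross (b - a) (c - a)" "cross (a - c) (b - c) = cross (b - a) (c - a)"
  by (simp_all add: cross_eq algebra_simps)

text \<open>Each \<open>cis\<close> of an angle is a normalised quotient of edge vectors, and around
  the triangle the three multiply to -1. Hence the sum is \<open>pi\<close> modulo
  \<open>2 * pi\<close>; as each angle lies strictly between 0 and \<open>pi\<close>, no other
  multiple is possible.\<close>

lemma vangle_sum_pos:
  assumes "cross (b - a) (c - a) > 0"
  shows "vangle (b - a) (c - a) + vangle (c - b) (a - b) + vangle (a - c) (b - c) = pi"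
proof -
  have ne: "a \<noteq> b" "b \<noteq> c" "a \<noteq> c" using assms by (auto simp: cross_eq)
  have cs: "cis (vangle p q) = cnj p * q / of_real (cmod p * cmod q)"
    if "p \<noteq> 0" "q \<noteq> 0" "cross p q > 0" for p q
  proof (rule complex_eqI)
    show "Re (cis (vangle p q)) = Re (cnj p * q / of_real (cmod p * cmod q))"
      unfolding Re_divide_of_real by (simp add: cos_vangle)
    show "Im (cis (vangle p q)) = Im (cnj p * q / of_real (cmod p * cmod q))"
      unfolding Im_divide_of_real using that sin_vangle[OF that(1,2)] by (simp add: cross_def)
  qed
  have sp: "vangle p q > 0 \<and> vangle p q < pi" if "p \<noteq> 0" "q \<noteq> 0" "cross p q > 0" for p q
  proof -
    have "sin (vangle p q) > 0" using sin_vangle[OF that(1,2)] that by simp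
    hence "vangle p q \<noteq> 0" "vangle p q \<noteq> pi" by auto
    thus ?thesis using vangle_bounds[of p q] by auto
  qed
  let ?x = "vangle (b - a) (c - a)" and ?y = "vangle (c - b) (a - b)" and ?t = "vangle (a - c) (b - c)"
  have c3: "cross (c - b) (a - b) > 0" "cross (a - c) (b - c) > 0" using assms cross_vertices by auto
  have "cis (?x + ?y + ?t) = cis ?x * cis ?y * cis ?t" by (simp add: cis_mult)
  also have "\<dots> = (cnj (b - a) * (c - a) * (cnj (c - b) * (a - b)) * (cnj (a - c) * (b - c))) /
      (of_real (cmod (b - a) * cmod (c - a)) * of_real (cmod (c - b) * cmod (a - b)) * of_real (cmod (a - c) * cmod (b - c)))"
    using ne assms c3 by (subst (1 2 3) cs) auto
  also have "cnj (b - a) * (c - a) * (cnj (c - b) * (a - b)) * (cnj (a - c) * (b - c)) =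
      - (((a - b) * cnj (a - b)) * ((c - b) * cnj (c - b)) * ((a - c) * cnj (a - c)))"
    by (simp add: algebra_simps)
  also have "\<dots> = - of_real ((cmod (a - b))\<^sup>2 * (cmod (c - b))\<^sup>2 * (cmod (a - c))\<^sup>2)"
    unfolding complex_norm_square[symmetric] by simp
  also have "of_real (cmod (b - a) * cmod (c - a)) * of_real (cmod (c - b) * cmod (a - b)) * of_real (cmod (a - c) * cmod (b - c))
      = (of_real ((cmod (a - b))\<^sup>2 * (cmod (c - b))\<^sup>2 * (cmod (a - c))\<^sup>2) :: complex)"
    by (simp add: norm_minus_commute[of b a] norm_minus_commute[of c a] norm_minus_commute[of b c] power2_eq_square)
  also have "- (of_real ((cmod (a - b))\<^sup>2 * (cmod (c - b))\<^sup>2 * (cmod (a - c))\<^sup>2) :: complex) /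
      of_real ((cmod (a - b))\<^sup>2 * (cmod (c - b))\<^sup>2 * (cmod (a - c))\<^sup>2) = -1"
    using ne by simp
  finally have "Re (cis (?x + ?y + ?t)) = Re (-1)" by (rule arg_cong)
  hence "cos (?x + ?y + ?t - pi) = 1" by simp
  then obtain n :: int where n: "?x + ?y + ?t - pi = n * (2 * pi)" unfolding cos_one_2pi_int by (metis mult.assoc)
  have "?x + ?y + ?t - pi > - (2 * pi)" "?x + ?y + ?t - pi < 2 * pi"
    using sp[of "b - a" "c - a"] sp[of "c - b" "a - b"] sp[of "a - c" "b - c"] ne assms c3 by auto
  hence n2: "- (2 * pi) < of_int n * (2 * pi)" "of_int n * (2 * pi) < 2 * pi" unfolding n by auto
  have "(of_int (-1) :: real) < of_int n"
    by (rule mult_right_less_imp_less[of _ "2 * pi"]) (use n2 in simp_all)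
  moreover have "(of_int n :: real) < of_int 1"
    by (rule mult_right_less_imp_less[of _ "2 * pi"]) (use n2 in simp_all)
  ultimately have "n = 0" unfolding of_int_less_iff by simp
  thus ?thesis using n by simp
qed

lemma vangle_sum:
  assumes "cross (b - a) (c - a) \<noteq> 0"
  shows "vangle (b - a) (c - a) + vangle (c - b) (a - b) + vangle (a - c) (b - c) = pi"
proof (cases "cross (b - a) (c - a) > 0")
  case True thus ?thesis by (rule vangle_sum_pos)
next
  case False
  hence "cross (c - a) (b - a) > 0" using assms cross_commute[of "c - a" "b - a"] by simp
  from vangle_sum_pos[OF this] show ?thesis
    by (simp add: vangle_commute[of "b - a"] vangle_commute[of "c - b"] vangle_commute[of "a - c"])
qed

text \<open>A positive angle in a collinear triangle is \<open>pi\<close>, which makes its vertex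
  lie between the other two. This cannot happen at two vertices at once.\<close>

lemma cross_nonzero:
  assumes ne: "a \<noteq> b" "b \<noteq> c" "a \<noteq> c"
    and pos: "vangle (b - a) (c - a) > 0" "vangle (c - b) (a - b) > 0"
  shows "cross (b - a) (c - a) \<noteq> 0"
proof
  assume 0: "cross (b - a) (c - a) = 0"
  have add: "cmod (q - p) = cmod p + cmod q" if "p \<noteq> 0" "q \<noteq> 0" "cross p q = 0" "vangle p q > 0" for p q
  proof -
    have "sin (vangle p q) = 0" using sin_vangle[OF that(1,2)] that by simp
    hence "vangle p q = pi" using that vangle_bounds[of p q]
      by (metis order_less_le sin_gt_zero)
    hence "Re (cnj p * q) / (cmod p * cmod q) = -1" using cos_vangle[of p q] by simp
    hence R: "Re (cnj p * q) = - (cmod p * cmod q)" using that by (simp add: field_simps)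
    have "(cmod (q - p))\<^sup>2 = (cmod p)\<^sup>2 + (cmod q)\<^sup>2 - 2 * Re (cnj p * q)"
      unfolding cmod_power2 by (simp add: power2_eq_square algebra_simps)
    also have "\<dots> = (cmod p + cmod q)\<^sup>2" unfolding R by (simp add: power2_eq_square algebra_simps)
    finally show ?thesis by (rule power2_eq_imp_eq) auto
  qed
  have "cmod ((c - a) - (b - a)) = cmod (b - a) + cmod (c - a)" using add[of "b - a" "c - a"] 0 ne pos by auto
  moreover have "cmod ((a - b) - (c - b)) = cmod (c - b) + cmod (a - b)"
    using add[of "c - b" "a - b"] 0 cross_vertices[of c b a] ne pos by auto
  moreover have "cmod (b - a) > 0" using ne by simp
  ultimately show False by (simp add: norm_minus_commute[of a])
qed

section \<open>Faces as vertex sets\<close>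

text \<open>Angle at \<open>v\<close> and barycentric coordinate of \<open>v\<close> for a three-element vertex set \<open>f\<close>; the
  two other vertices are picked in an arbitrary order, on which the value does not depend.\<close>

definition opp :: "'v set \<Rightarrow> 'v \<Rightarrow> 'v \<times> 'v" where
  "opp f v = (SOME p. f = {v, fst p, snd p} \<and> v \<noteq> fst p \<and> v \<noteq> snd p \<and> fst p \<noteq> snd p)"

definition fang :: "('v \<Rightarrow> complex) \<Rightarrow> 'v set \<Rightarrow> 'v \<Rightarrow> real" where
  "fang z f v = vangle (z (fst (opp f v)) - z v) (z (snd (opp f v)) - z v)"

definition bary :: "('v \<Rightarrow> complex) \<Rightarrow> 'v set \<Rightarrow> 'v \<Rightarrow> complex \<Rightarrow> real" where
  "bary z f v p = cross (z (fst (opp f v)) - p) (z (snd (opp f v)) - p) /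
     cross (z (fst (opp f v)) - z v) (z (snd (opp f v)) - z v)"

definition fdiam :: "('v \<Rightarrow> complex) \<Rightarrow> 'v set \<Rightarrow> real" where
  "fdiam z f = Max ((\<lambda>(i, j). cmod (z i - z j)) ` (f \<times> f))"

lemma opp_cases:
  assumes "f = {v, j, k}" "v \<noteq> j" "v \<noteq> k" "j \<noteq> k"
  shows "opp f v = (j, k) \<or> opp f v = (k, j)"
proof -
  define P where "P p \<longleftrightarrow> f = {v, fst p, snd p} \<and> v \<noteq> fst p \<and> v \<noteq> snd p \<and> fst p \<noteq> snd p" for p
  have "P (j, k)" unfolding P_def using assms by auto
  hence "P (Eps P)" by (rule someI)
  moreover have "opp f v = Eps P" unfolding opp_def by (simp only: P_def[abs_def])
  ultimately have "P (opp f v)" by simp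
  moreover obtain a b where ab: "opp f v = (a, b)" by (cases "opp f v")
  ultimately have "{v, a, b} = {v, j, k}" "v \<noteq> a" "v \<noteq> b" "a \<noteq> b" unfolding P_def using assms(1) by auto
  hence "{a, b} = {j, k}" using assms(2-4) by (auto simp: insert_eq_iff)
  thus ?thesis unfolding ab by (auto simp: doubleton_eq_iff)
qed

lemma fang_eq:
  assumes "f = {v, j, k}" "v \<noteq> j" "v \<noteq> k" "j \<noteq> k"
  shows "fang z f v = vangle (z j - z v) (z k - z v)"
  unfolding fang_def using opp_cases[OF assms] vangle_commute by auto

lemma bary_eq:
  assumes "f = {v, j, k}" "v \<noteq> j" "v \<noteq> k" "j \<noteq> k"
  shows "bary z f v p = cross (z j - p) (z k - p) / cross (z j - z v) (z k - z v)"
  unfolding bary_def using opp_cases[OF assms]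
  by (auto simp: cross_commute[of "z j - p"] cross_commute[of "z j - z v"])

lemma face_third:
  assumes f: "card f = 3" "i \<in> f" "j \<in> f" "i \<noteq> j"
  obtains k where "k \<noteq> i" "k \<noteq> j" "f = {i, j, k}"
proof -
  have "card (f - {i, j}) = 1" using f by (subst card_Diff_subset) auto
  then obtain k where "f - {i, j} = {k}" by (auto simp: card_1_singleton_iff)
  thus ?thesis using that[of k] f by auto
qed

lemma face_others:
  assumes "card f = 3" "v \<in> f"
  obtains j k where "f = {v, j, k}" "v \<noteq> j" "v \<noteq> k" "j \<noteq> k"
proof -
  have "f \<noteq> {v}" using assms by auto
  then obtain j where "j \<in> f" "j \<noteq> v" using assms(2) by blast
  then obtain k where "k \<noteq> v" "k \<noteq> j" "f = {v, j, k}" using face_third[of f v j] assms by metis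
  thus ?thesis using that \<open>j \<noteq> v\<close> by metis
qed

lemma mem_hull_image_iff:
  fixes z :: "'v \<Rightarrow> complex"
  assumes "finite g" "inj_on z g"
  shows "p \<in> convex hull (z ` g) \<longleftrightarrow> (\<exists>c. (\<forall>v\<in>g. 0 \<le> c v) \<and> sum c g = 1 \<and> (\<Sum>v\<in>g. c v *\<^sub>R z v) = p)"
proof
  assume "p \<in> convex hull (z ` g)"
  then obtain c where c: "\<forall>x\<in>z ` g. 0 \<le> c x" "sum c (z ` g) = 1" "(\<Sum>x\<in>z ` g. c x *\<^sub>R x) = p"
    using assms by (auto simp: convex_hull_finite)
  thus "\<exists>c. (\<forall>v\<in>g. 0 \<le> c v) \<and> sum c g = 1 \<and> (\<Sum>v\<in>g. c v *\<^sub>R z v) = p"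
    using assms by (intro exI[of _ "c \<circ> z"]) (auto simp: sum.reindex)
next
  assume "\<exists>c. (\<forall>v\<in>g. 0 \<le> c v) \<and> sum c g = 1 \<and> (\<Sum>v\<in>g. c v *\<^sub>R z v) = p"
  then obtain c where c: "\<forall>v\<in>g. 0 \<le> c v" "sum c g = 1" "(\<Sum>v\<in>g. c v *\<^sub>R z v) = p" by blast
  thus "p \<in> convex hull (z ` g)"
    using convex_sum[OF assms(1) convex_convex_hull c(2), of z "z ` g"] hull_subset[of "z ` g" convex]
    by (auto simp: hull_inc)
qed

lemma fdiam_ge: "finite f \<Longrightarrow> i \<in> f \<Longrightarrow> j \<in> f \<Longrightarrow> cmod (z i - z j) \<le> fdiam z f"
  unfolding fdiam_def by (rule Max_ge) auto

lemma fdiam_le: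
  assumes "finite f" "f \<noteq> {}" "\<And>i j. i \<in> f \<Longrightarrow> j \<in> f \<Longrightarrow> cmod (z i - z j) \<le> b"
  shows "fdiam z f \<le> b"
  unfolding fdiam_def using assms by (subst Max_le_iff) auto

lemma dist_hull_le_fdiam:
  assumes "finite f" "p \<in> convex hull (z ` f)" "q \<in> convex hull (z ` f)"
  shows "cmod (p - q) \<le> fdiam z f"
proof -
  have 1: "convex hull (z ` f) \<subseteq> cball (z i) (fdiam z f)" if "i \<in> f" for i
    using fdiam_ge[OF assms(1) that] by (intro hull_minimal) (auto simp: dist_norm)
  have "convex hull (z ` f) \<subseteq> cball p (fdiam z f)"
    using 1 assms(2) by (intro hull_minimal) (force simp: dist_commute)+
  thus ?thesis using assms(3) by (auto simp: dist_norm)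
qed

text \<open>Injectivity is stated separately because \<open>vangle\<close> of zero vectors is
  \<open>arccos 0\<close>: a triangle collapsed to a point would satisfy an angle bound.\<close>

locale fat_face =
  fixes z :: "'v \<Rightarrow> complex" and f :: "'v set" and \<epsilon> :: real
  assumes card3: "card f = 3" and inj: "inj_on z f" and eps: "0 < \<epsilon>"
    and fat: "\<And>v. v \<in> f \<Longrightarrow> \<epsilon> \<le> fang z f v"
begin

lemma fin: "finite f" "f \<noteq> {}" using card3 by (auto intro: card_ge_0_finite)

lemma cross_ne:
  assumes "f = {a, b, c}" "a \<noteq> b" "a \<noteq> c" "b \<noteq> c"
  shows "cross (z b - z a) (z c - z a) \<noteq> 0"
proof (rule cross_nonzero)
  show "z a \<noteq> z b" "z b \<noteq> z c" "z a \<noteq> z c" using inj assms by (auto dest: inj_onD)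
  show "0 < vangle (z b - z a) (z c - z a)" using fat[of a] fang_eq[OF assms, of z] assms eps by auto
  have "fang z f b = vangle (z c - z b) (z a - z b)" by (rule fang_eq) (use assms in auto)
  thus "0 < vangle (z c - z b) (z a - z b)" using fat[of b] assms eps by auto
qed

lemma angle_sum: "sum (fang z f) f = pi"
proof -
  obtain a b c where f: "f = {a, b, c}" "a \<noteq> b" "a \<noteq> c" "b \<noteq> c" using card3 by (auto simp: card_3_iff)
  have "fang z f a = vangle (z b - z a) (z c - z a)" "fang z f b = vangle (z c - z b) (z a - z b)"
    "fang z f c = vangle (z a - z c) (z b - z c)"
    by (rule fang_eq; use f in auto)+
  thus ?thesis using vangle_sum[OF cross_ne[OF f]] f by simp
qed

lemma fang_le: "v \<in> f \<Longrightarrow> fang z f v \<le> pi - \<epsilon>"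
proof -
  assume v: "v \<in> f"
  then obtain j k where f: "f = {v, j, k}" "v \<noteq> j" "v \<noteq> k" "j \<noteq> k" using face_others[OF card3] by metis
  have "fang z f v + fang z f j + fang z f k = pi" using angle_sum f by simp
  thus ?thesis using fat[of j] fat[of k] f eps by auto
qed

lemma sin_eps_pos: "0 < sin \<epsilon>"
proof -
  obtain v where v: "v \<in> f" using fin by blast
  show ?thesis using fat[OF v] fang_le[OF v] eps by (intro sin_gt_zero) auto
qed

lemma sin_fang_ge: "v \<in> f \<Longrightarrow> sin \<epsilon> \<le> sin (fang z f v)"
  using fat fang_le eps by (intro sin_between_ge) auto

text \<open>\<open>\<kappa>\<close> is the diameter of the circumscribed circle, the product of the
  sides over twice the area.\<close>

lemma sine_law:
  obtains \<kappa> where "\<kappa> > 0" "\<And>v j k. f = {v, j, k} \<Longrightarrow> v \<noteq> j \<Longrightarrow> v \<noteq> k \<Longrightarrow> j \<noteq> k \<Longrightarrow>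
    cmod (z j - z k) = \<kappa> * sin (fang z f v)"
proof -
  obtain a b c where f: "f = {a, b, c}" "a \<noteq> b" "a \<noteq> c" "b \<noteq> c" using card3 by (auto simp: card_3_iff)
  have ne: "z a \<noteq> z b" "z b \<noteq> z c" "z a \<noteq> z c" using inj f by (auto dest: inj_onD)
  let ?d = "\<bar>cross (z b - z a) (z c - z a)\<bar>"
  define \<kappa> where "\<kappa> = cmod (z b - z a) * cmod (z c - z a) * cmod (z b - z c) / ?d"
  have d: "?d > 0" using cross_ne[OF f] by simp
  have k: "\<kappa> > 0" unfolding \<kappa>_def using d ne by simp
  have fe: "fang z f a = vangle (z b - z a) (z c - z a)" "fang z f b = vangle (z c - z b) (z a - z b)"
    "fang z f c = vangle (z a - z c) (z b - z c)"
    by (rule fang_eq; use f in auto)+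
  have A: "cmod (z b - z c) = \<kappa> * sin (fang z f a)"
    unfolding fe \<kappa>_def using ne d by (subst sin_vangle) auto
  have B: "cmod (z a - z c) = \<kappa> * sin (fang z f b)"
    unfolding fe \<kappa>_def using ne d cross_vertices(1)[of "z c" "z b" "z a"]
    by (subst sin_vangle) (auto simp: norm_minus_commute[of "z b" "z a"] norm_minus_commute[of "z c" "z a"]
        norm_minus_commute[of "z c" "z b"])
  have C: "cmod (z a - z b) = \<kappa> * sin (fang z f c)"
    unfolding fe \<kappa>_def using ne d cross_vertices(2)[of "z a" "z c" "z b"]
    by (subst sin_vangle) (auto simp: norm_minus_commute[of "z b" "z a"] norm_minus_commute[of "z c" "z a"]
        norm_minus_commute[of "z c" "z b"])
  show ?thesis
  proof (rule that[OF k])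
    fix v j k assume g: "f = {v, j, k}" "v \<noteq> j" "v \<noteq> k" "j \<noteq> k"
    have "v \<in> {a, b, c}" "j \<in> {a, b, c}" "k \<in> {a, b, c}" unfolding f(1)[symmetric] g(1) by simp_all
    thus "cmod (z j - z k) = \<kappa> * sin (fang z f v)"
      using A B C g(2-4) by (auto simp: norm_minus_commute)
  qed
qed

lemma fdiam_pos: "0 < fdiam z f"
proof -
  obtain a b c where f: "f = {a, b, c}" "a \<noteq> b" using card3 by (auto simp: card_3_iff)
  have "a \<in> f" "b \<in> f" unfolding f(1) by simp_all
  moreover from this have "0 < cmod (z a - z b)" using inj f(2) by (auto dest: inj_onD)
  ultimately show ?thesis using fdiam_ge[OF fin(1), of a b z] by linarith
qed

text \<open>By the sine law every side is at most \<open>\<kappa>\<close> and at least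
  \<open>\<kappa> * sin \<epsilon>\<close>.\<close>

lemma edge_ge_fdiam:
  assumes "i \<in> f" "j \<in> f" "i \<noteq> j"
  shows "sin \<epsilon> * fdiam z f \<le> cmod (z i - z j)"
proof -
  obtain \<kappa> where \<kappa>: "\<kappa> > 0" "\<And>v j k. f = {v, j, k} \<Longrightarrow> v \<noteq> j \<Longrightarrow> v \<noteq> k \<Longrightarrow> j \<noteq> k \<Longrightarrow>
    cmod (z j - z k) = \<kappa> * sin (fang z f v)" using sine_law by blast
  have e: "\<exists>v\<in>f. cmod (z i - z j) = \<kappa> * sin (fang z f v)" if ij: "i \<in> f" "j \<in> f" "i \<noteq> j" for i j
  proof -
    obtain k where "k \<noteq> i" "k \<noteq> j" "f = {i, j, k}" using face_third[OF card3 ij] .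
    hence "f = {k, i, j}" "k \<in> f" by auto
    thus ?thesis using \<kappa>(2)[of k i j] \<open>k \<noteq> i\<close> \<open>k \<noteq> j\<close> ij by auto
  qed
  have "fdiam z f \<le> \<kappa>"
  proof (rule fdiam_le[OF fin])
    fix i j assume "i \<in> f" "j \<in> f"
    show "cmod (z i - z j) \<le> \<kappa>"
    proof (cases "i = j")
      case False
      then obtain v where "cmod (z i - z j) = \<kappa> * sin (fang z f v)" using e \<open>i \<in> f\<close> \<open>j \<in> f\<close> by blast
      also have "\<dots> \<le> \<kappa> * 1" using \<kappa> by (intro mult_left_mono) auto
      finally show ?thesis by simp
    qed (use \<kappa> in auto)
  qed
  hence "sin \<epsilon> * fdiam z f \<le> sin \<epsilon> * \<kappa>" using sin_eps_pos by simp
  also obtain v where v: "v \<in> f" "cmod (z i - z j) = \<kappa> * sin (fang z f v)" using e assms by blast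
  have "sin \<epsilon> * \<kappa> \<le> \<kappa> * sin (fang z f v)" using sin_fang_ge[OF v(1)] \<kappa> by (simp add: mult.commute)
  finally show ?thesis using v by simp
qed

lemma cross_ge:
  assumes "f = {a, b, c}" "a \<noteq> b" "a \<noteq> c" "b \<noteq> c"
  shows "(sin \<epsilon>)^3 * (fdiam z f)\<^sup>2 \<le> \<bar>cross (z b - z a) (z c - z a)\<bar>"
proof -
  have ne: "z a \<noteq> z b" "z b \<noteq> z c" "z a \<noteq> z c" using inj assms by (auto dest: inj_onD)
  have "sin \<epsilon> \<le> \<bar>cross (z b - z a) (z c - z a)\<bar> / (cmod (z b - z a) * cmod (z c - z a))"
    using sin_fang_ge[of a] fang_eq[OF assms, of z] ne assms by (auto simp: sin_vangle)
  hence 1: "sin \<epsilon> * (cmod (z b - z a) * cmod (z c - z a)) \<le> \<bar>cross (z b - z a) (z c - z a)\<bar>"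
    using ne by (simp add: field_simps)
  have "(sin \<epsilon> * fdiam z f) * (sin \<epsilon> * fdiam z f) \<le> cmod (z b - z a) * cmod (z c - z a)"
    using edge_ge_fdiam[of b a] edge_ge_fdiam[of c a] assms sin_eps_pos fdiam_pos by (intro mult_mono) auto
  hence "sin \<epsilon> * ((sin \<epsilon> * fdiam z f) * (sin \<epsilon> * fdiam z f)) \<le> sin \<epsilon> * (cmod (z b - z a) * cmod (z c - z a))"
    using sin_eps_pos by (intro mult_left_mono) auto
  thus ?thesis using 1 by (simp add: power2_eq_square power3_eq_cube mult_ac)
qed

lemma bary_sum: "(\<Sum>v\<in>f. bary z f v p) = 1" "(\<Sum>v\<in>f. bary z f v p *\<^sub>R z v) = p"
proof -
  obtain a b c where f: "f = {a, b, c}" "a \<noteq> b" "a \<noteq> c" "b \<noteq> c" using card3 by (auto simp: card_3_iff)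
  let ?d = "cross (z b - z a) (z c - z a)"
  have d: "?d \<noteq> 0" by (rule cross_ne[OF f])
  have ba: "bary z f a p = cross (z b - p) (z c - p) / ?d" by (rule bary_eq) (use f in auto)
  have "bary z f b p = cross (z c - p) (z a - p) / cross (z c - z b) (z a - z b)" by (rule bary_eq) (use f in auto)
  hence bb: "bary z f b p = cross (z c - p) (z a - p) / ?d" by (simp add: cross_vertices)
  have "bary z f c p = cross (z a - p) (z b - p) / cross (z a - z c) (z b - z c)" by (rule bary_eq) (use f in auto)
  hence bc: "bary z f c p = cross (z a - p) (z b - p) / ?d" by (simp add: cross_vertices)
  have s: "cross (z b - p) (z c - p) + cross (z c - p) (z a - p) + cross (z a - p) (z b - p) = ?d"
    by (simp add: cross_eq algebra_simps)
  have "(\<Sum>v\<in>f. bary z f v p) = (cross (z b - p) (z c - p) + cross (z c - p) (z a - p) + cross (z a - p) (z b - p)) / ?d"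
    unfolding add_divide_distrib ba[symmetric] bb[symmetric] bc[symmetric]
    by (subst (1) f(1)) (use f(2-4) in \<open>simp add: add.assoc\<close>)
  thus "(\<Sum>v\<in>f. bary z f v p) = 1" using s d by simp
  have "cross (z b - p) (z c - p) *\<^sub>R z a + cross (z c - p) (z a - p) *\<^sub>R z b + cross (z a - p) (z b - p) *\<^sub>R z c = ?d *\<^sub>R p"
    by (rule complex_eqI) (simp_all add: cross_eq algebra_simps)
  hence "(1 / ?d) *\<^sub>R (cross (z b - p) (z c - p) *\<^sub>R z a + cross (z c - p) (z a - p) *\<^sub>R z b + cross (z a - p) (z b - p) *\<^sub>R z c) = p"
    using d by simp
  moreover have "(\<Sum>v\<in>f. bary z f v p *\<^sub>R z v) = bary z f a p *\<^sub>R z a + bary z f b p *\<^sub>R z b + bary z f c p *\<^sub>R z c"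
    by (subst (1) f(1)) (use f(2-4) in \<open>simp add: add.assoc\<close>)
  ultimately show "(\<Sum>v\<in>f. bary z f v p *\<^sub>R z v) = p"
    unfolding ba bb bc by (simp add: scaleR_add_right)
qed

lemma bary_unique:
  assumes "sum c f = 1" "(\<Sum>v\<in>f. c v *\<^sub>R z v) = p" "v \<in> f"
  shows "bary z f v p = c v"
proof -
  obtain j k where f: "f = {v, j, k}" "v \<noteq> j" "v \<noteq> k" "j \<noteq> k" using face_others[OF card3 assms(3)] by metis
  have d: "cross (z j - z v) (z k - z v) \<noteq> 0" by (rule cross_ne[OF f])
  have s: "c v = 1 - c j - c k" using assms(1) f by simp
  have p: "p = c v *\<^sub>R z v + c j *\<^sub>R z j + c k *\<^sub>R z k" using assms(2) f by (simp add: add.assoc)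
  have "cross (z j - p) (z k - p) = c v * cross (z j - z v) (z k - z v)"
    unfolding p s by (simp add: cross_eq algebra_simps)
  thus ?thesis using bary_eq[OF f, of z p] d by simp
qed

lemma mem_hull_face_iff: "p \<in> convex hull (z ` f) \<longleftrightarrow> (\<forall>v\<in>f. 0 \<le> bary z f v p)"
proof
  assume "p \<in> convex hull (z ` f)"
  then obtain c where "\<forall>v\<in>f. 0 \<le> c v" "sum c f = 1" "(\<Sum>v\<in>f. c v *\<^sub>R z v) = p"
    using mem_hull_image_iff[OF fin(1) inj] by blast
  thus "\<forall>v\<in>f. 0 \<le> bary z f v p" using bary_unique by metis
next
  assume "\<forall>v\<in>f. 0 \<le> bary z f v p"
  thus "p \<in> convex hull (z ` f)" unfolding mem_hull_image_iff[OF fin(1) inj]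
    using bary_sum[of p] by (intro exI[of _ "\<lambda>v. bary z f v p"]) auto
qed

lemma bary_subface:
  assumes "g \<subseteq> f" "\<forall>v\<in>g. 0 \<le> c v" "sum c g = 1" "(\<Sum>v\<in>g. c v *\<^sub>R z v) = p" "v \<in> f"
  shows "bary z f v p = (if v \<in> g then c v else 0)"
proof (rule bary_unique[where c = "\<lambda>v. if v \<in> g then c v else 0"])
  have [simp]: "f \<inter> g = g" using assms(1) by blast
  show "(\<Sum>v\<in>f. if v \<in> g then c v else 0) = 1"
    using assms(3) fin by (simp add: sum.If_cases Collect_mem_eq)
  have "(\<Sum>v\<in>f. (if v \<in> g then c v else 0) *\<^sub>R z v) = (\<Sum>v\<in>f. if v \<in> g then c v *\<^sub>R z v else 0)"
    by (intro sum.cong) auto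
  thus "(\<Sum>v\<in>f. (if v \<in> g then c v else 0) *\<^sub>R z v) = p"
    using assms(4) fin by (simp add: sum.If_cases Collect_mem_eq)
qed (use assms in auto)

lemma bary_vertex: "v \<in> f \<Longrightarrow> w \<in> f \<Longrightarrow> bary z f v (z w) = (if v = w then 1 else 0)"
  using bary_subface[of "{w}" "\<lambda>_. 1" "z w" v] by auto

text \<open>A barycentric coordinate is affine with gradient of length opposite side over twice the
  area, and \<open>cross_ge\<close> bounds the area from below.\<close>

lemma bary_lipschitz:
  assumes "v \<in> f"
  shows "\<bar>bary z f v p - bary z f v q\<bar> \<le> cmod (p - q) / ((sin \<epsilon>)^3 * fdiam z f)"
proof -
  obtain j k where f: "f = {v, j, k}" "v \<noteq> j" "v \<noteq> k" "j \<noteq> k" using face_others[OF card3 assms] by metis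
  let ?d = "cross (z j - z v) (z k - z v)" and ?D = "fdiam z f"
  have d: "?d \<noteq> 0" by (rule cross_ne[OF f])
  have "bary z f v p - bary z f v q = cross (p - q) (z j - z k) / ?d"
    unfolding bary_eq[OF f] diff_divide_distrib[symmetric] by (simp add: cross_eq algebra_simps)
  hence "\<bar>bary z f v p - bary z f v q\<bar> = \<bar>cross (p - q) (z j - z k)\<bar> / \<bar>?d\<bar>" by simp
  also have "\<dots> \<le> (cmod (p - q) * ?D) / ((sin \<epsilon>)^3 * ?D\<^sup>2)"
  proof (rule frac_le)
    have "\<bar>cross (p - q) (z j - z k)\<bar> \<le> cmod (p - q) * cmod (z j - z k)" by (rule cross_le)
    also have "\<dots> \<le> cmod (p - q) * ?D" using fdiam_ge[OF fin(1), of j k z] f by (intro mult_left_mono) auto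
    finally show "\<bar>cross (p - q) (z j - z k)\<bar> \<le> cmod (p - q) * ?D" .
    show "(sin \<epsilon>)^3 * ?D\<^sup>2 \<le> \<bar>?d\<bar>" by (rule cross_ge[OF f])
  qed (use fdiam_pos sin_eps_pos in auto)
  also have "\<dots> = cmod (p - q) / ((sin \<epsilon>)^3 * ?D)" using fdiam_pos by (simp add: power2_eq_square)
  finally show ?thesis .
qed

text \<open>All coordinates of the centroid are 1/3, and \<open>bary_lipschitz\<close> keeps them
  positive on a disc of this radius.\<close>

lemma inscribed_ball:
  obtains g where "ball g ((sin \<epsilon>)^3 * fdiam z f / 3) \<subseteq> convex hull (z ` f)"
proof
  define g where "g = (\<Sum>v\<in>f. (1/3) *\<^sub>R z v)"
  have g: "bary z f v g = 1/3" if "v \<in> f" for v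
    using bary_unique[of "\<lambda>_. 1/3" g v] that card3 unfolding g_def by simp
  show "ball g ((sin \<epsilon>)^3 * fdiam z f / 3) \<subseteq> convex hull (z ` f)"
  proof
    fix p assume "p \<in> ball g ((sin \<epsilon>)^3 * fdiam z f / 3)"
    hence "cmod (g - p) < (sin \<epsilon>)^3 * fdiam z f / 3" by (simp add: dist_norm)
    hence "cmod (g - p) / ((sin \<epsilon>)^3 * fdiam z f) < 1/3" using sin_eps_pos fdiam_pos by (simp add: field_simps)
    hence "\<bar>bary z f v g - bary z f v p\<bar> < 1/3" if "v \<in> f" for v
      using bary_lipschitz[OF that, of g p] by linarith
    thus "p \<in> convex hull (z ` f)" unfolding mem_hull_face_iff using g by (smt (verit))
  qed
qed

end

section \<open>Angle sums\<close>

lemma cross_cis_polar: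
  assumes "Re p = r * cos a" "Im p = r * sin a"
  shows "cross p (cis t) = r * sin (t - a)" "cross (cis t) p = r * sin (a - t)"
    "Re (cnj (cis t) * p) = r * cos (a - t)"
  by (simp_all add: cross_eq sin_diff cos_diff assms algebra_simps)

lemmas cross_cis = cross_cis_polar[OF cos_Arg2pi[symmetric] sin_Arg2pi[symmetric]]

text \<open>For a direction \<open>d\<close>, compare imaginary parts in
  \<open>(cnj d * p) * (cnj p * q) = (cmod p)\<^sup>2 * (cnj d * q)\<close>, then apply the addition
  theorem for the sine.\<close>

lemma cross_cis_right:
  assumes "p \<noteq> 0" "q \<noteq> 0" "cross p q > 0"
  shows "cross (cis t) q = cmod q * sin (Arg2pi p + vangle p q - t)"
proof -
  let ?a = "Arg2pi p" and ?\<theta> = "vangle p q"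
  have c: "Re (cnj p * q) = cmod p * cmod q * cos ?\<theta>" using cos_vangle[of p q] assms by (simp add: field_simps)
  have s: "cross p q = cmod p * cmod q * sin ?\<theta>" using sin_vangle[of p q] assms by (simp add: field_simps)
  have "(cmod p)\<^sup>2 * cross (cis t) q = cross (cis t) p * Re (cnj p * q) + Re (cnj (cis t) * p) * cross p q"
    unfolding cmod_power2 by (simp add: cross_eq power2_eq_square algebra_simps)
  also have "\<dots> = (cmod p)\<^sup>2 * (cmod q * (sin (?a - t) * cos ?\<theta> + cos (?a - t) * sin ?\<theta>))"
    unfolding c s cross_cis by (simp add: power2_eq_square algebra_simps)
  also have "sin (?a - t) * cos ?\<theta> + cos (?a - t) * sin ?\<theta> = sin ((?a - t) + ?\<theta>)" by (simp only: sin_add)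
  finally show ?thesis using assms by (simp add: algebra_simps)
qed

text \<open>Each sine condition is a half-turn, and two half-turns offset by \<open>\<theta>\<close>
  meet in the sector. The last alternative is the part of the sector that passes
  \<open>2 * pi\<close> and re-enters at 0.\<close>

lemma sector_iff:
  assumes a: "0 \<le> a" "a < 2 * pi" and t: "0 \<le> t" "t < 2 * pi" and \<theta>: "0 < \<theta>" "\<theta> < pi"
  shows "0 \<le> sin (t - a) \<and> 0 \<le> sin (a + \<theta> - t) \<longleftrightarrow> a \<le> t \<and> t \<le> a + \<theta> \<or> t \<le> a + \<theta> - 2 * pi"
proof -
  have key: "0 \<le> sin x \<and> 0 \<le> sin (\<theta> - x) \<longleftrightarrow> x \<le> \<theta>" if x: "0 \<le> x" "x < 2 * pi" for x
  proof
    assume s: "0 \<le> sin x \<and> 0 \<le> sin (\<theta> - x)"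
    have "x \<le> pi" using s sin_lt_zero[of x] x by force
    show "x \<le> \<theta>"
    proof (rule ccontr)
      assume "\<not> x \<le> \<theta>"
      hence "0 < sin (x - \<theta>)" using \<open>x \<le> pi\<close> \<theta> by (intro sin_gt_zero) auto
      moreover have "sin (\<theta> - x) = - sin (x - \<theta>)" by (metis minus_diff_eq sin_minus)
      ultimately show False using s by simp
    qed
  next
    assume "x \<le> \<theta>"
    thus "0 \<le> sin x \<and> 0 \<le> sin (\<theta> - x)" using x \<theta> by (auto intro!: sin_ge_zero)
  qed
  show ?thesis
  proof (cases "a \<le> t")
    case True
    have "0 \<le> sin (t - a) \<and> 0 \<le> sin (\<theta> - (t - a)) \<longleftrightarrow> t - a \<le> \<theta>" using True a t by (intro key) auto
    moreover have "\<theta> - (t - a) = a + \<theta> - t" by simp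
    ultimately show ?thesis using True \<theta> by auto
  next
    case False
    have "0 \<le> sin (t - a + 2 * pi) \<and> 0 \<le> sin (\<theta> - (t - a + 2 * pi)) \<longleftrightarrow> t - a + 2 * pi \<le> \<theta>"
      using False a t by (intro key) auto
    moreover have "sin (\<theta> - (t - a + 2 * pi)) = sin (a + \<theta> - t)"
    proof -
      have "sin (a + \<theta> - t) = sin (\<theta> - (t - a + 2 * pi) + 2 * pi)" by (rule arg_cong[where f = sin]) simp
      thus ?thesis by (simp only: sin_periodic)
    qed
    moreover have "sin (t - a + 2 * pi) = sin (t - a)" by (simp only: sin_periodic)
    ultimately show ?thesis using False by auto
  qed
qed

lemma sector_measure:
  assumes a: "0 \<le> a" "a < 2 * pi" and \<theta>: "0 < \<theta>" "\<theta> < pi"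
  defines "S \<equiv> {t \<in> {0..<2*pi}. a \<le> t \<and> t \<le> a + \<theta> \<or> t \<le> a + \<theta> - 2 * pi}"
  shows "S \<in> lmeasurable" "measure lebesgue S = \<theta>"
proof -
  have "S \<in> lmeasurable \<and> measure lebesgue S = \<theta>"
  proof (cases "a + \<theta> < 2 * pi")
    case True
    have "S = {a..a+\<theta>}" unfolding S_def using True a \<theta> by auto
    thus ?thesis using \<theta> by simp
  next
    case False
    have eq: "S = {a..<2*pi} \<union> {0..a + \<theta> - 2 * pi}" unfolding S_def using False a \<theta> by auto
    have m: "measure lebesgue {a..<2*pi} = 2 * pi - a" using a by (subst measure_completion) auto
    have "measure lebesgue S = measure lebesgue {a..<2*pi} + measure lebesgue {0..a + \<theta> - 2 * pi}"
      unfolding eq using \<theta> a by (intro measure_Union) (auto simp: emeasure_lborel_Icc_eq)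
    moreover have "{a..<2*pi} \<in> lmeasurable" by (rule fmeasurableI2[of "{a..2*pi}"]) auto
    hence "S \<in> lmeasurable" unfolding eq by (rule fmeasurable.Un) simp
    ultimately show ?thesis unfolding m using False by auto
  qed
  thus "S \<in> lmeasurable" "measure lebesgue S = \<theta>" by auto
qed

lemma finite_cross_cis_zero:
  assumes "x \<noteq> 0"
  shows "finite {t \<in> {0..<2*pi}. cross x (cis t) = 0}"
proof (rule finite_subset)
  show "finite ((\<lambda>i::int. Arg2pi x + of_int i * pi) ` {-2..2})" by simp
  show "{t \<in> {0..<2*pi}. cross x (cis t) = 0} \<subseteq> (\<lambda>i::int. Arg2pi x + of_int i * pi) ` {-2..2}"
  proof
    fix t assume "t \<in> {t \<in> {0..<2*pi}. cross x (cis t) = 0}"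
    hence t: "0 \<le> t" "t < 2*pi" "sin (t - Arg2pi x) = 0" using assms by (auto simp: cross_cis)
    then obtain i :: int where i: "t - Arg2pi x = of_int i * pi" by (auto simp: sin_zero_iff_int2)
    have "- 2 * pi < of_int i * pi" "of_int i * pi < 2 * pi"
      using t i Arg2pi_ge_0[of x] Arg2pi_lt_2pi[of x] by linarith+
    hence "(-2::real) < of_int i" "of_int i < (2::real)"
      using mult_right_less_imp_less[of "-2" pi "of_int i"] mult_right_less_imp_less[of "of_int i" pi 2] by simp_all
    hence "i \<in> {-2..2}" by auto
    moreover have "t = Arg2pi x + of_int i * pi" using i by simp
    ultimately show "t \<in> (\<lambda>i::int. Arg2pi x + of_int i * pi) ` {-2..2}" by blast
  qed
qed

context fat_face
begin

lemma oriented: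
  assumes "v \<in> f"
  obtains j k where "f = {v, j, k}" "v \<noteq> j" "v \<noteq> k" "j \<noteq> k" "cross (z j - z v) (z k - z v) > 0"
proof -
  obtain j k where f: "f = {v, j, k}" "v \<noteq> j" "v \<noteq> k" "j \<noteq> k" using face_others[OF card3 assms] by metis
  show ?thesis
  proof (cases "cross (z j - z v) (z k - z v) > 0")
    case True thus ?thesis using that f by metis
  next
    case False
    hence "cross (z k - z v) (z j - z v) > 0"
      using cross_ne[OF f] cross_commute[of "z k - z v" "z j - z v"] by simp
    moreover have "f = {v, k, j}" using f(1) by auto
    ultimately show ?thesis using that f by metis
  qed
qed

lemma bary_direction:
  assumes f: "f = {v, j, k}" "v \<noteq> j" "v \<noteq> k" "j \<noteq> k"
  shows "bary z f j (z v + d) = cross d (z k - z v) / cross (z j - z v) (z k - z v)"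
    "bary z f k (z v + d) = cross (z j - z v) d / cross (z j - z v) (z k - z v)"
    "bary z f v (z v + d) = 1 - bary z f j (z v + d) - bary z f k (z v + d)"
proof -
  have e: "f = {j, k, v}" "f = {k, v, j}" using f(1) by auto
  have "bary z f j (z v + d) = cross (z k - (z v + d)) (z v - (z v + d)) / cross (z k - z j) (z v - z j)"
    using f e(1) by (intro bary_eq) auto
  thus "bary z f j (z v + d) = cross d (z k - z v) / cross (z j - z v) (z k - z v)"
    by (simp add: cross_vertices) (simp add: cross_eq algebra_simps)
  have "bary z f k (z v + d) = cross (z v - (z v + d)) (z j - (z v + d)) / cross (z v - z k) (z j - z k)"
    using f e(2) by (intro bary_eq) auto
  thus "bary z f k (z v + d) = cross (z j - z v) d / cross (z j - z v) (z k - z v)"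
    by (simp add: cross_vertices) (simp add: cross_eq algebra_simps)
  have "(\<Sum>i\<in>f. bary z f i (z v + d)) = bary z f v (z v + d) + bary z f j (z v + d) + bary z f k (z v + d)"
    by (subst (1) f(1)) (use f(2-4) in \<open>simp add: add.assoc\<close>)
  thus "bary z f v (z v + d) = 1 - bary z f j (z v + d) - bary z f k (z v + d)" using bary_sum(1)[of "z v + d"] by simp
qed

text \<open>Encodes the angle at \<open>v\<close> as the measure of the set of directions entering
  the triangle, so that angle sums become additivity of Lebesgue measure and no cyclic order of
  faces is required.\<close>

definition dirs :: "'v \<Rightarrow> real set" where
  "dirs v = {t \<in> {0..<2*pi}. \<exists>s>0. z v + of_real s * cis t \<in> convex hull (z ` f)}"

lemma cross_scale: "cross (of_real s * p) q = s * cross p q" "cross p (of_real s * q) = s * cross p q"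
  by (simp_all add: cross_eq algebra_simps)

lemma dirs_eq:
  assumes f: "f = {v, j, k}" "v \<noteq> j" "v \<noteq> k" "j \<noteq> k" and pos: "cross (z j - z v) (z k - z v) > 0"
  shows "dirs v = {t \<in> {0..<2*pi}. 0 \<le> cross (z j - z v) (cis t) \<and> 0 \<le> cross (cis t) (z k - z v)}"
proof -
  let ?p = "z j - z v" and ?q = "z k - z v"
  have "(\<exists>s>0. z v + of_real s * cis t \<in> convex hull (z ` f)) \<longleftrightarrow> 0 \<le> cross ?p (cis t) \<and> 0 \<le> cross (cis t) ?q" for t
  proof
    assume "\<exists>s>0. z v + of_real s * cis t \<in> convex hull (z ` f)"
    then obtain s where s: "s > 0" "z v + of_real s * cis t \<in> convex hull (z ` f)" by blast
    have "j \<in> f" "k \<in> f" unfolding f(1) by auto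
    hence "0 \<le> bary z f j (z v + of_real s * cis t)" "0 \<le> bary z f k (z v + of_real s * cis t)"
      using s(2) unfolding mem_hull_face_iff by auto
    thus "0 \<le> cross ?p (cis t) \<and> 0 \<le> cross (cis t) ?q"
      unfolding bary_direction[OF f] cross_scale using s(1) pos by (auto simp: zero_le_divide_iff zero_le_mult_iff)
  next
    assume c: "0 \<le> cross ?p (cis t) \<and> 0 \<le> cross (cis t) ?q"
    define A where "A = cross ?p (cis t) / cross ?p ?q + cross (cis t) ?q / cross ?p ?q"
    have A0: "0 \<le> A" unfolding A_def using c pos by simp
    \<comment> \<open>Small enough to keep the coordinate of \<open>v\<close> nonnegative; the added
      1 spares a proof that \<open>A\<close> is positive.\<close>
    define s where "s = 1 / (A + 1)"
    have s: "s > 0" "s * A \<le> 1" unfolding s_def using A0 by (auto simp: field_simps)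
    have "0 \<le> bary z f i (z v + of_real s * cis t)" if "i \<in> f" for i
    proof -
      have 1: "0 \<le> bary z f j (z v + of_real s * cis t)" "0 \<le> bary z f k (z v + of_real s * cis t)"
        unfolding bary_direction[OF f] cross_scale using c s pos by auto
      have 2: "0 \<le> bary z f v (z v + of_real s * cis t)"
        unfolding bary_direction(3)[OF f] unfolding bary_direction(1,2)[OF f] cross_scale
        using s(2) unfolding A_def by (simp add: algebra_simps)
      have "i = v \<or> i = j \<or> i = k" using that f(1) by blast
      thus ?thesis using 1 2 by blast
    qed
    hence "z v + of_real s * cis t \<in> convex hull (z ` f)" unfolding mem_hull_face_iff by blast
    thus "\<exists>s>0. z v + of_real s * cis t \<in> convex hull (z ` f)" using s(1) by blast
  qed
  thus ?thesis unfolding dirs_def by blast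
qed

lemma dirs_measure:
  assumes "v \<in> f"
  shows "dirs v \<in> lmeasurable" "measure lebesgue (dirs v) = fang z f v"
proof -
  obtain j k where f: "f = {v, j, k}" "v \<noteq> j" "v \<noteq> k" "j \<noteq> k" and pos: "cross (z j - z v) (z k - z v) > 0"
    using oriented[OF assms] by metis
  let ?p = "z j - z v" and ?q = "z k - z v"
  have ne: "?p \<noteq> 0" "?q \<noteq> 0" using pos by (auto simp: cross_eq)
  have \<theta>: "fang z f v = vangle ?p ?q" by (rule fang_eq[OF f])
  have b: "0 < fang z f v" "fang z f v < pi" using fat[OF assms] fang_le[OF assms] eps by auto
  have "dirs v = {t \<in> {0..<2*pi}. Arg2pi ?p \<le> t \<and> t \<le> Arg2pi ?p + fang z f v \<or> t \<le> Arg2pi ?p + fang z f v - 2 * pi}"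
  proof -
    have "0 \<le> cross ?p (cis t) \<and> 0 \<le> cross (cis t) ?q \<longleftrightarrow>
        Arg2pi ?p \<le> t \<and> t \<le> Arg2pi ?p + fang z f v \<or> t \<le> Arg2pi ?p + fang z f v - 2 * pi" if "t \<in> {0..<2*pi}" for t
    proof -
      have "0 \<le> cross ?p (cis t) \<and> 0 \<le> cross (cis t) ?q \<longleftrightarrow>
        0 \<le> sin (t - Arg2pi ?p) \<and> 0 \<le> sin (Arg2pi ?p + fang z f v - t)"
        unfolding cross_cis(1) cross_cis_right[OF ne pos] \<theta>[symmetric] using ne by (simp add: zero_le_mult_iff)
      also have "\<dots> \<longleftrightarrow> Arg2pi ?p \<le> t \<and> t \<le> Arg2pi ?p + fang z f v \<or> t \<le> Arg2pi ?p + fang z f v - 2 * pi"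
        using that b Arg2pi_ge_0 Arg2pi_lt_2pi by (intro sector_iff) auto
      finally show ?thesis .
    qed
    thus ?thesis unfolding dirs_eq[OF f pos] by blast
  qed
  thus "dirs v \<in> lmeasurable" "measure lebesgue (dirs v) = fang z f v"
    using sector_measure[OF Arg2pi_ge_0 Arg2pi_lt_2pi b] by simp_all
qed

lemma dirs_small:
  assumes "v \<in> f" "t \<in> dirs v"
  obtains s0 where "s0 > 0" "\<And>s. 0 < s \<Longrightarrow> s \<le> s0 \<Longrightarrow> z v + of_real s * cis t \<in> convex hull (z ` f)"
proof -
  obtain s0 where s0: "s0 > 0" "z v + of_real s0 * cis t \<in> convex hull (z ` f)"
    using assms unfolding dirs_def by blast
  have zv: "z v \<in> convex hull (z ` f)" using assms by (simp add: hull_inc)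
  show ?thesis
  proof (rule that[OF s0(1)])
    fix s assume s: "0 < s" "s \<le> s0"
    have "(1 - s / s0) *\<^sub>R z v + (s / s0) *\<^sub>R (z v + of_real s0 * cis t) \<in> convex hull (z ` f)"
      using s s0 zv by (intro convexD convex_convex_hull) auto
    moreover have "(1 - s / s0) *\<^sub>R z v + (s / s0) *\<^sub>R (z v + of_real s0 * cis t) = z v + of_real s * cis t"
      using s0(1) by (simp add: scaleR_conv_of_real algebra_simps)
    ultimately show "z v + of_real s * cis t \<in> convex hull (z ` f)" by simp
  qed
qed

end

section \<open>Planar fat triangulations\<close>

text \<open>\<open>inter\<close> says that faces meet along common subfaces, \<open>nbhd\<close>
  that every point of a face is interior to the union of the faces through it. Together they express
  an embedded triangulation of an open set, possibly smaller than the plane, as the image of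
  \<open>\<phi>'\<close> may be.\<close>

locale planar =
  fixes F :: "'v set set" and z :: "'v \<Rightarrow> complex" and \<epsilon> :: real
  assumes card3: "\<And>f. f \<in> F \<Longrightarrow> card f = 3"
    and inj: "inj_on z (\<Union>F)"
    and eps: "0 < \<epsilon>"
    and fat: "\<And>f v. f \<in> F \<Longrightarrow> v \<in> f \<Longrightarrow> \<epsilon> \<le> fang z f v"
    and inter: "\<And>f g p. f \<in> F \<Longrightarrow> g \<in> F \<Longrightarrow> p \<in> convex hull (z ` f) \<Longrightarrow> p \<in> convex hull (z ` g) \<Longrightarrow>
        p \<in> convex hull (z ` (f \<inter> g))"
    and nbhd: "\<And>f p. f \<in> F \<Longrightarrow> p \<in> convex hull (z ` f) \<Longrightarrow>
        \<exists>r>0. ball p r \<subseteq> (\<Union>g\<in>{g\<in>F. p \<in> convex hull (z ` g)}. convex hull (z ` g))"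
begin

abbreviation H :: "'v set \<Rightarrow> complex set" where "H f \<equiv> convex hull (z ` f)"
abbreviation star :: "'v \<Rightarrow> 'v set set" where "star v \<equiv> {f \<in> F. v \<in> f}"
abbreviation dm :: "'v set \<Rightarrow> real" where "dm \<equiv> fdiam z"

lemma face: "f \<in> F \<Longrightarrow> fat_face z f \<epsilon>"
proof
  assume f: "f \<in> F"
  show "card f = 3" by (rule card3[OF f])
  show "inj_on z f" using inj f by (rule inj_on_subset[OF _ Union_upper])
  show "0 < \<epsilon>" by (rule eps)
  show "\<epsilon> \<le> fang z f v" if "v \<in> f" for v by (rule fat[OF f that])
qed

lemma fin:
  assumes "f \<in> F"
  shows "finite f" "f \<noteq> {}"
  by (rule fat_face.fin(1)[OF face[OF assms]], rule fat_face.fin(2)[OF face[OF assms]])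

lemma closed_H:
  assumes "f \<in> F"
  shows "closed (H f)" "compact (H f)"
proof -
  show "compact (H f)" by (intro finite_imp_compact_convex_hull finite_imageI fin(1)[OF assms])
  thus "closed (H f)" by (rule compact_imp_closed)
qed

text \<open>By \<open>inter\<close> the point is a convex combination of the common vertices, and
  uniqueness of coordinates in \<open>f\<close> and in \<open>g\<close> forces both to be these
  coefficients. Barycentric coordinates therefore glue to functions on the whole union.\<close>

lemma bary_consistent:
  assumes "f \<in> F" "g \<in> F" "p \<in> H f" "p \<in> H g" "v \<in> f"
  shows "bary z f v p = (if v \<in> g then bary z g v p else 0)"
proof -
  have "inj_on z (f \<inter> g)" using inj assms by (auto intro: inj_on_subset)
  then obtain c where c: "\<forall>v\<in>f\<inter>g. 0 \<le> c v" "sum c (f \<inter> g) = 1" "(\<Sum>v\<in>f\<inter>g. c v *\<^sub>R z v) = p"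
    using inter[OF assms(1-4)] mem_hull_image_iff[of "f \<inter> g" z p] fin(1)[OF assms(1)] by auto
  have f: "bary z f v p = (if v \<in> f \<inter> g then c v else 0)"
    using fat_face.bary_subface[OF face[OF assms(1)] _ c assms(5)] by auto
  show ?thesis
  proof (cases "v \<in> g")
    case True
    have "bary z g v p = (if v \<in> f \<inter> g then c v else 0)"
      using fat_face.bary_subface[OF face[OF assms(2)] _ c True] by auto
    thus ?thesis using f True by simp
  next
    case False thus ?thesis using f by simp
  qed
qed

lemma vertex_mem:
  assumes "v \<in> \<Union>F" "f \<in> F" "z v \<in> H f"
  shows "v \<in> f"
proof -
  obtain g where g: "g \<in> F" "v \<in> g" using assms by blast
  have "z v \<in> H g" using g by (simp add: hull_inc)
  hence "bary z g v (z v) = (if v \<in> f then bary z f v (z v) else 0)"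
    using bary_consistent g assms by metis
  moreover have "bary z g v (z v) = 1" using fat_face.bary_vertex[OF face] g by metis
  ultimately show ?thesis by (auto split: if_splits)
qed

lemma share_vertex:
  assumes "f \<in> F" "g \<in> F" "p \<in> H f" "p \<in> H g"
  shows "f \<inter> g \<noteq> {}"
proof
  assume "f \<inter> g = {}"
  thus False using inter[OF assms] by simp
qed

lemma vertex_nbhd:
  assumes "v \<in> \<Union>F"
  obtains r where "r > 0" "ball (z v) r \<subseteq> (\<Union>g\<in>star v. H g)"
proof -
  obtain f where f: "f \<in> F" "v \<in> f" using assms by blast
  hence "z v \<in> H f" by (simp add: hull_inc)
  then obtain r where r: "r > 0" "ball (z v) r \<subseteq> (\<Union>g\<in>{g\<in>F. z v \<in> H g}. H g)" using nbhd[OF f(1)] by blast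
  have "{g\<in>F. z v \<in> H g} \<subseteq> star v" using vertex_mem assms by blast
  hence "(\<Union>g\<in>{g\<in>F. z v \<in> H g}. H g) \<subseteq> (\<Union>g\<in>star v. H g)" by (rule UN_mono) simp
  thus ?thesis using that r by (meson subset_trans)
qed

subsection \<open>Angle sums and degrees\<close>

abbreviation A :: "'v \<Rightarrow> 'v set \<Rightarrow> real set" where "A v f \<equiv> fat_face.dirs z f v"

text \<open>A vertex \<open>k\<close> of \<open>f\<close> outside \<open>g\<close> has coordinate
  zero on the intersection. So a common direction is parallel to the edge from \<open>v\<close> to
  the remaining vertex, and only finitely many directions are.\<close>

lemma dirs_overlap:
  assumes "f \<in> star v" "g \<in> star v" "f \<noteq> g"
  shows "negligible (A v f \<inter> A v g)"
proof -
  have F: "f \<in> F" "g \<in> F" "v \<in> f" "v \<in> g" using assms by auto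
  note ff = face[OF F(1)] face[OF F(2)]
  have "\<not> f \<subseteq> g" using assms card3 fin card_subset_eq[of g f] by auto
  then obtain k where k: "k \<in> f" "k \<notin> g" by blast
  have vk: "v \<noteq> k" using k F by auto
  obtain j where j: "j \<noteq> v" "j \<noteq> k" "f = {v, k, j}" using face_third[OF card3[OF F(1)] F(3) k(1) vk] by metis
  have fj: "f = {v, j, k}" using j(3) by auto
  have "z v \<noteq> z j"
  proof
    assume "z v = z j"
    moreover have "v \<in> \<Union>F" "j \<in> \<Union>F" using F(1,3) j(3) by auto
    ultimately show False using inj j(1) by (auto dest: inj_onD)
  qed
  have "A v f \<inter> A v g \<subseteq> {t \<in> {0..<2*pi}. cross (z j - z v) (cis t) = 0}"
  proof
    fix t assume t: "t \<in> A v f \<inter> A v g"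
    obtain s1 where s1: "s1 > 0" "\<And>s. 0 < s \<Longrightarrow> s \<le> s1 \<Longrightarrow> z v + of_real s * cis t \<in> H f"
      using fat_face.dirs_small[OF ff(1) F(3), of t] t by blast
    obtain s2 where s2: "s2 > 0" "\<And>s. 0 < s \<Longrightarrow> s \<le> s2 \<Longrightarrow> z v + of_real s * cis t \<in> H g"
      using fat_face.dirs_small[OF ff(2) F(4), of t] t by blast
    define s where "s = min s1 s2"
    have s: "s > 0" "z v + of_real s * cis t \<in> H f" "z v + of_real s * cis t \<in> H g"
      unfolding s_def using s1 s2 by auto
    have "bary z f k (z v + of_real s * cis t) = 0"
      using bary_consistent[OF F(1,2) s(2,3) k(1)] k(2) by simp
    hence "cross (z j - z v) (of_real s * cis t) = 0"
      using fat_face.bary_direction(2)[OF ff(1) fj, of "of_real s * cis t"] fat_face.cross_ne[OF ff(1) fj] j vk by auto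
    hence "cross (z j - z v) (cis t) = 0" using s(1) fat_face.cross_scale[OF ff(1)] by auto
    moreover have "t \<in> {0..<2*pi}" using t unfolding fat_face.dirs_def[OF ff(1)] by blast
    ultimately show "t \<in> {t \<in> {0..<2*pi}. cross (z j - z v) (cis t) = 0}" by blast
  qed
  moreover have "finite {t \<in> {0..<2*pi}. cross (z j - z v) (cis t) = 0}"
    using \<open>z v \<noteq> z j\<close> by (intro finite_cross_cis_zero) auto
  ultimately show ?thesis using finite_subset negligible_finite by metis
qed

lemma sum_fang_eq_measure:
  assumes "finite G" "G \<subseteq> star v"
  shows "(\<Sum>f\<in>G. fang z f v) = measure lebesgue (\<Union>f\<in>G. A v f)" "(\<Union>f\<in>G. A v f) \<in> lmeasurable"
    "(\<Union>f\<in>G. A v f) \<subseteq> {0..<2*pi}"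
proof -
  have lm: "A v f \<in> lmeasurable" "measure lebesgue (A v f) = fang z f v" "A v f \<subseteq> {0..<2*pi}" if "f \<in> G" for f
  proof -
    have f: "f \<in> F" "v \<in> f" using that assms by auto
    show "A v f \<in> lmeasurable" "measure lebesgue (A v f) = fang z f v"
      using fat_face.dirs_measure[OF face[OF f(1)] f(2)] by auto
    show "A v f \<subseteq> {0..<2*pi}" unfolding fat_face.dirs_def[OF face[OF f(1)]] by blast
  qed
  have "measure lebesgue (\<Union>f\<in>G. A v f) = (\<Sum>f\<in>G. measure lebesgue (A v f))"
  proof (rule measure_negligible_finite_Union_image[OF assms(1) lm(1)])
    show "pairwise (\<lambda>f g. negligible (A v f \<inter> A v g)) G" unfolding pairwise_def using dirs_overlap assms(2) by blast
  qed
  thus "(\<Sum>f\<in>G. fang z f v) = measure lebesgue (\<Union>f\<in>G. A v f)" using lm by simp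
  show "(\<Union>f\<in>G. A v f) \<in> lmeasurable" using assms lm by (intro fmeasurable.finite_UN) auto
  show "(\<Union>f\<in>G. A v f) \<subseteq> {0..<2*pi}" using lm by blast
qed

lemma measure_circle: "{0..<2*pi} \<in> lmeasurable" "measure lebesgue {0..<2*pi} = 2 * pi"
proof -
  show "{0..<2*pi} \<in> lmeasurable" by (rule fmeasurableI2[of "{0..2*pi}"]) auto
  show "measure lebesgue {0..<2*pi} = 2 * pi" by (subst measure_completion) auto
qed

definition deg_bound :: nat where "deg_bound = nat \<lceil>2 * pi / \<epsilon>\<rceil>"

text \<open>Any finite family of faces at \<open>v\<close> has essentially disjoint direction sets,
  each of measure at least \<open>\<epsilon>\<close>, inside an interval of length
  \<open>2 * pi\<close>. Bounding finite subfamilies yields finiteness and the cardinality bound at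
  once.\<close>

lemma star_finite: "finite (star v)" "card (star v) \<le> deg_bound"
proof -
  have "finite (star v) \<and> card (star v) \<le> deg_bound"
  proof (rule finite_if_finite_subsets_card_bdd)
    fix G assume G: "G \<subseteq> star v" "finite G"
    have "real (card G) * \<epsilon> = (\<Sum>f\<in>G. \<epsilon>)" by simp
    also have "\<dots> \<le> (\<Sum>f\<in>G. fang z f v)" using G fat by (intro sum_mono) auto
    also have "\<dots> = measure lebesgue (\<Union>f\<in>G. A v f)" using sum_fang_eq_measure[OF G(2,1)] by simp
    also have "\<dots> \<le> measure lebesgue {0..<2*pi}"
      using sum_fang_eq_measure[OF G(2,1)] measure_circle by (intro measure_mono_fmeasurable) auto
    finally have "real (card G) \<le> 2 * pi / \<epsilon>" unfolding measure_circle using eps by (simp add: field_simps)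
    thus "card G \<le> deg_bound" unfolding deg_bound_def by linarith
  qed
  thus "finite (star v)" "card (star v) \<le> deg_bound" by auto
qed

text \<open>A disc around \<open>z v\<close> is covered by the star, so every direction enters some
  face and the inequality behind \<open>star_finite\<close> becomes an equality.\<close>

theorem star_angle_sum:
  assumes "v \<in> \<Union>F"
  shows "(\<Sum>f\<in>star v. fang z f v) = 2 * pi"
proof -
  obtain r where r: "r > 0" "ball (z v) r \<subseteq> (\<Union>g\<in>star v. H g)" using vertex_nbhd[OF assms] .
  have "{0..<2*pi} \<subseteq> (\<Union>f\<in>star v. A v f)"
  proof
    fix t assume t: "t \<in> {0..<2*pi}"
    have "z v + of_real (r/2) * cis t \<in> ball (z v) r" using r(1) by (simp add: dist_norm norm_mult)
    then obtain g where g: "g \<in> star v" "z v + of_real (r/2) * cis t \<in> H g" using r(2) by blast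
    hence "t \<in> A v g" unfolding fat_face.dirs_def[OF face] using t r(1)
      by (subst fat_face.dirs_def[OF face]) (auto intro!: exI[of _ "r/2"])
    thus "t \<in> (\<Union>f\<in>star v. A v f)" using g by blast
  qed
  hence "(\<Union>f\<in>star v. A v f) = {0..<2*pi}" using sum_fang_eq_measure(3)[OF star_finite(1) subset_refl] by blast
  thus ?thesis using sum_fang_eq_measure(1)[OF star_finite(1) subset_refl, of v] measure_circle by simp
qed

subsection \<open>Comparability of neighbouring faces\<close>

lemma sin_eps:
  assumes "F \<noteq> {}"
  shows "0 < sin \<epsilon>"
proof -
  obtain f where "f \<in> F" using assms by blast
  thus ?thesis by (rule fat_face.sin_eps_pos[OF face])
qed

lemma dm_pos: "f \<in> F \<Longrightarrow> 0 < dm f"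
  by (rule fat_face.fdiam_pos[OF face])

lemma dm_edge: "f \<in> F \<Longrightarrow> i \<in> f \<Longrightarrow> j \<in> f \<Longrightarrow> i \<noteq> j \<Longrightarrow> sin \<epsilon> * dm f \<le> cmod (z i - z j)"
  by (rule fat_face.edge_ge_fdiam[OF face])

text \<open>One factor \<open>1 / sin \<epsilon>\<close> for every face that may surround a
  vertex.\<close>

definition comp_const :: real where "comp_const = (1 / sin \<epsilon>) ^ deg_bound"

lemma comp_const_ge_1: "F \<noteq> {} \<Longrightarrow> 1 \<le> comp_const"
  unfolding comp_const_def using sin_eps by (intro one_le_power) (simp add: field_simps)

text \<open>Two faces at \<open>v\<close> that meet on a small circle around \<open>z v\<close>
  share an edge at \<open>v\<close>, whose length lies between \<open>sin \<epsilon> * dm\<close>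
  and \<open>dm\<close> for both. With these logarithmic intervals,
  \<open>connected_cover_oscillation\<close> on the circle replaces a walk around the
  vertex.\<close>

lemma star_comparable:
  assumes "f \<in> star v" "g \<in> star v"
  shows "dm f \<le> comp_const * dm g"
proof -
  have F: "f \<in> F" "g \<in> F" "v \<in> f" "v \<in> g" using assms by auto
  hence vF: "v \<in> \<Union>F" by blast
  have se: "0 < sin \<epsilon>" using sin_eps F by blast
  obtain r where r: "r > 0" "ball (z v) r \<subseteq> (\<Union>g\<in>star v. H g)" using vertex_nbhd[OF vF] .
  \<comment> \<open>Below \<open>r\<close> the circle stays inside the star; below the other two
    bounds it cuts edges of \<open>f\<close> and of \<open>g\<close>.\<close>
  define \<rho> where "\<rho> = min (r/2) (min (sin \<epsilon> * dm f) (sin \<epsilon> * dm g))"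
  have \<rho>: "0 < \<rho>" "\<rho> < r" "\<rho> \<le> sin \<epsilon> * dm f" "\<rho> \<le> sin \<epsilon> * dm g"
    unfolding \<rho>_def using r se dm_pos F by auto
  have meet: "H h \<inter> sphere (z v) \<rho> \<noteq> {}" if h: "h \<in> F" "v \<in> h" "\<rho> \<le> sin \<epsilon> * dm h" for h
  proof -
    obtain j k where j: "h = {v, j, k}" "v \<noteq> j" using face_others[OF card3[OF h(1)] h(2)] by metis
    hence jh: "j \<in> h" by blast
    let ?e = "cmod (z j - z v)"
    have e: "\<rho> \<le> ?e" using dm_edge[OF h(1) jh h(2)] j(2) h(3) by auto
    have e0: "?e > 0" using e \<rho>(1) by linarith
    let ?P = "(1 - \<rho> / ?e) *\<^sub>R z v + (\<rho> / ?e) *\<^sub>R z j"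
    have "?P \<in> H h" using e e0 \<rho>(1) h(2) jh by (intro convexD convex_convex_hull) (auto simp: hull_inc)
    moreover have "?P - z v = (\<rho> / ?e) *\<^sub>R (z j - z v)" by (simp add: algebra_simps)
    hence "cmod (?P - z v) = \<rho>" using e0 \<rho>(1) by (simp only: norm_scaleR) simp
    hence "dist (z v) ?P = \<rho>" by (metis dist_commute dist_norm)
    ultimately show ?thesis by (metis disjoint_iff mem_sphere)
  qed
  have "ln (dm f) - ln (sin \<epsilon> * dm g) \<le> (\<Sum>h\<in>star v. ln (dm h) - ln (sin \<epsilon> * dm h))"
  proof (rule connected_cover_oscillation[where X = "sphere (z v) \<rho>" and A = H])
    show "connected (sphere (z v) \<rho>)" by (intro connected_sphere) simp
    show "sphere (z v) \<rho> \<subseteq> (\<Union>h\<in>star v. H h)" using r(2) \<rho>(2) by force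
    show "ln (sin \<epsilon> * dm h) \<le> ln (dm h)" if "h \<in> star v" for h
    proof -
      have "sin \<epsilon> * dm h \<le> 1 * dm h" using dm_pos that by (intro mult_right_mono) force+
      thus ?thesis using dm_pos se that by simp
    qed
    show "ln (sin \<epsilon> * dm h) \<le> ln (dm i)" if hi: "h \<in> star v" "i \<in> star v" "H h \<inter> H i \<inter> sphere (z v) \<rho> \<noteq> {}" for h i
    proof -
      have hF: "h \<in> F" "i \<in> F" "v \<in> h" "v \<in> i" using hi by auto
      obtain P where P: "P \<in> H h" "P \<in> H i" "P \<in> sphere (z v) \<rho>" using hi(3) by blast
      have "P \<in> H (h \<inter> i)" using inter[OF hF(1,2) P(1,2)] .
      moreover have "P \<noteq> z v" using P(3) \<rho>(1) by force
      ultimately have "h \<inter> i \<noteq> {v}" by auto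
      then obtain j where j: "j \<in> h" "j \<in> i" "j \<noteq> v" using hF by blast
      have "sin \<epsilon> * dm h \<le> cmod (z j - z v)" using dm_edge[OF hF(1) j(1) hF(3) j(3)] .
      also have "\<dots> \<le> dm i" using fdiam_ge[OF fin(1)[OF hF(2)] j(2) hF(4)] .
      finally show ?thesis using se dm_pos[OF hF(1)] dm_pos[OF hF(2)] by simp
    qed
    show "closed (H h)" if "h \<in> star v" for h using closed_H that by auto
  qed (use assms F star_finite \<rho> meet in auto)
  also have "\<dots> = (\<Sum>h\<in>star v. ln (1 / sin \<epsilon>))"
  proof (rule sum.cong[OF refl])
    fix h assume "h \<in> star v"
    hence "0 < dm h" using dm_pos by blast
    thus "ln (dm h) - ln (sin \<epsilon> * dm h) = ln (1 / sin \<epsilon>)" using se by (simp add: ln_mult ln_div)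
  qed
  also have "\<dots> = card (star v) * ln (1 / sin \<epsilon>)" by simp
  also have "\<dots> \<le> deg_bound * ln (1 / sin \<epsilon>)"
    using star_finite se by (intro mult_right_mono) (auto intro!: ln_ge_zero)
  also have "\<dots> = ln comp_const" unfolding comp_const_def using se by (simp add: ln_realpow)
  finally have "ln (dm f) \<le> ln comp_const + ln (sin \<epsilon> * dm g)" by simp
  also have "\<dots> = ln (comp_const * (sin \<epsilon> * dm g))"
    using comp_const_ge_1 F se dm_pos by (subst ln_mult) force+
  finally have "dm f \<le> comp_const * (sin \<epsilon> * dm g)"
    using comp_const_ge_1 F se dm_pos by (subst (asm) ln_le_cancel_iff) (force intro!: mult_pos_pos)+
  also have "\<dots> \<le> comp_const * (1 * dm g)"
    using comp_const_ge_1 F dm_pos by (intro mult_left_mono mult_right_mono) force+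
  finally show ?thesis by simp
qed

subsection \<open>Packing\<close>

lemma interior_disjoint:
  assumes "f \<in> F" "g \<in> F" "f \<noteq> g"
  shows "interior (H f) \<inter> interior (H g) = {}"
proof -
  have fg: "f \<inter> g \<subset> f" using assms card3 fin card_subset_eq[of g f] by auto
  have c: "card (f \<inter> g) \<le> 2" using psubset_card_mono[OF fin(1)[OF assms(1)] fg] card3[OF assms(1)] by simp
  have "interior (H f) \<inter> interior (H g) \<subseteq> H f \<inter> H g" using interior_subset by blast
  hence "interior (H f) \<inter> interior (H g) \<subseteq> convex hull (z ` (f \<inter> g))" using inter assms by blast
  hence "interior (H f) \<inter> interior (H g) \<subseteq> interior (convex hull (z ` (f \<inter> g)))"
    by (rule interior_maximal) auto
  moreover have "card (z ` (f \<inter> g)) \<le> 2" using c card_image_le[of "f \<inter> g" z] fin(1)[OF assms(1)] by auto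
  hence "interior (convex hull (z ` (f \<inter> g))) = {}"
    using fin(1)[OF assms(1)] by (intro empty_interior_convex_hull) auto
  ultimately show ?thesis by blast
qed

text \<open>The inscribed discs of distinct faces are disjoint and lie in the large disc; the
  constant is the square of their radius factor \<open>(sin \<epsilon>)^3 / 3\<close>.\<close>

lemma packing:
  assumes "finite G" "G \<subseteq> F" "\<And>f. f \<in> G \<Longrightarrow> H f \<subseteq> cball x \<rho>" "0 \<le> \<rho>"
  shows "(sin \<epsilon>)^6 / 9 * (\<Sum>f\<in>G. (dm f)\<^sup>2) \<le> \<rho>\<^sup>2"
proof -
  let ?r = "\<lambda>f. (sin \<epsilon>)^3 * dm f / 3"
  have "\<forall>f\<in>G. \<exists>g. ball g (?r f) \<subseteq> H f" using fat_face.inscribed_ball[OF face] assms by (metis subsetD)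
  then obtain c where c: "\<And>f. f \<in> G \<Longrightarrow> ball (c f) (?r f) \<subseteq> H f" by metis
  have r0: "0 \<le> ?r f" if "f \<in> G" for f
    using sin_eps dm_pos that assms by (intro divide_nonneg_pos mult_nonneg_nonneg zero_le_power) force+
  have "ball (c f) (?r f) \<subseteq> interior (H f)" if "f \<in> G" for f
    using c[OF that] by (rule interior_maximal) simp
  hence disj: "disjoint_family_on (\<lambda>f. ball (c f) (?r f)) G"
    unfolding disjoint_family_on_def using interior_disjoint assms(2) by blast
  have vol: "measure lborel (ball y s) = pi * s\<^sup>2" if "0 \<le> s" for y :: complex and s
    using that by (simp add: content_ball unit_ball_vol_2)
  have "pi * (\<Sum>f\<in>G. (?r f)\<^sup>2) = (\<Sum>f\<in>G. measure lborel (ball (c f) (?r f)))"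
    unfolding sum_distrib_left using vol r0 by (intro sum.cong) auto
  also have "\<dots> = measure lborel (\<Union>f\<in>G. ball (c f) (?r f))"
  proof (rule measure_finite_Union[symmetric, OF assms(1) _ disj])
    show "emeasure lborel (ball (c f) (?r f)) \<noteq> \<infinity>" for f
      using emeasure_lborel_ball_finite[of "c f" "?r f"] by (metis less_irrefl)
  qed auto
  also have "\<dots> \<le> measure lborel (cball x \<rho>)"
  proof (rule measure_mono_fmeasurable)
    show "(\<Union>f\<in>G. ball (c f) (?r f)) \<subseteq> cball x \<rho>" using c assms(3) by blast
    show "(\<Union>f\<in>G. ball (c f) (?r f)) \<in> sets lborel" by (auto intro!: borel_open open_UN)
    show "cball x \<rho> \<in> fmeasurable lborel" by (intro fmeasurable_compact) simp
  qed
  also have "\<dots> = pi * \<rho>\<^sup>2" using vol[OF assms(4)] by (simp add: content_cball_conv_ball)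
  finally have "(\<Sum>f\<in>G. (?r f)\<^sup>2) \<le> \<rho>\<^sup>2" by simp
  moreover have "(?r f)\<^sup>2 = (sin \<epsilon>)^6 / 9 * (dm f)\<^sup>2" for f
    by (simp add: power_mult_distrib power_divide flip: power_mult)
  ultimately show ?thesis by (simp add: sum_distrib_left)
qed

subsection \<open>Faces far from a vertex are not too large\<close>

abbreviation nbrs :: "'v set \<Rightarrow> 'v set set" where "nbrs f \<equiv> {g \<in> F. g \<inter> f \<noteq> {}}"

lemma nbrs_finite: "f \<in> F \<Longrightarrow> finite (nbrs f)"
proof -
  assume f: "f \<in> F"
  have "nbrs f = (\<Union>v\<in>f. star v)" by auto
  thus ?thesis using fin(1)[OF f] star_finite(1) by simp
qed

text \<open>The tent function of \<open>f\<close> is 1 on \<open>f\<close>, positive only on faces touching \<open>f\<close>, and has Lipschitz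
  constant comparable to the inverse diameter of \<open>f\<close>. So a short segment starting in \<open>f\<close> can neither
  reach a vertex outside \<open>f\<close> nor leave the neighbours of \<open>f\<close>.\<close>

definition tent :: "'v set \<Rightarrow> 'v set \<Rightarrow> complex \<Rightarrow> real" where
  "tent f g p = (\<Sum>i\<in>g \<inter> f. bary z g i p)"

lemma tent_consistent:
  assumes "g \<in> F" "h \<in> F" "p \<in> H g" "p \<in> H h"
  shows "tent f g p = tent f h p"
proof -
  have 1: "tent f g p = (\<Sum>i\<in>g \<inter> h \<inter> f. bary z h i p)" if "g \<in> F" "h \<in> F" "p \<in> H g" "p \<in> H h" for g h
  proof -
    have "tent f g p = (\<Sum>i\<in>g \<inter> f. if i \<in> h then bary z h i p else 0)"
      unfolding tent_def using bary_consistent[OF that] by (intro sum.cong) auto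
    also have "\<dots> = (\<Sum>i\<in>g \<inter> h \<inter> f. bary z h i p)"
      using fin(1)[OF that(1)] by (intro sum.mono_neutral_cong_right) auto
    finally show ?thesis .
  qed
  have "tent f g p = (\<Sum>i\<in>g \<inter> h \<inter> f. bary z g i p)"
    unfolding 1[OF assms] using bary_consistent[OF assms] by (intro sum.cong) auto
  also have "\<dots> = tent f h p" unfolding 1[OF assms(2,1,4,3)] by (simp add: Int_commute)
  finally show ?thesis .
qed

text \<open>The factor 3 counts vertices. Restricting to neighbours of \<open>f\<close> lets
  \<open>star_comparable\<close> express the constant through \<open>dm f\<close> instead of
  \<open>dm g\<close>.\<close>

lemma tent_lipschitz:
  assumes "f \<in> F" "g \<in> nbrs f"
  shows "\<bar>tent f g p - tent f g q\<bar> \<le> 3 * comp_const / ((sin \<epsilon>)^3 * dm f) * cmod (p - q)"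
proof -
  have g: "g \<in> F" "g \<inter> f \<noteq> {}" using assms by auto
  have ne: "F \<noteq> {}" using g by blast
  have s: "0 < (sin \<epsilon>)^3" using sin_eps[OF ne] by simp
  have dg: "0 < dm g" "0 < dm f" using dm_pos g assms by auto
  obtain v where v: "v \<in> g" "v \<in> f" using g by blast
  have cmp: "dm f \<le> comp_const * dm g" using star_comparable[of f v g] v g assms by auto
  have "\<bar>tent f g p - tent f g q\<bar> = \<bar>\<Sum>i\<in>g \<inter> f. bary z g i p - bary z g i q\<bar>"
    unfolding tent_def by (simp add: sum_subtractf)
  also have "\<dots> \<le> (\<Sum>i\<in>g \<inter> f. \<bar>bary z g i p - bary z g i q\<bar>)" by (rule sum_abs)
  also have "\<dots> \<le> (\<Sum>i\<in>g \<inter> f. cmod (p - q) / ((sin \<epsilon>)^3 * dm g))"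
    by (intro sum_mono fat_face.bary_lipschitz[OF face[OF g(1)]]) auto
  also have "\<dots> = card (g \<inter> f) * (cmod (p - q) / ((sin \<epsilon>)^3 * dm g))" by simp
  also have "\<dots> \<le> 3 * (cmod (p - q) / ((sin \<epsilon>)^3 * dm g))"
  proof (rule mult_right_mono)
    have "card (g \<inter> f) \<le> card g" using fin(1)[OF g(1)] by (intro card_mono) auto
    thus "real (card (g \<inter> f)) \<le> 3" using card3[OF g(1)] by simp
    show "0 \<le> cmod (p - q) / ((sin \<epsilon>)^3 * dm g)" using s dg by simp
  qed
  also have "\<dots> \<le> 3 * (cmod (p - q) * (comp_const / ((sin \<epsilon>)^3 * dm f)))"
  proof -
    have "1 / ((sin \<epsilon>)^3 * dm g) \<le> comp_const / ((sin \<epsilon>)^3 * dm f)"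
      using cmp s dg by (simp add: field_simps)
    hence "cmod (p - q) * (1 / ((sin \<epsilon>)^3 * dm g)) \<le> cmod (p - q) * (comp_const / ((sin \<epsilon>)^3 * dm f))"
      by (intro mult_left_mono) auto
    thus ?thesis by simp
  qed
  finally show ?thesis by (simp add: mult_ac)
qed

lemma far_vertex:
  assumes f: "f \<in> F" and p: "p \<in> H f" and v0: "v0 \<in> \<Union>F" "v0 \<notin> f"
  shows "1 \<le> 3 * comp_const / ((sin \<epsilon>)^3 * dm f) * cmod (p - z v0)"
proof (rule ccontr)
  define L where "L = 3 * comp_const / ((sin \<epsilon>)^3 * dm f)"
  define d where "d = cmod (p - z v0)"
  assume "\<not> ?thesis"
  hence Ld: "L * d < 1" unfolding L_def d_def by simp
  have ne: "F \<noteq> {}" using f by blast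
  have L0: "0 \<le> L" unfolding L_def using comp_const_ge_1[OF ne] sin_eps[OF ne] dm_pos[OF f] by simp
  have d0: "0 \<le> d" unfolding d_def by simp
  define \<gamma> where "\<gamma> t = p + of_real t * (z v0 - p)" for t :: real
  have \<gamma>_cont: "continuous_on S \<gamma>" for S unfolding \<gamma>_def by (intro continuous_intros)
  have \<gamma>_diff: "cmod (\<gamma> s - \<gamma> t) = \<bar>s - t\<bar> * d" for s t
  proof -
    have "\<gamma> s - \<gamma> t = of_real (s - t) * (z v0 - p)" unfolding \<gamma>_def by (simp add: algebra_simps)
    thus ?thesis unfolding d_def by (simp only: norm_mult norm_of_real norm_minus_commute[of p])
  qed
  define K where "K = (\<Union>g\<in>nbrs f. H g)"
  have K_closed: "closed K" unfolding K_def using nbrs_finite[OF f] closed_H by (intro closed_UN) auto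
  have fN: "f \<in> nbrs f" using f fin by auto
  have \<gamma>0: "\<gamma> 0 \<in> H f" "\<gamma> 1 = z v0" unfolding \<gamma>_def using p by auto
  \<comment> \<open>The choice of face is immaterial by \<open>tent_consistent\<close>; along the
    segment \<open>h\<close> is therefore one function, Lipschitz on finitely many closed
    pieces.\<close>
  define h where "h t = tent f (SOME g. g \<in> nbrs f \<and> \<gamma> t \<in> H g) (\<gamma> t)" for t
  have h_eq: "h t = tent f g (\<gamma> t)" if g: "g \<in> F" "\<gamma> t \<in> H g" and K: "\<gamma> t \<in> K" for t g
  proof -
    have "\<exists>g. g \<in> nbrs f \<and> \<gamma> t \<in> H g" using K unfolding K_def by blast
    hence "(SOME g. g \<in> nbrs f \<and> \<gamma> t \<in> H g) \<in> nbrs f \<and> \<gamma> t \<in> H (SOME g. g \<in> nbrs f \<and> \<gamma> t \<in> H g)"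
      by (rule someI_ex)
    thus ?thesis unfolding h_def using tent_consistent g by blast
  qed
  have h_pos: "0 < h s" if s: "0 \<le> s" "s \<le> 1" "\<And>t. 0 \<le> t \<Longrightarrow> t \<le> s \<Longrightarrow> \<gamma> t \<in> K" for s
  proof -
    have "lipschitz_on (L * d) {0..s} h"
    proof (rule lipschitz_on_closed_Union[where I = "nbrs f" and U = "\<lambda>g. {t \<in> {0..s}. \<gamma> t \<in> H g}"])
      fix g assume g: "g \<in> nbrs f"
      have "{t \<in> {0..s}. \<gamma> t \<in> H g} = {0..s} \<inter> \<gamma> -` H g" by auto
      thus "closed {t \<in> {0..s}. \<gamma> t \<in> H g}"
        using continuous_closed_preimage[OF \<gamma>_cont[of "{0..s}"], of "H g"] closed_H(1)[of g] g by auto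
      show "lipschitz_on (L * d) {t \<in> {0..s}. \<gamma> t \<in> H g} h"
      proof (rule lipschitz_onI)
        fix t t' assume t: "t \<in> {t \<in> {0..s}. \<gamma> t \<in> H g}" "t' \<in> {t \<in> {0..s}. \<gamma> t \<in> H g}"
        have "h t = tent f g (\<gamma> t)" "h t' = tent f g (\<gamma> t')" using t g s by (auto intro!: h_eq)
        hence "dist (h t) (h t') \<le> L * cmod (\<gamma> t - \<gamma> t')"
          using tent_lipschitz[OF f g] unfolding L_def dist_real_def by simp
        thus "dist (h t) (h t') \<le> L * d * dist t t'" unfolding \<gamma>_diff dist_real_def by (simp add: mult_ac)
      qed (use L0 d0 in simp)
    next
      show "{0..s} \<subseteq> (\<Union>g\<in>nbrs f. {t \<in> {0..s}. \<gamma> t \<in> H g})" using s(3) unfolding K_def by fastforce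
    qed (use nbrs_finite[OF f] L0 d0 in auto)
    hence "dist (h s) (h 0) \<le> L * d * dist s 0" using s by (intro lipschitz_onD) auto
    also have "\<dots> \<le> L * d * 1" using s L0 d0 by (intro mult_left_mono) (auto simp: dist_real_def)
    finally have "dist (h s) (h 0) < 1" using Ld by simp
    moreover have "h 0 = tent f f (\<gamma> 0)" using s f \<gamma>0 by (intro h_eq) auto
    hence "h 0 = 1" unfolding tent_def using fat_face.bary_sum(1)[OF face[OF f]] by simp
    ultimately show ?thesis by (simp add: dist_real_def)
  qed
  \<comment> \<open>Nothing guarantees in advance that the segment remains in the union of the
    faces. If it stays among the neighbours of \<open>f\<close>, the tent is both positive and zero
    at \<open>z v0\<close>; otherwise the first exit time is examined.\<close>
  define B where "B = {t \<in> {0..1}. \<gamma> t \<notin> K}"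
  show False
  proof (cases "B = {}")
    case True
    hence all: "\<gamma> t \<in> K" if "0 \<le> t" "t \<le> 1" for t using that unfolding B_def by auto
    have "0 < h 1" using all by (intro h_pos) auto
    moreover obtain g where g: "g \<in> F" "\<gamma> 1 \<in> H g" using all[of 1] unfolding K_def by auto
    ultimately have "0 < tent f g (z v0)" using h_eq[OF g] all[of 1] \<gamma>0 by simp
    moreover have "v0 \<in> g" using vertex_mem[OF v0(1) g(1)] g(2) \<gamma>0 by simp
    hence "bary z g i (z v0) = 0" if "i \<in> g \<inter> f" for i
      using fat_face.bary_vertex[OF face[OF g(1)], of i v0] that v0(2) by auto
    hence "tent f g (z v0) = 0" unfolding tent_def by (intro sum.neutral) auto
    ultimately show False by simp
  next
    case False
    define s where "s = Inf B"
    have bdd: "bdd_below B" unfolding B_def by auto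
    obtain b where b: "b \<in> B" using False by blast
    have s01: "0 \<le> s" "s \<le> 1"
    proof -
      show "0 \<le> s" unfolding s_def using False by (intro cInf_greatest) (auto simp: B_def)
      have "s \<le> b" unfolding s_def using b bdd by (rule cInf_lower)
      thus "s \<le> 1" using b unfolding B_def by auto
    qed
    have below: "\<gamma> t \<in> K" if "0 \<le> t" "t < s" for t
    proof (rule ccontr)
      assume "\<gamma> t \<notin> K"
      hence "t \<in> B" using that s01 unfolding B_def by auto
      hence "s \<le> t" unfolding s_def using bdd by (rule cInf_lower)
      thus False using that by simp
    qed
    have sK: "\<gamma> s \<in> K"
    proof (cases "s = 0")
      case True thus ?thesis using \<gamma>0 fN unfolding K_def by blast
    next
      case False
      have "closed (\<gamma> -` K)" using K_closed \<gamma>_cont[of UNIV] by (metis closed_vimage continuous_on_eq_continuous_at open_UNIV)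
      moreover have "{0<..<s} \<subseteq> \<gamma> -` K" using below by auto
      ultimately have "closure {0<..<s} \<subseteq> \<gamma> -` K" by (rule closure_minimal[rotated])
      thus ?thesis using False s01 by auto
    qed
    have upto: "\<gamma> t \<in> K" if "0 \<le> t" "t \<le> s" for t using that below sK by (cases "t = s") auto
    have hs: "0 < h s" using s01 upto by (intro h_pos) auto
    obtain g where g: "g \<in> F" "\<gamma> s \<in> H g" using sK unfolding K_def by auto
    obtain r where r: "r > 0" "ball (\<gamma> s) r \<subseteq> (\<Union>g\<in>{g\<in>F. \<gamma> s \<in> H g}. H g)" using nbhd[OF g] by blast
    \<comment> \<open>At the exit point the tent is still positive, so every face through it touches
      \<open>f\<close>. These faces cover a neighbourhood, so the segment cannot leave
      \<open>K\<close> there.\<close>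
    have "{g\<in>F. \<gamma> s \<in> H g} \<subseteq> nbrs f"
    proof
      fix i assume i: "i \<in> {g\<in>F. \<gamma> s \<in> H g}"
      hence "0 < tent f i (\<gamma> s)" using h_eq[of i s] hs sK by auto
      hence "i \<inter> f \<noteq> {}" unfolding tent_def by auto
      thus "i \<in> nbrs f" using i by auto
    qed
    hence "(\<Union>g\<in>{g\<in>F. \<gamma> s \<in> H g}. H g) \<subseteq> K" unfolding K_def by (rule UN_mono) simp
    hence rK: "ball (\<gamma> s) r \<subseteq> K" using r(2) by (rule subset_trans[rotated])
    have "Inf B < s + r / (d + 1)" using r(1) d0 unfolding s_def by simp
    then obtain t where t: "t \<in> B" "t < s + r / (d + 1)" using cInf_lessD[OF False] by blast
    have "s \<le> t" unfolding s_def using t(1) bdd by (rule cInf_lower)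
    have "\<bar>s - t\<bar> * d \<le> r / (d + 1) * d" using t(2) \<open>s \<le> t\<close> d0 by (intro mult_right_mono) auto
    also have "\<dots> < r" using r(1) d0 by (simp add: field_simps)
    finally have "\<gamma> t \<in> ball (\<gamma> s) r" using \<gamma>_diff[of s t] by (simp add: dist_norm)
    hence "\<gamma> t \<in> K" using rK by blast
    thus False using t(1) unfolding B_def by simp
  qed
qed

theorem size_bound:
  assumes v0: "v0 \<in> \<Union>F"
  obtains C where "1 \<le> C" "\<And>f p. f \<in> F \<Longrightarrow> p \<in> H f \<Longrightarrow> dm f \<le> C * (1 + cmod (p - z v0))"
proof
  \<comment> \<open>The last summand takes care of the finitely many faces at \<open>v0\<close>, the
    second one of all others through \<open>far_vertex\<close>.\<close>
  define C where "C = 1 + 3 * comp_const / (sin \<epsilon>)^3 + (\<Sum>f\<in>star v0. dm f)"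
  have ne: "F \<noteq> {}" using v0 by blast
  have c0: "0 \<le> 3 * comp_const / (sin \<epsilon>)^3" using comp_const_ge_1[OF ne] sin_eps[OF ne] by simp
  have s0: "0 \<le> (\<Sum>f\<in>star v0. dm f)" using dm_pos by (intro sum_nonneg) (auto intro: less_imp_le)
  show C1: "1 \<le> C" unfolding C_def using c0 s0 by simp
  fix f p assume f: "f \<in> F" "p \<in> H f"
  show "dm f \<le> C * (1 + cmod (p - z v0))"
  proof (cases "v0 \<in> f")
    case True
    have "dm f \<le> (\<Sum>f\<in>star v0. dm f)"
      using True f star_finite(1) dm_pos by (intro member_le_sum) (auto intro: less_imp_le)
    also have "\<dots> \<le> C * 1" unfolding C_def using c0 by simp
    also have "\<dots> \<le> C * (1 + cmod (p - z v0))" using C1 by (intro mult_left_mono) auto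
    finally show ?thesis .
  next
    case False
    have "1 \<le> 3 * comp_const / ((sin \<epsilon>)^3 * dm f) * cmod (p - z v0)" by (rule far_vertex[OF f v0 False])
    hence "dm f \<le> 3 * comp_const / (sin \<epsilon>)^3 * cmod (p - z v0)"
      using dm_pos[OF f(1)] sin_eps[OF ne] by (simp add: field_simps)
    also have "\<dots> \<le> C * (1 + cmod (p - z v0))" using c0 s0 unfolding C_def by (intro mult_mono) auto
    finally show ?thesis .
  qed
qed

end

section \<open>Radial ranges of faces and size control around a base vertex\<close>

lemma Lipschitz_range:
  fixes \<psi> :: "complex \<Rightarrow> real"
  assumes S: "S \<noteq> {}" and d: "\<And>x y. x \<in> S \<Longrightarrow> y \<in> S \<Longrightarrow> cmod (x - y) \<le> d"
    and L: "\<And>x y. \<bar>\<psi> x - \<psi> y\<bar> \<le> cmod (x - y)"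
  shows "x \<in> S \<Longrightarrow> Inf (\<psi> ` S) \<le> \<psi> x" "x \<in> S \<Longrightarrow> \<psi> x \<le> Sup (\<psi> ` S)"
    "Inf (\<psi> ` S) \<le> Sup (\<psi> ` S)" "Sup (\<psi> ` S) - Inf (\<psi> ` S) \<le> d"
proof -
  obtain x0 where x0: "x0 \<in> S" using S by blast
  have b: "\<bar>\<psi> x - \<psi> y\<bar> \<le> d" if "x \<in> S" "y \<in> S" for x y using d[OF that] L[of x y] by linarith
  have "\<psi> x0 - d \<le> \<psi> x \<and> \<psi> x \<le> \<psi> x0 + d" if "x \<in> S" for x using b[OF x0 that] by linarith
  hence bdd: "bdd_below (\<psi> ` S)" "bdd_above (\<psi> ` S)"
    unfolding bdd_below_def bdd_above_def by blast+
  show 1: "x \<in> S \<Longrightarrow> Inf (\<psi> ` S) \<le> \<psi> x" for x using bdd by (intro cInf_lower) auto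
  show 2: "x \<in> S \<Longrightarrow> \<psi> x \<le> Sup (\<psi> ` S)" for x using bdd by (intro cSup_upper) auto
  show "Inf (\<psi> ` S) \<le> Sup (\<psi> ` S)" using 1[OF x0] 2[OF x0] by linarith
  have "\<psi> y - d \<le> Inf (\<psi> ` S)" if "y \<in> S" for y
    using S b[OF that] by (intro cInf_greatest) force+
  hence "\<psi> y \<le> Inf (\<psi> ` S) + d" if "y \<in> S" for y using that by force
  hence "Sup (\<psi> ` S) \<le> Inf (\<psi> ` S) + d" using S by (intro cSup_least) auto
  thus "Sup (\<psi> ` S) - Inf (\<psi> ` S) \<le> d" by simp
qed

lemma cmod_diff_lipschitz: "\<bar>cmod (x - a) - cmod (y - a)\<bar> \<le> cmod (x - y)"
proof -
  have "x - y = (x - a) - (y - a)" by simp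
  thus ?thesis by (metis norm_triangle_ineq3)
qed

context planar
begin

lemma H_nonempty: "f \<in> F \<Longrightarrow> H f \<noteq> {}"
  using fin(2) by simp

lemma dist_H: "f \<in> F \<Longrightarrow> x \<in> H f \<Longrightarrow> y \<in> H f \<Longrightarrow> cmod (x - y) \<le> dm f"
  using dist_hull_le_fdiam fin(1) by metis

definition rlo :: "complex \<Rightarrow> 'v set \<Rightarrow> real" where "rlo a f = Inf ((\<lambda>w. cmod (w - a)) ` H f)"
definition rhi :: "complex \<Rightarrow> 'v set \<Rightarrow> real" where "rhi a f = Sup ((\<lambda>w. cmod (w - a)) ` H f)"

lemma radial_range:
  assumes "f \<in> F"
  shows "x \<in> H f \<Longrightarrow> rlo a f \<le> cmod (x - a)" "x \<in> H f \<Longrightarrow> cmod (x - a) \<le> rhi a f"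
    "rlo a f \<le> rhi a f" "rhi a f - rlo a f \<le> dm f"
  unfolding rlo_def rhi_def
  using Lipschitz_range[OF H_nonempty[OF assms] dist_H[OF assms], of "\<lambda>w. cmod (w - a)"] cmod_diff_lipschitz[of _ a]
  by auto

text \<open>A 1-Lipschitz function maps each face into an interval no longer than its diameter, so a
  family whose values fill an interval has at least that total diameter.\<close>

lemma projection_cover:
  fixes \<psi> :: "complex \<Rightarrow> real"
  assumes G: "finite G" "G \<subseteq> F" and L: "\<And>x y. \<bar>\<psi> x - \<psi> y\<bar> \<le> cmod (x - y)" and ab: "a \<le> b"
    and cov: "\<And>r. a < r \<Longrightarrow> r < b \<Longrightarrow> \<exists>f\<in>G. \<exists>x\<in>H f. \<psi> x = r"
  shows "b - a \<le> (\<Sum>f\<in>G. dm f)"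
proof -
  have R: "x \<in> H f \<Longrightarrow> Inf (\<psi> ` H f) \<le> \<psi> x" "x \<in> H f \<Longrightarrow> \<psi> x \<le> Sup (\<psi> ` H f)"
    "Inf (\<psi> ` H f) \<le> Sup (\<psi> ` H f)" "Sup (\<psi> ` H f) - Inf (\<psi> ` H f) \<le> dm f" if "f \<in> G" for f x
  proof -
    have f: "f \<in> F" using that G by blast
    show "x \<in> H f \<Longrightarrow> Inf (\<psi> ` H f) \<le> \<psi> x" "x \<in> H f \<Longrightarrow> \<psi> x \<le> Sup (\<psi> ` H f)"
      "Inf (\<psi> ` H f) \<le> Sup (\<psi> ` H f)" "Sup (\<psi> ` H f) - Inf (\<psi> ` H f) \<le> dm f"
      using Lipschitz_range[OF H_nonempty[OF f] dist_H[OF f] L] by auto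
  qed
  have "b - a \<le> (\<Sum>f\<in>G. Sup (\<psi> ` H f) - Inf (\<psi> ` H f))"
  proof (rule interval_cover_length[OF G(1) R(3) ab])
    fix r assume "a < r" "r < b"
    then obtain f x where "f \<in> G" "x \<in> H f" "\<psi> x = r" using cov by blast
    thus "\<exists>f\<in>G. Inf (\<psi> ` H f) \<le> r \<and> r \<le> Sup (\<psi> ` H f)" using R(1,2)[of f x] by blast
  qed
  also have "\<dots> \<le> (\<Sum>f\<in>G. dm f)" by (intro sum_mono R(4))
  finally show ?thesis .
qed

text \<open>Fixing one admissible constant by choice allows all constants derived from it to be
  definitions.\<close>

definition size_const :: "'v \<Rightarrow> real" where
  "size_const v0 = (SOME C. 1 \<le> C \<and> (\<forall>f\<in>F. \<forall>p\<in>H f. dm f \<le> C * (1 + cmod (p - z v0))))"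

lemma size_const:
  assumes "v0 \<in> \<Union>F"
  shows "1 \<le> size_const v0" "f \<in> F \<Longrightarrow> p \<in> H f \<Longrightarrow> dm f \<le> size_const v0 * (1 + cmod (p - z v0))"
proof -
  have "\<exists>C. 1 \<le> C \<and> (\<forall>f\<in>F. \<forall>p\<in>H f. dm f \<le> C * (1 + cmod (p - z v0)))"
    using size_bound[OF assms] by metis
  from someI_ex[OF this] show "1 \<le> size_const v0" "f \<in> F \<Longrightarrow> p \<in> H f \<Longrightarrow> dm f \<le> size_const v0 * (1 + cmod (p - z v0))"
    unfolding size_const_def by blast+
qed

lemma dm_near:
  assumes "v0 \<in> \<Union>F" "f \<in> F" "p \<in> H f" "cmod (p - z v0) \<le> \<tau>"
  shows "dm f \<le> size_const v0 * (1 + \<tau>)"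
proof -
  have "dm f \<le> size_const v0 * (1 + cmod (p - z v0))" by (rule size_const(2)[OF assms(1-3)])
  also have "\<dots> \<le> size_const v0 * (1 + \<tau>)" using size_const(1)[OF assms(1)] assms(4) by (intro mult_left_mono) auto
  finally show ?thesis .
qed

lemma near_face_subset:
  assumes "v0 \<in> \<Union>F" "f \<in> F" "H f \<inter> cball (z v0) \<tau> \<noteq> {}"
  shows "H f \<subseteq> cball (z v0) (\<tau> + size_const v0 * (1 + \<tau>))"
proof
  fix q assume q: "q \<in> H f"
  obtain p where p: "p \<in> H f" "cmod (p - z v0) \<le> \<tau>" using assms(3) by (auto simp: dist_norm norm_minus_commute)
  have "cmod (q - z v0) \<le> cmod (p - z v0) + cmod (q - p)"
    using norm_triangle_ineq[of "p - z v0" "q - p"] by simp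
  also have "\<dots> \<le> \<tau> + dm f" using p dist_H[OF assms(2) q p(1)] by simp
  also have "\<dots> \<le> \<tau> + size_const v0 * (1 + \<tau>)" using dm_near[OF assms(1,2) p] by simp
  finally show "q \<in> cball (z v0) (\<tau> + size_const v0 * (1 + \<tau>))" by (simp add: dist_norm norm_minus_commute)
qed

end

section \<open>Two triangulations of the same combinatorial type\<close>

text \<open>\<open>h\<close> stands for the comparison map between the two realizations. Covering
  the plane and local finiteness are demanded of \<open>z\<close> alone, so every disc exhaustion
  below is taken on that side.\<close>

locale plane_pair = P: planar F z \<epsilon> + Q: planar F z' \<epsilon>
  for F :: "'v set set" and z z' :: "'v \<Rightarrow> complex" and \<epsilon> :: real +
  fixes h :: "complex \<Rightarrow> complex" and u :: "'v \<Rightarrow> real" and v0 :: 'v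
  assumes v0: "v0 \<in> \<Union>F"
    and cover: "(\<Union>f\<in>F. convex hull (z ` f)) = UNIV"
    and locfin: "\<And>R. finite {f \<in> F. convex hull (z ` f) \<inter> cball (z v0) R \<noteq> {}}"
    and cont: "continuous_on UNIV h" and injh: "inj h"
    and maps: "\<And>f. f \<in> F \<Longrightarrow> h ` (convex hull (z ` f)) = convex hull (z' ` f)"
    and hz: "\<And>v. v \<in> \<Union>F \<Longrightarrow> h (z v) = z' v"
    and conf: "\<And>f i j. f \<in> F \<Longrightarrow> i \<in> f \<Longrightarrow> j \<in> f \<Longrightarrow> i \<noteq> j \<Longrightarrow>
        cmod (z' i - z' j) = exp ((u i + u j) / 2) * cmod (z i - z j)"
begin

abbreviation "o1 \<equiv> z v0"
abbreviation "o2 \<equiv> z' v0"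

definition faces_near :: "real \<Rightarrow> 'v set set" where "faces_near R = {f \<in> F. P.H f \<inter> cball o1 R \<noteq> {}}"

lemma faces_near: "finite (faces_near R)" "faces_near R \<subseteq> F" "f \<in> faces_near R \<Longrightarrow> P.H f \<inter> cball o1 R \<noteq> {}"
  unfolding faces_near_def using locfin by auto

lemma s_pos: "0 < sin \<epsilon>" using P.sin_eps v0 by blast

text \<open>Chosen so that \<open>R + C * (1 + R) \<le> reach * R\<close> for
  \<open>1 \<le> R\<close>, where \<open>C\<close> is the size constant.\<close>

definition reach :: real where "reach = 1 + 2 * P.size_const v0"

lemma reach_ge: "3 \<le> reach" unfolding reach_def using P.size_const(1)[OF v0] by simp

lemma faces_near_subset:
  assumes "1 \<le> R" "f \<in> faces_near R"
  shows "P.H f \<subseteq> cball o1 (reach * R)"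
proof -
  have "P.H f \<subseteq> cball o1 (R + P.size_const v0 * (1 + R))"
    using assms faces_near by (intro P.near_face_subset v0) auto
  also have "\<dots> \<subseteq> cball o1 (reach * R)"
  proof (rule subset_cball)
    have "P.size_const v0 * (1 + R) \<le> P.size_const v0 * (2 * R)"
      using P.size_const(1)[OF v0] assms by (intro mult_left_mono) auto
    thus "R + P.size_const v0 * (1 + R) \<le> reach * R" unfolding reach_def by (simp add: algebra_simps)
  qed
  finally show ?thesis .
qed

definition pack_const :: real where "pack_const = 9 / (sin \<epsilon>)^6 * reach\<^sup>2"

lemma pack_const_pos: "0 < pack_const" unfolding pack_const_def using s_pos reach_ge by simp

lemma faces_near_packing:
  assumes "1 \<le> R"
  shows "(\<Sum>f\<in>faces_near R. (P.dm f)\<^sup>2) \<le> pack_const * R\<^sup>2"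
proof -
  have "(sin \<epsilon>)^6 / 9 * (\<Sum>f\<in>faces_near R. (P.dm f)\<^sup>2) \<le> (reach * R)\<^sup>2"
    using faces_near_subset[OF assms] faces_near reach_ge assms by (intro P.packing) auto
  thus ?thesis unfolding pack_const_def using s_pos by (simp add: field_simps power_mult_distrib)
qed

subsection \<open>Polynomial growth of the comparison map\<close>

definition D :: "real \<Rightarrow> real" where "D R = Sup ((\<lambda>x. cmod (h x - o2)) ` cball o1 R)"

lemma h_o1: "h o1 = o2" using hz v0 by blast

lemma cont_mod: "continuous_on S (\<lambda>x. cmod (h x - o2))"
  using continuous_on_subset[OF cont, of S] by (intro continuous_intros) auto

lemma D_attained:
  assumes "0 \<le> R"
  obtains x where "x \<in> cball o1 R" "D R = cmod (h x - o2)"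
proof -
  have "compact ((\<lambda>x. cmod (h x - o2)) ` cball o1 R)" by (intro compact_continuous_image cont_mod) simp
  moreover have "(\<lambda>x. cmod (h x - o2)) ` cball o1 R \<noteq> {}" using assms by simp
  ultimately have "D R \<in> (\<lambda>x. cmod (h x - o2)) ` cball o1 R"
    unfolding D_def by (intro closed_contains_Sup compact_imp_closed bounded_imp_bdd_above compact_imp_bounded)
  thus ?thesis using that by blast
qed

lemma D_ge: "x \<in> cball o1 R \<Longrightarrow> cmod (h x - o2) \<le> D R"
  unfolding D_def
  by (intro cSup_upper bounded_imp_bdd_above compact_imp_bounded compact_continuous_image cont_mod) auto

lemma D_mono: "0 \<le> R \<Longrightarrow> R \<le> S \<Longrightarrow> D R \<le> D S"
  using D_attained[of R] D_ge[of _ S] by (metis subset_cball subsetD)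

lemma D_pos: "0 < R \<Longrightarrow> 0 < D R"
proof -
  assume R: "0 < R"
  have "o1 + of_real R \<noteq> o1" using R by simp
  hence "h (o1 + of_real R) \<noteq> o2" using injh h_o1 by (metis injD)
  hence "0 < cmod (h (o1 + of_real R) - o2)" by simp
  also have "\<dots> \<le> D R" using R by (intro D_ge) (simp add: dist_norm)
  finally show ?thesis .
qed

lemma h_open: "open S \<Longrightarrow> open (h ` S)"
  using cont injh by (intro invariance_of_domain) (auto intro: continuous_on_subset inj_on_subset)

text \<open>Maximum principle from invariance of domain: \<open>h\<close> is open, so at an interior
  maximum the image point could still be pushed radially away from \<open>o2\<close>.\<close>

lemma max_on_sphere:
  assumes R: "0 < R" and lt: "\<And>x. x \<in> sphere o1 R \<Longrightarrow> cmod (h x - o2) < t"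
  shows "D R < t"
proof -
  obtain x where x: "x \<in> cball o1 R" "D R = cmod (h x - o2)" using D_attained R by (metis less_imp_le)
  show ?thesis
  proof (cases "x \<in> sphere o1 R")
    case True thus ?thesis using lt x by simp
  next
    case False
    hence xb: "x \<in> ball o1 R" using x(1) by auto
    have "open (h ` ball o1 R)" by (rule h_open) simp
    then obtain e where e: "e > 0" "ball (h x) e \<subseteq> h ` ball o1 R" using xb by (metis imageI open_contains_ball)
    have D0: "0 < D R" by (rule D_pos[OF R])
    define y where "y = h x + of_real (e / 2 / D R) * (h x - o2)"
    have "y - h x = of_real (e / 2 / D R) * (h x - o2)" unfolding y_def by simp
    hence "cmod (y - h x) = \<bar>e / 2 / D R\<bar> * D R" using x(2) by (simp only: norm_mult norm_of_real)
    hence "cmod (y - h x) = e / 2" using e D0 by simp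
    hence "y \<in> ball (h x) e" using e by (simp add: dist_norm norm_minus_commute)
    then obtain w where w: "w \<in> ball o1 R" "y = h w" using e by blast
    have "y - o2 = of_real (1 + e / 2 / D R) * (h x - o2)" unfolding y_def by (simp add: algebra_simps)
    hence "cmod (y - o2) = \<bar>1 + e / 2 / D R\<bar> * D R" using x(2) by (simp only: norm_mult norm_of_real)
    also have "\<dots> = D R + e / 2" using e D0 by (simp add: field_simps)
    finally have "D R < cmod (h w - o2)" using w e by simp
    moreover have "cmod (h w - o2) \<le> D R" using w by (intro D_ge) auto
    ultimately show ?thesis by simp
  qed
qed

lemma face_at: obtains f where "f \<in> F" "x \<in> P.H f"
  using cover by blast

text \<open>Either the level set of \<open>t\<close> meets all circles of radius between \<open>2R\<close> and \<open>4R\<close>, or one of these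
  circles lies entirely beyond level \<open>t\<close> and every vertical segment from the disc of radius \<open>R\<close> to it
  crosses the level set.\<close>

lemma level_set_length:
  assumes R: "0 < R" and t: "D R < t" "t < D (2 * R)"
  shows "R \<le> (\<Sum>f\<in>{f \<in> faces_near (4 * R). Q.rlo o2 f \<le> t \<and> t \<le> Q.rhi o2 f}. P.dm f)"
proof -
  let ?G = "{f \<in> faces_near (4 * R). Q.rlo o2 f \<le> t \<and> t \<le> Q.rhi o2 f}"
  have G: "finite ?G" "?G \<subseteq> F" using faces_near(1)[of "4 * R"] faces_near(2)[of "4 * R"] by auto
  have hit: "\<exists>f\<in>?G. x \<in> P.H f" if x: "x \<in> cball o1 (4 * R)" "cmod (h x - o2) = t" for x
  proof -
    obtain f where f: "f \<in> F" "x \<in> P.H f" by (rule face_at)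
    have "h x \<in> Q.H f" using maps[OF f(1)] f(2) by blast
    hence "Q.rlo o2 f \<le> t \<and> t \<le> Q.rhi o2 f" using Q.radial_range(1,2)[OF f(1), of "h x" o2] x(2) by simp
    moreover have "f \<in> faces_near (4 * R)" unfolding faces_near_def using f x(1) by blast
    ultimately show ?thesis using f(2) by blast
  qed
  show ?thesis
  proof (cases "\<forall>s. 2 * R \<le> s \<and> s \<le> 4 * R \<longrightarrow> (\<exists>x\<in>sphere o1 s. cmod (h x - o2) = t)")
    case True
    have "4 * R - 2 * R \<le> (\<Sum>f\<in>?G. P.dm f)"
    proof (rule P.projection_cover[OF G, where \<psi> = "\<lambda>x. cmod (x - o1)"])
      show "\<exists>f\<in>?G. \<exists>x\<in>P.H f. cmod (x - o1) = r" if r: "2 * R < r" "r < 4 * R" for r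
      proof -
        obtain x where x: "x \<in> sphere o1 r" "cmod (h x - o2) = t" using True r by (meson less_imp_le)
        hence "cmod (x - o1) = r" by (simp add: dist_norm norm_minus_commute)
        moreover have "x \<in> cball o1 (4 * R)" using x(1) r by auto
        ultimately show ?thesis using hit[OF _ x(2)] by blast
      qed
    qed (use R cmod_diff_lipschitz in auto)
    thus ?thesis using R by simp
  next
    case False
    then obtain s where s: "2 * R \<le> s" "s \<le> 4 * R" and ne: "\<And>x. x \<in> sphere o1 s \<Longrightarrow> cmod (h x - o2) \<noteq> t" by blast
    have con: "connected ((\<lambda>x. cmod (h x - o2)) ` sphere o1 s)"
      by (intro connected_continuous_image cont_mod connected_sphere) simp
    \<comment> \<open>The circle avoids level \<open>t\<close> and is connected, so one point below
      \<open>t\<close> would put all of it below. The maximum principle would then give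
      \<open>D s < t\<close>, against \<open>t < D (2 * R)\<close>.\<close>
    have gt: "t < cmod (h x - o2)" if x: "x \<in> sphere o1 s" for x
    proof (rule ccontr)
      assume "\<not> t < cmod (h x - o2)"
      hence xt: "cmod (h x - o2) < t" using ne[OF x] by simp
      have "cmod (h y - o2) < t" if y: "y \<in> sphere o1 s" for y
      proof (rule ccontr)
        assume "\<not> cmod (h y - o2) < t"
        hence "t \<in> (\<lambda>x. cmod (h x - o2)) ` sphere o1 s"
          using xt connectedD_interval[OF con, of "cmod (h x - o2)" "cmod (h y - o2)" t] x y by auto
        thus False using ne by blast
      qed
      hence "D s < t" using s R by (intro max_on_sphere) auto
      moreover have "D (2 * R) \<le> D s" using s R by (intro D_mono) auto
      ultimately show False using t by simp
    qed
    have "R - 0 \<le> (\<Sum>f\<in>?G. P.dm f)"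
    proof (rule P.projection_cover[OF G, where \<psi> = "\<lambda>x. Re (x - o1)"])
      fix r assume r: "0 < r" "r < R"
      \<comment> \<open>Height at which the vertical line at offset \<open>r\<close> from
        \<open>o1\<close> meets the circle of radius \<open>s\<close>.\<close>
      define Y where "Y = sqrt (s\<^sup>2 - r\<^sup>2)"
      have rs: "r\<^sup>2 \<le> s\<^sup>2" using r s R by (intro power_mono) auto
      define g where "g y = o1 + Complex r y" for y
      have cg: "continuous_on S g" for S unfolding g_def Complex_eq by (intro continuous_intros)
      have ng: "cmod (g y - o1) = sqrt (r\<^sup>2 + y\<^sup>2)" for y unfolding g_def by (simp add: cmod_def)
      have g0: "cmod (g 0 - o1) = r" unfolding ng using r by simp
      have gY: "cmod (g Y - o1) = s" unfolding ng Y_def using rs r s R by simp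
      have le: "cmod (h (g 0) - o2) \<le> t"
      proof -
        have "g 0 \<in> cball o1 R" using g0 r by (simp add: dist_norm norm_minus_commute)
        thus ?thesis using D_ge[of "g 0" R] t by simp
      qed
      have "g Y \<in> sphere o1 s" using gY by (simp add: dist_norm norm_minus_commute)
      hence ge: "t \<le> cmod (h (g Y) - o2)" using gt by (meson less_imp_le)
      have Y0: "0 \<le> Y" unfolding Y_def using rs by simp
      have "continuous_on {0..Y} (\<lambda>y. cmod (h (g y) - o2))"
        using continuous_on_compose2[OF cont_mod[of UNIV] cg[of "{0..Y}"]] by auto
      then obtain y where y: "0 \<le> y" "y \<le> Y" "cmod (h (g y) - o2) = t"
        using IVT'[of "\<lambda>y. cmod (h (g y) - o2)" 0 t Y] le ge Y0 by auto
      have "cmod (g y - o1) \<le> cmod (g Y - o1)"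
        unfolding ng using y by (intro real_sqrt_le_mono add_left_mono power_mono) auto
      hence "g y \<in> cball o1 (4 * R)" using gY s by (simp add: dist_norm norm_minus_commute)
      then obtain f where "f \<in> ?G" "g y \<in> P.H f" using hit[OF _ y(3)] by blast
      moreover have "Re (g y - o1) = r" unfolding g_def by simp
      ultimately show "\<exists>f\<in>?G. \<exists>x\<in>P.H f. Re (x - o1) = r" by blast
    next
      show "\<bar>Re (x - o1) - Re (y - o1)\<bar> \<le> cmod (x - y)" for x y
        using abs_Re_le_cmod[of "x - y"] by simp
    qed (use R in auto)
    thus ?thesis by simp
  qed
qed

end

context planar
begin

lemma radial_attained:
  assumes "f \<in> F"
  obtains x where "x \<in> H f" "cmod (x - a) = rlo a f"
proof -
  have "compact ((\<lambda>w. cmod (w - a)) ` H f)"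
    by (intro compact_continuous_image closed_H(2)[OF assms] continuous_intros)
  moreover have "(\<lambda>w. cmod (w - a)) ` H f \<noteq> {}" using H_nonempty[OF assms] by blast
  ultimately have "rlo a f \<in> (\<lambda>w. cmod (w - a)) ` H f"
    unfolding rlo_def by (intro closed_contains_Inf compact_imp_closed bounded_imp_bdd_below compact_imp_bounded)
  thus ?thesis using that by force
qed

end

context plane_pair
begin

text \<open>For scales \<open>\<tau>\<close> above \<open>D 1\<close> the additive 1 of the size
  bound is at most \<open>\<tau> / D 1\<close>, which makes the bound homogeneous in
  \<open>\<tau>\<close>.\<close>

definition size_ratio :: real where "size_ratio = Q.size_const v0 * (1 / D 1 + 2)"

lemma size_ratio_pos: "0 < size_ratio"
  unfolding size_ratio_def using Q.size_const(1)[OF v0] D_pos[of 1] by (intro mult_pos_pos add_pos_pos) auto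

definition scale_fam :: "real \<Rightarrow> real \<Rightarrow> 'v set set" where
  "scale_fam R \<tau> = {f \<in> faces_near (4 * R). Q.rlo o2 f \<le> 2 * \<tau> \<and> \<tau> \<le> Q.rhi o2 f}"

lemma scale_fam_size:
  assumes "D 1 \<le> \<tau>" "f \<in> scale_fam R \<tau>"
  shows "Q.dm f \<le> size_ratio * \<tau>" "Q.rhi o2 f \<le> (2 + size_ratio) * \<tau>"
proof -
  have f: "f \<in> F" "Q.rlo o2 f \<le> 2 * \<tau>" using assms faces_near(2) unfolding scale_fam_def by auto
  obtain x where x: "x \<in> Q.H f" "cmod (x - o2) = Q.rlo o2 f" using Q.radial_attained[OF f(1)] .
  have "Q.dm f \<le> Q.size_const v0 * (1 + 2 * \<tau>)" using x f by (intro Q.dm_near v0) auto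
  also have "\<dots> \<le> Q.size_const v0 * (\<tau> / D 1 + 2 * \<tau>)"
    using Q.size_const(1)[OF v0] D_pos[of 1] assms(1) by (intro mult_left_mono add_mono) auto
  also have "\<dots> = size_ratio * \<tau>" unfolding size_ratio_def by (simp add: algebra_simps)
  finally show d: "Q.dm f \<le> size_ratio * \<tau>" .
  have "Q.rhi o2 f \<le> Q.rlo o2 f + Q.dm f" using Q.radial_range(4)[OF f(1), of o2] by simp
  thus "Q.rhi o2 f \<le> (2 + size_ratio) * \<tau>" using d f(2) by (simp add: algebra_simps)
qed

definition mass_const :: real where "mass_const = 9 / (sin \<epsilon>)^6 * (2 + size_ratio)\<^sup>2"

lemma mass_const_pos: "0 < mass_const" unfolding mass_const_def using s_pos size_ratio_pos by simp

text \<open>The families at scales that are a fixed factor apart are disjoint and each carries a fixed share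
  of the area, so only boundedly many scales fit between \<open>D R\<close> and \<open>D (2 * R)\<close>.\<close>

lemma scale_mass:
  assumes R: "1 \<le> R" and \<tau>: "D R \<le> \<tau>" "2 * \<tau> \<le> D (2 * R)"
  shows "R\<^sup>2 \<le> mass_const * (\<Sum>f\<in>scale_fam R \<tau>. (P.dm f)\<^sup>2)"
proof -
  let ?G = "scale_fam R \<tau>"
  have G: "finite ?G" "?G \<subseteq> F" unfolding scale_fam_def using faces_near(1,2)[of "4 * R"] by auto
  have D1: "D 1 \<le> \<tau>" using D_mono[of 1 R] R \<tau> by simp
  have \<tau>0: "0 < \<tau>" using D1 D_pos[of 1] by simp
  have "R * (2 * \<tau> - \<tau>) \<le> (\<Sum>f\<in>?G. P.dm f * (Q.rhi o2 f - Q.rlo o2 f))"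
  proof (rule weighted_interval_cover[OF G(1)])
    show "0 \<le> P.dm f" if "f \<in> ?G" for f using P.dm_pos[of f] that G by auto
    show "Q.rlo o2 f \<le> Q.rhi o2 f" if "f \<in> ?G" for f using Q.radial_range(3) that G by blast
    fix r assume r: "\<tau> < r" "r < 2 * \<tau>"
    have "R \<le> (\<Sum>f\<in>{f \<in> faces_near (4 * R). Q.rlo o2 f \<le> r \<and> r \<le> Q.rhi o2 f}. P.dm f)"
      using R r \<tau> by (intro level_set_length) auto
    also have "{f \<in> faces_near (4 * R). Q.rlo o2 f \<le> r \<and> r \<le> Q.rhi o2 f} = {f \<in> ?G. Q.rlo o2 f \<le> r \<and> r \<le> Q.rhi o2 f}"
      unfolding scale_fam_def using r by auto
    finally show "R \<le> (\<Sum>f\<in>{f \<in> ?G. Q.rlo o2 f \<le> r \<and> r \<le> Q.rhi o2 f}. P.dm f)" .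
  qed (use \<tau>0 in auto)
  also have "\<dots> \<le> (\<Sum>f\<in>?G. P.dm f * Q.dm f)"
    using G P.dm_pos Q.radial_range(4) by (intro sum_mono mult_left_mono) (auto intro: less_imp_le)
  finally have "R * \<tau> \<le> (\<Sum>f\<in>?G. P.dm f * Q.dm f)" by simp
  \<comment> \<open>Cauchy-Schwarz separates source area from image area. The latter is at most a
    multiple of \<open>\<tau>\<^sup>2\<close> by packing, which leaves a lower bound for the source
    area.\<close>
  hence "(R * \<tau>)\<^sup>2 \<le> (\<Sum>f\<in>?G. P.dm f * Q.dm f)\<^sup>2" using R \<tau>0 by (intro power_mono) auto
  also have "\<dots> \<le> (\<Sum>f\<in>?G. (P.dm f)\<^sup>2) * (\<Sum>f\<in>?G. (Q.dm f)\<^sup>2)" by (rule Cauchy_Schwarz_ineq_sum)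
  also have "\<dots> \<le> (\<Sum>f\<in>?G. (P.dm f)\<^sup>2) * (mass_const * \<tau>\<^sup>2)"
  proof (rule mult_left_mono)
    have "(sin \<epsilon>)^6 / 9 * (\<Sum>f\<in>?G. (Q.dm f)\<^sup>2) \<le> ((2 + size_ratio) * \<tau>)\<^sup>2"
    proof (rule Q.packing[OF G])
      show "Q.H f \<subseteq> cball o2 ((2 + size_ratio) * \<tau>)" if f: "f \<in> ?G" for f
      proof
        fix x assume "x \<in> Q.H f"
        hence "cmod (x - o2) \<le> Q.rhi o2 f" using Q.radial_range(2) f G by blast
        also have "\<dots> \<le> (2 + size_ratio) * \<tau>" by (rule scale_fam_size(2)[OF D1 f])
        finally show "x \<in> cball o2 ((2 + size_ratio) * \<tau>)" by (simp add: dist_norm norm_minus_commute)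
      qed
      show "0 \<le> (2 + size_ratio) * \<tau>" using size_ratio_pos \<tau>0 by simp
    qed
    hence "(\<Sum>f\<in>?G. (Q.dm f)\<^sup>2) \<le> 9 / (sin \<epsilon>)^6 * ((2 + size_ratio) * \<tau>)\<^sup>2"
      using s_pos by (simp add: pos_le_divide_eq mult.commute)
    thus "(\<Sum>f\<in>?G. (Q.dm f)\<^sup>2) \<le> mass_const * \<tau>\<^sup>2" unfolding mass_const_def power_mult_distrib by (simp only: mult.assoc)
  qed (auto intro: sum_nonneg)
  finally have "R\<^sup>2 * \<tau>\<^sup>2 \<le> (mass_const * (\<Sum>f\<in>?G. (P.dm f)\<^sup>2)) * \<tau>\<^sup>2" by (simp add: power_mult_distrib mult_ac)
  thus ?thesis using \<tau>0 by (simp add: mult_le_cancel_right_pos)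
qed

text \<open>Exceeds \<open>2 + size_ratio\<close>, the factor by which the image of a face of one
  family can overshoot its scale.\<close>

definition scale_ratio :: real where "scale_ratio = 3 + size_ratio"

lemma scale_fam_disjoint:
  assumes "D 1 \<le> \<tau>" "scale_ratio * \<tau> \<le> \<tau>'"
  shows "scale_fam R \<tau> \<inter> scale_fam R \<tau>' = {}"
proof (rule ccontr)
  assume "scale_fam R \<tau> \<inter> scale_fam R \<tau>' \<noteq> {}"
  then obtain f where f: "f \<in> scale_fam R \<tau>" "f \<in> scale_fam R \<tau>'" by blast
  have "\<tau>' \<le> Q.rhi o2 f" using f(2) unfolding scale_fam_def by blast
  also have "\<dots> \<le> (2 + size_ratio) * \<tau>" by (rule scale_fam_size(2)[OF assms(1) f(1)])
  also have "\<dots> < scale_ratio * \<tau>" unfolding scale_ratio_def using assms(1) D_pos[of 1] by (intro mult_strict_right_mono) auto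
  finally show False using assms(2) by simp
qed

lemma scales_bound:
  assumes R: "1 \<le> R" and n: "\<And>j. j < n \<Longrightarrow> 2 * (scale_ratio ^ j * D R) \<le> D (2 * R)"
  shows "real n \<le> 16 * mass_const * pack_const"
proof -
  let ?\<tau> = "\<lambda>j. scale_ratio ^ j * D R"
  have l1: "1 \<le> scale_ratio" unfolding scale_ratio_def using size_ratio_pos by simp
  have D0: "0 < D R" using R by (intro D_pos) simp
  have ge: "D R \<le> ?\<tau> j" for j using D0 one_le_power[OF l1, of j] by simp
  have D1: "D 1 \<le> ?\<tau> j" for j using ge[of j] D_mono[of 1 R] R by simp
  have disj: "scale_fam R (?\<tau> i) \<inter> scale_fam R (?\<tau> j) = {}" if "i < j" for i j
  proof (rule scale_fam_disjoint[OF D1])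
    have "scale_ratio ^ Suc i \<le> scale_ratio ^ j" using that l1 by (intro power_increasing) auto
    thus "scale_ratio * ?\<tau> i \<le> ?\<tau> j" using D0 by (simp add: mult.assoc[symmetric])
  qed
  have fin: "finite (scale_fam R \<tau>)" "scale_fam R \<tau> \<subseteq> faces_near (4 * R)" for \<tau>
    unfolding scale_fam_def using faces_near(1)[of "4 * R"] by auto
  have "real n * R\<^sup>2 = (\<Sum>j<n. R\<^sup>2)" by simp
  also have "\<dots> \<le> (\<Sum>j<n. mass_const * (\<Sum>f\<in>scale_fam R (?\<tau> j). (P.dm f)\<^sup>2))"
    using R n ge by (intro sum_mono scale_mass) auto
  also have "\<dots> = mass_const * (\<Sum>j<n. \<Sum>f\<in>scale_fam R (?\<tau> j). (P.dm f)\<^sup>2)" by (simp add: sum_distrib_left)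
  also have "(\<Sum>j<n. \<Sum>f\<in>scale_fam R (?\<tau> j). (P.dm f)\<^sup>2) = (\<Sum>f\<in>(\<Union>j<n. scale_fam R (?\<tau> j)). (P.dm f)\<^sup>2)"
    using fin disj by (intro sum.UNION_disjoint[symmetric]) (auto, metis disjoint_iff linorder_neqE_nat)
  also have "mass_const * \<dots> \<le> mass_const * (\<Sum>f\<in>faces_near (4 * R). (P.dm f)\<^sup>2)"
    using fin(2) faces_near(1) mass_const_pos by (intro mult_left_mono sum_mono2) auto
  also have "\<dots> \<le> mass_const * (pack_const * (4 * R)\<^sup>2)" using R mass_const_pos by (intro mult_left_mono faces_near_packing) auto
  also have "\<dots> = (16 * mass_const * pack_const) * R\<^sup>2" by (simp add: power2_eq_square)
  finally show ?thesis using R by (simp add: mult_le_cancel_right_pos)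
qed

theorem growth:
  obtains N where "1 \<le> N" "\<And>R. 1 \<le> R \<Longrightarrow> D (2 * R) \<le> N * D R"
proof
  \<comment> \<open>One scale more than \<open>scales_bound\<close> allows.\<close>
  define n where "n = nat \<lceil>16 * mass_const * pack_const\<rceil> + 1"
  have l1: "1 \<le> scale_ratio" unfolding scale_ratio_def using size_ratio_pos by simp
  have ln: "1 \<le> scale_ratio ^ n" using l1 by (rule one_le_power)
  thus "1 \<le> 2 * scale_ratio ^ n" by linarith
  fix R :: real assume R: "1 \<le> R"
  show "D (2 * R) \<le> 2 * scale_ratio ^ n * D R"
  proof (rule ccontr)
    assume neg: "\<not> ?thesis"
    have D0: "0 < D R" using R by (intro D_pos) simp
    have "real n \<le> 16 * mass_const * pack_const"
    proof (rule scales_bound[OF R])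
      fix j assume "j < n"
      hence "scale_ratio ^ j \<le> scale_ratio ^ n" using l1 by (intro power_increasing) auto
      hence "scale_ratio ^ j * D R \<le> scale_ratio ^ n * D R" using D0 by simp
      thus "2 * (scale_ratio ^ j * D R) \<le> D (2 * R)" using neg by simp
    qed
    thus False unfolding n_def by linarith
  qed
qed

subsection \<open>The discrete conservation law\<close>

definition ang_diff :: "'v set \<Rightarrow> 'v \<Rightarrow> real" where "ang_diff f v = fang z' f v - fang z f v"
definition c0 :: real where "c0 = (sin \<epsilon>)^4 / 12"
definition C0 :: real where "C0 = 3 / (sin \<epsilon>)\<^sup>2"
definition M0 :: real where "M0 = 4 * pi / sin \<epsilon>"

lemma const_pos: "0 < c0" "0 < C0" "0 < M0"
  unfolding c0_def C0_def M0_def using s_pos by auto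

lemma angle_var_face:
  assumes f: "f \<in> F"
  shows "angle_var c0 C0 M0 u (ang_diff f) f"
proof -
  interpret A: fat_face z f \<epsilon> by (rule P.face[OF f])
  interpret B: fat_face z' f \<epsilon> by (rule Q.face[OF f])
  obtain \<kappa> where \<kappa>: "\<kappa> > 0" "\<And>v j k. f = {v, j, k} \<Longrightarrow> v \<noteq> j \<Longrightarrow> v \<noteq> k \<Longrightarrow> j \<noteq> k \<Longrightarrow>
    cmod (z j - z k) = \<kappa> * sin (fang z f v)" using A.sine_law by blast
  obtain \<kappa>' where \<kappa>': "\<kappa>' > 0" "\<And>v j k. f = {v, j, k} \<Longrightarrow> v \<noteq> j \<Longrightarrow> v \<noteq> k \<Longrightarrow> j \<noteq> k \<Longrightarrow>
    cmod (z' j - z' k) = \<kappa>' * sin (fang z' f v)" using B.sine_law by blast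
  show ?thesis unfolding c0_def C0_def M0_def ang_diff_def
  proof (rule angle_varI[OF P.eps P.card3[OF f]])
    show "sum (fang z f) f = pi" by (rule A.angle_sum)
    show "sum (fang z' f) f = pi" by (rule B.angle_sum)
    fix v assume v: "v \<in> f"
    show "\<epsilon> \<le> fang z f v" "\<epsilon> \<le> fang z' f v" using A.fat B.fat v by auto
    obtain j k where jk: "f = {v, j, k}" "v \<noteq> j" "v \<noteq> k" "j \<noteq> k" using face_others[OF P.card3[OF f] v] by metis
    have jf: "j \<in> f" "k \<in> f" unfolding jk(1) by auto
    have sp: "0 < sin (fang z f v)" "0 < sin (fang z' f v)"
      using A.sin_fang_ge[OF v] B.sin_fang_ge[OF v] s_pos by linarith+
    have "\<kappa>' * sin (fang z' f v) = exp ((u j + u k) / 2) * (\<kappa> * sin (fang z f v))"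
      using conf[OF f jf jk(4)] \<kappa>(2)[OF jk] \<kappa>'(2)[OF jk] by simp
    hence "ln (\<kappa>' * sin (fang z' f v)) = ln (exp ((u j + u k) / 2) * (\<kappa> * sin (fang z f v)))" by simp
    hence l: "ln \<kappa>' + ln (sin (fang z' f v)) = (u j + u k) / 2 + (ln \<kappa> + ln (sin (fang z f v)))"
      using \<kappa> \<kappa>' sp by (simp add: ln_mult)
    have "sum u f = u v + u j + u k" by (subst jk(1)) (use jk(2-4) in \<open>simp add: add.assoc\<close>)
    \<comment> \<open>Logarithms of the conformal relation on the edge opposite to \<open>v\<close>
      give \<open>u j + u k\<close>, which is \<open>sum u f - u v\<close>. The bracket is the same
      for all vertices and serves as \<open>K\<close>.\<close>
    thus "u v = (sum u f - 2 * (ln \<kappa>' - ln \<kappa>)) - 2 * (ln (sin (fang z' f v)) - ln (sin (fang z f v)))"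
      using l by (simp add: field_simps)
  qed
qed

text \<open>Divergence theorem: after exchanging faces and vertices, each vertex of \<open>W\<close>
  collects its full star, where both angle sums are \<open>2 * pi\<close>. The function
  \<open>g\<close> is free, so any test function supported on finitely many vertices is
  allowed.\<close>

lemma green:
  assumes "finite W" "W \<subseteq> \<Union>F"
  shows "(\<Sum>f\<in>{f \<in> F. f \<inter> W \<noteq> {}}. \<Sum>v\<in>f \<inter> W. ang_diff f v * g v) = 0"
proof -
  let ?T = "{f \<in> F. f \<inter> W \<noteq> {}}"
  have "?T = (\<Union>v\<in>W. P.star v)" by auto
  hence finT: "finite ?T" using assms(1) P.star_finite(1) by simp
  have "(\<Sum>f\<in>?T. \<Sum>v\<in>f \<inter> W. ang_diff f v * g v) = (\<Sum>f\<in>?T. \<Sum>v\<in>{v. v \<in> W \<and> v \<in> f}. ang_diff f v * g v)"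
    by (intro sum.cong) auto
  also have "\<dots> = (\<Sum>v\<in>W. \<Sum>f\<in>{f. f \<in> ?T \<and> v \<in> f}. ang_diff f v * g v)"
    by (rule sum.swap_restrict[OF finT assms(1)])
  also have "\<dots> = (\<Sum>v\<in>W. (\<Sum>f\<in>P.star v. ang_diff f v) * g v)"
    unfolding sum_distrib_right by (intro sum.cong) auto
  also have "\<dots> = (\<Sum>v\<in>W. 0)"
  proof (rule sum.cong[OF refl])
    fix v assume "v \<in> W"
    hence "v \<in> \<Union>F" using assms by blast
    hence "(\<Sum>f\<in>P.star v. ang_diff f v) = 0"
      unfolding ang_diff_def sum_subtractf using P.star_angle_sum Q.star_angle_sum by simp
    thus "(\<Sum>f\<in>P.star v. ang_diff f v) * g v = 0" by simp
  qed
  finally show ?thesis by simp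
qed

definition verts_in :: "real \<Rightarrow> 'v set" where "verts_in r = {v \<in> \<Union>F. cmod (z v - o1) < r}"
definition faces_in :: "real \<Rightarrow> 'v set set" where "faces_in r = {f \<in> F. f \<subseteq> verts_in r}"
definition faces_on :: "real \<Rightarrow> 'v set set" where "faces_on r = {f \<in> F. P.H f \<inter> sphere o1 r \<noteq> {}}"

lemma vertex_in_H: "v \<in> f \<Longrightarrow> z v \<in> P.H f" by (simp add: hull_inc)

lemma touch_faces_near: "f \<in> F \<Longrightarrow> f \<inter> verts_in r \<noteq> {} \<Longrightarrow> f \<in> faces_near r"
proof -
  assume f: "f \<in> F" "f \<inter> verts_in r \<noteq> {}"
  then obtain v where v: "v \<in> f" "cmod (z v - o1) < r" unfolding verts_in_def by auto
  have "z v \<in> cball o1 r" using v(2) by (simp add: dist_norm norm_minus_commute)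
  thus ?thesis unfolding faces_near_def using vertex_in_H[OF v(1)] f(1) by blast
qed

lemma verts_in: "finite (verts_in r)" "verts_in r \<subseteq> \<Union>F"
proof -
  show "verts_in r \<subseteq> \<Union>F" unfolding verts_in_def by blast
  have "verts_in r \<subseteq> \<Union>(faces_near r)"
  proof
    fix v assume v: "v \<in> verts_in r"
    then obtain f where "f \<in> F" "v \<in> f" unfolding verts_in_def by blast
    thus "v \<in> \<Union>(faces_near r)" using touch_faces_near[of f r] v by blast
  qed
  moreover have "finite (\<Union>(faces_near r))" using faces_near(1,2)[of r] P.fin(1) by blast
  ultimately show "finite (verts_in r)" by (rule finite_subset)
qed

lemma faces_in: "finite (faces_in r)" "faces_in r \<subseteq> F" "r \<le> s \<Longrightarrow> faces_in r \<subseteq> faces_in s"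
proof -
  show "faces_in r \<subseteq> F" unfolding faces_in_def by blast
  have "faces_in r \<subseteq> faces_near r"
  proof
    fix f assume f: "f \<in> faces_in r"
    hence "f \<in> F" "f \<inter> verts_in r = f" unfolding faces_in_def by auto
    thus "f \<in> faces_near r" using touch_faces_near[of f r] P.fin(2)[of f] by simp
  qed
  thus "finite (faces_in r)" using faces_near(1) finite_subset by blast
  show "r \<le> s \<Longrightarrow> faces_in r \<subseteq> faces_in s" unfolding faces_in_def verts_in_def by force
qed

lemma faces_on: "finite (faces_on r)" "faces_on r \<subseteq> F"
proof -
  have "faces_on r \<subseteq> faces_near r" unfolding faces_on_def faces_near_def by auto
  thus "finite (faces_on r)" using faces_near(1) finite_subset by blast
  show "faces_on r \<subseteq> F" unfolding faces_on_def by blast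
qed

lemma straddle:
  assumes "f \<in> F" "f \<inter> verts_in r \<noteq> {}" "\<not> f \<subseteq> verts_in r"
  shows "f \<in> faces_on r"
proof -
  obtain i j where i: "i \<in> f" "cmod (z i - o1) < r" and j: "j \<in> f" "r \<le> cmod (z j - o1)"
    using assms unfolding verts_in_def by force
  have "connected ((\<lambda>x. cmod (x - o1)) ` P.H f)"
    by (intro connected_continuous_image continuous_intros convex_connected convex_convex_hull)
  moreover have "cmod (z i - o1) \<in> (\<lambda>x. cmod (x - o1)) ` P.H f" "cmod (z j - o1) \<in> (\<lambda>x. cmod (x - o1)) ` P.H f"
    using vertex_in_H i j by blast+
  ultimately have "r \<in> (\<lambda>x. cmod (x - o1)) ` P.H f"
    using connectedD_interval[of _ "cmod (z i - o1)" "cmod (z j - o1)" r] i j by (meson less_imp_le)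
  then obtain x where "x \<in> P.H f" "cmod (x - o1) = r" by blast
  hence "x \<in> P.H f \<inter> sphere o1 r" by (simp add: dist_norm norm_minus_commute)
  thus ?thesis unfolding faces_on_def using assms(1) by blast
qed

subsection \<open>Energy of exponentials of the conformal factor\<close>

definition w :: "real \<Rightarrow> 'v \<Rightarrow> real" where "w e = (\<lambda>v. exp (e / 2 * u v))"
abbreviation osc_w :: "real \<Rightarrow> 'v set \<Rightarrow> real" where "osc_w e f \<equiv> osc (w e) f"
definition energy :: "real \<Rightarrow> real \<Rightarrow> real" where "energy e r = (\<Sum>f\<in>faces_in r. (osc_w e f)\<^sup>2)"
definition small :: "real \<Rightarrow> bool" where "small e \<longleftrightarrow> 0 < e \<and> e * M0 \<le> 1 \<and> 6 * C0 * e * M0 \<le> c0"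

lemma osc_w_nonneg: "f \<in> F \<Longrightarrow> 0 \<le> osc_w e f"
  using osc_nonneg P.fin by metis

lemma osc_w_faces_on: "f \<in> faces_on r \<Longrightarrow> 0 \<le> osc_w e f"
  using osc_w_nonneg faces_on(2) by blast

lemma w_pos: "0 < w e v" unfolding w_def by simp

lemma energy_nonneg: "0 \<le> energy e r" unfolding energy_def by (intro sum_nonneg) auto

lemma
  assumes "small e" "f \<in> F"
  shows energy_face: "c0 / (2 * e) * (osc_w e f)\<^sup>2 \<le> - (\<Sum>v\<in>f. ang_diff f v * exp (e * u v))"
    and ang_diff_w: "v \<in> f \<Longrightarrow> \<bar>ang_diff f v\<bar> * Max (w e ` f) \<le> 6 * C0 / e * osc_w e f"
    and energy_face_cutoff: "(\<And>v. v \<in> f \<Longrightarrow> 0 \<le> \<zeta> v) \<Longrightarrow>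
       c0 / (4 * e) * (Min (\<zeta> ` f))\<^sup>2 * (osc_w e f)\<^sup>2
         - (3 * C0 * M0 + 1296 * C0\<^sup>2 / (c0 * e)) * (osc \<zeta> f)\<^sup>2 * (Max (w e ` f))\<^sup>2
         \<le> - (\<Sum>v\<in>f. ang_diff f v * (\<zeta> v)\<^sup>2 * exp (e * u v))"
  using exp_weighted_variation[OF const_pos angle_var_face[OF assms(2)], of e]
    variation_times_exp_le[OF const_pos angle_var_face[OF assms(2)], of e v]
    exp_weighted_variation_cutoff[OF const_pos angle_var_face[OF assms(2)], of e \<zeta>] assms(1)
  unfolding small_def w_def by blast+

lemma exp_w: "exp (e * u v) = (w e v)\<^sup>2"
  unfolding w_def by (simp flip: exp_of_nat_mult)

text \<open>Faces meeting at a point of the circle share a vertex, so their value intervals overlap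
  and chain up around the connected circle.\<close>

lemma sphere_oscillation:
  assumes r: "0 < r" and f: "f \<in> faces_on r" and g: "g \<in> faces_on r"
  shows "Max (w e ` f) - Min (w e ` g) \<le> (\<Sum>f\<in>faces_on r. osc_w e f)"
  unfolding osc_def
proof (rule connected_cover_oscillation[where X = "sphere o1 r" and A = P.H])
  show "connected (sphere o1 r)" by (intro connected_sphere) simp
  show "finite (faces_on r)" by (rule faces_on)
  show "closed (P.H i)" if "i \<in> faces_on r" for i using P.closed_H(1) that faces_on by blast
  show "sphere o1 r \<subseteq> (\<Union>i\<in>faces_on r. P.H i)"
  proof
    fix x assume x: "x \<in> sphere o1 r"
    obtain i where "i \<in> F" "x \<in> P.H i" by (rule face_at)
    thus "x \<in> (\<Union>i\<in>faces_on r. P.H i)" using x unfolding faces_on_def by blast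
  qed
  show "Min (w e ` i) \<le> Max (w e ` i)" if "i \<in> faces_on r" for i
    using osc_w_nonneg[of i e] that faces_on unfolding osc_def by force
  show "Min (w e ` i) \<le> Max (w e ` j)" if ij: "i \<in> faces_on r" "j \<in> faces_on r" "P.H i \<inter> P.H j \<inter> sphere o1 r \<noteq> {}" for i j
  proof -
    have F: "i \<in> F" "j \<in> F" using ij faces_on by auto
    then obtain v where v: "v \<in> i" "v \<in> j" using P.share_vertex ij(3) by blast
    have "Min (w e ` i) \<le> w e v" "w e v \<le> Max (w e ` j)" using v F P.fin(1) by auto
    thus ?thesis by simp
  qed
  show "P.H f \<inter> sphere o1 r \<noteq> {}" "P.H g \<inter> sphere o1 r \<noteq> {}" using f g unfolding faces_on_def by blast+
qed (use f g in blast)+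

text \<open>Subtracting the minimum \<open>m\<^sup>2\<close> over the circle from the test function keeps the constant
  independent of \<open>e\<close>.\<close>

lemma energy_le_boundary:
  assumes e: "small e" and r: "0 < r"
  shows "energy e r \<le> 72 * C0 / c0 * (\<Sum>f\<in>faces_on r. osc_w e f)\<^sup>2"
proof -
  have e0: "0 < e" using e unfolding small_def by simp
  define \<Omega> where "\<Omega> = (\<Sum>f\<in>faces_on r. osc_w e f)"
  have \<Omega>0: "0 \<le> \<Omega>" unfolding \<Omega>_def using osc_w_nonneg faces_on by (intro sum_nonneg) blast
  define ms where "ms = (\<lambda>f. Min (w e ` f)) ` faces_on r"
  have xs: "o1 + of_real r \<in> sphere o1 r" using r by (simp add: dist_norm)
  obtain f0 where f0: "f0 \<in> F" "o1 + of_real r \<in> P.H f0" by (rule face_at)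
  have "f0 \<in> faces_on r" unfolding faces_on_def using f0 xs by blast
  hence Sne: "faces_on r \<noteq> {}" by blast
  have msf: "finite ms" "ms \<noteq> {}" unfolding ms_def using faces_on(1) Sne by auto
  define m where "m = Min ms"
  have "m \<in> ms" unfolding m_def using msf by (rule Min_in)
  then obtain g0 where g0: "g0 \<in> faces_on r" "m = Min (w e ` g0)" unfolding ms_def by blast
  have m_le: "m \<le> w e v" if "f \<in> faces_on r" "v \<in> f" for f v
  proof -
    have "m \<le> Min (w e ` f)" unfolding m_def ms_def using that faces_on(1) by (intro Min_le) auto
    also have "f \<in> F" using that(1) faces_on(2) by blast
    hence "Min (w e ` f) \<le> w e v" using that P.fin(1) by (intro Min_le) auto
    finally show ?thesis .
  qed
  have m0: "0 \<le> m"
  proof -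
    have "g0 \<in> F" using g0(1) faces_on(2) by blast
    hence "Min (w e ` g0) \<in> w e ` g0" using P.fin[of g0] by (intro Min_in) auto
    thus ?thesis using g0 w_pos by (auto intro: less_imp_le)
  qed
  let ?T = "{f \<in> F. f \<inter> verts_in r \<noteq> {}}"
  define \<Psi> where "\<Psi> f = (\<Sum>v\<in>f \<inter> verts_in r. ang_diff f v * (exp (e * u v) - m\<^sup>2))" for f
  have green0: "(\<Sum>f\<in>?T. \<Psi> f) = 0" unfolding \<Psi>_def by (rule green[OF verts_in])
  have "?T \<subseteq> faces_near r" using touch_faces_near by blast
  hence finT: "finite ?T" using faces_near(1)[of r] finite_subset by blast
  have in_touch: "faces_in r \<subseteq> ?T"
  proof
    fix f assume f: "f \<in> faces_in r"
    hence fF: "f \<in> F" "f \<inter> verts_in r = f" unfolding faces_in_def by auto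
    thus "f \<in> ?T" using P.fin(2)[OF fF(1)] by simp
  qed
  \<comment> \<open>On a face with all its vertices inside, the subtracted constant is annihilated
    by the zero total flux.\<close>
  have full: "\<Psi> f \<le> - (c0 / (2 * e) * (osc_w e f)\<^sup>2)" if f: "f \<in> faces_in r" for f
  proof -
    have fF: "f \<in> F" and "f \<inter> verts_in r = f" using f unfolding faces_in_def by auto
    hence "\<Psi> f = (\<Sum>v\<in>f. ang_diff f v * exp (e * u v)) - (\<Sum>v\<in>f. ang_diff f v) * m\<^sup>2"
      unfolding \<Psi>_def by (simp add: right_diff_distrib sum_subtractf sum_distrib_right)
    also have "(\<Sum>v\<in>f. ang_diff f v) = 0" using angle_var_face[OF fF] unfolding angle_var_def by simp
    finally show ?thesis using energy_face[OF e fF] by simp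
  qed
  have part: "\<Psi> f \<le> 36 * C0 / e * \<Omega> * osc_w e f" if f: "f \<in> ?T - faces_in r" for f
  proof -
    have fF: "f \<in> F" using f by auto
    have fS: "f \<in> faces_on r" using f straddle unfolding faces_in_def by auto
    define X where "X = Max (w e ` f)"
    have wX: "w e v \<le> X" if "v \<in> f" for v unfolding X_def using that P.fin(1)[OF fF] by auto
    have Xm: "X - m \<le> \<Omega>" unfolding X_def g0(2) \<Omega>_def by (rule sphere_oscillation[OF r fS g0(1)])
    \<comment> \<open>Factor \<open>w\<^sup>2 - m\<^sup>2\<close>: the difference is bounded by the
      circle sum \<open>\<Omega>\<close>, and the sum by \<open>2 * X\<close>, which is paired with
      the flux through \<open>ang_diff_w\<close>. The resulting \<open>1 / e\<close> is the one that
      also stands in \<open>full\<close>.\<close>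
    have "ang_diff f v * (exp (e * u v) - m\<^sup>2) \<le> 12 * C0 / e * \<Omega> * osc_w e f" if v: "v \<in> f" for v
    proof -
      have mw: "m \<le> w e v" "w e v \<le> X" using m_le[OF fS v] wX[OF v] by auto
      have 1: "0 \<le> exp (e * u v) - m\<^sup>2" "exp (e * u v) - m\<^sup>2 \<le> 2 * X * \<Omega>"
      proof -
        have eq: "exp (e * u v) - m\<^sup>2 = (w e v + m) * (w e v - m)" unfolding exp_w by (simp add: power2_eq_square algebra_simps)
        show "0 \<le> exp (e * u v) - m\<^sup>2" unfolding eq using mw m0 by simp
        show "exp (e * u v) - m\<^sup>2 \<le> 2 * X * \<Omega>" unfolding eq using mw m0 Xm by (intro mult_mono) auto
      qed
      have "ang_diff f v * (exp (e * u v) - m\<^sup>2) \<le> \<bar>ang_diff f v\<bar> * (2 * X * \<Omega>)" using 1 by (intro mult_mono) auto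
      also have "\<dots> = (\<bar>ang_diff f v\<bar> * X) * (2 * \<Omega>)" by (simp add: mult_ac)
      also have "\<dots> \<le> (6 * C0 / e * osc_w e f) * (2 * \<Omega>)"
        using ang_diff_w[OF e fF v] \<Omega>0 unfolding X_def by (intro mult_right_mono) auto
      finally show ?thesis by (simp add: mult_ac)
    qed
    hence "\<Psi> f \<le> (\<Sum>v\<in>f \<inter> verts_in r. 12 * C0 / e * \<Omega> * osc_w e f)" unfolding \<Psi>_def by (intro sum_mono) auto
    also have "\<dots> = card (f \<inter> verts_in r) * (12 * C0 / e * \<Omega> * osc_w e f)" by simp
    also have "\<dots> \<le> 3 * (12 * C0 / e * \<Omega> * osc_w e f)"
    proof (rule mult_right_mono)
      have "card (f \<inter> verts_in r) \<le> card f" using P.fin(1)[OF fF] by (intro card_mono) auto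
      thus "real (card (f \<inter> verts_in r)) \<le> 3" using P.card3[OF fF] by simp
      show "0 \<le> 12 * C0 / e * \<Omega> * osc_w e f" using const_pos e0 \<Omega>0 osc_w_nonneg[OF fF] by simp
    qed
    finally show ?thesis by (simp add: mult_ac)
  qed
  have "0 = (\<Sum>f\<in>faces_in r. \<Psi> f) + (\<Sum>f\<in>?T - faces_in r. \<Psi> f)"
    using green0 sum.subset_diff[OF in_touch finT, of \<Psi>] by simp
  also have "\<dots> \<le> (\<Sum>f\<in>faces_in r. - (c0 / (2 * e) * (osc_w e f)\<^sup>2)) + (\<Sum>f\<in>?T - faces_in r. 36 * C0 / e * \<Omega> * osc_w e f)"
    using full part by (intro add_mono sum_mono) auto
  also have "(\<Sum>f\<in>faces_in r. - (c0 / (2 * e) * (osc_w e f)\<^sup>2)) = - (c0 / (2 * e) * energy e r)"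
    unfolding energy_def by (simp add: sum_negf sum_distrib_left)
  also have "(\<Sum>f\<in>?T - faces_in r. 36 * C0 / e * \<Omega> * osc_w e f) \<le> 36 * C0 / e * \<Omega> * \<Omega>"
  proof -
    have "?T - faces_in r \<subseteq> faces_on r"
    proof
      fix f assume "f \<in> ?T - faces_in r"
      hence "f \<in> F" "f \<inter> verts_in r \<noteq> {}" "\<not> f \<subseteq> verts_in r" unfolding faces_in_def by auto
      thus "f \<in> faces_on r" by (rule straddle)
    qed
    hence "(\<Sum>f\<in>?T - faces_in r. osc_w e f) \<le> \<Omega>"
      unfolding \<Omega>_def by (rule sum_mono2[OF faces_on(1)]) (use osc_w_faces_on in blast)
    hence "36 * C0 / e * \<Omega> * (\<Sum>f\<in>?T - faces_in r. osc_w e f) \<le> 36 * C0 / e * \<Omega> * \<Omega>"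
      using const_pos e0 \<Omega>0 by (intro mult_left_mono) auto
    thus ?thesis by (simp add: sum_distrib_left)
  qed
  finally have "c0 / (2 * e) * energy e r \<le> 36 * C0 / e * \<Omega> * \<Omega>" by simp
  hence "c0 / (2 * e) * energy e r * (2 * e / c0) \<le> 36 * C0 / e * \<Omega> * \<Omega> * (2 * e / c0)"
    using const_pos e0 by (intro mult_right_mono) auto
  thus ?thesis unfolding \<Omega>_def[symmetric] using const_pos e0 by (simp add: field_simps power2_eq_square)
qed

definition fill_const :: real where "fill_const = 288 * C0 / c0 * pack_const"

lemma fill_const_pos: "0 < fill_const" unfolding fill_const_def using const_pos pack_const_pos by simp

text \<open>Widman's hole filling. The boundary estimate holds on every circle of radius between
  \<open>R\<close> and \<open>2 * R\<close>; integrating over the radius and applying Cauchy-Schwarz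
  bounds the inner energy by \<open>fill_const\<close> times the energy of the annulus, and the
  inner energy is then added to both sides. No constant involves \<open>e\<close>.\<close>

lemma hole_filling:
  assumes e: "small e" and R: "1 \<le> R"
  shows "(1 + 1 / fill_const) * energy e R \<le> energy e (3 * reach * R)"
proof -
  define I where "I = {f \<in> faces_near (2 * R). \<not> f \<subseteq> verts_in R}"
  have I: "finite I" "I \<subseteq> F" "I \<subseteq> faces_near (2 * R)" unfolding I_def using faces_near(1,2)[of "2 * R"] by auto
  \<comment> \<open>The lower bound that \<open>energy_le_boundary\<close> imposes on the
    oscillation sum of each circle outside radius \<open>R\<close>.\<close>
  define q where "q = sqrt (energy e R / (72 * C0 / c0))"
  have kp: "0 < 72 * C0 / c0" using const_pos by simp
  have nn: "0 \<le> energy e R / (72 * C0 / c0)" using energy_nonneg[of e R] kp by (rule divide_nonneg_pos)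
  have q0: "0 \<le> q" "q\<^sup>2 = energy e R / (72 * C0 / c0)"
    unfolding q_def using real_sqrt_ge_zero[OF nn] real_sqrt_pow2[OF nn] by blast+
  have "q * (2 * R - R) \<le> (\<Sum>f\<in>I. osc_w e f * (P.rhi o1 f - P.rlo o1 f))"
  proof (rule weighted_interval_cover[OF I(1)])
    show "0 \<le> osc_w e f" if "f \<in> I" for f using osc_w_nonneg that I by blast
    show "P.rlo o1 f \<le> P.rhi o1 f" if "f \<in> I" for f using P.radial_range(3) that I by blast
    fix r assume r: "R < r" "r < 2 * R"
    have Sp_sub: "faces_on r \<subseteq> {f \<in> I. P.rlo o1 f \<le> r \<and> r \<le> P.rhi o1 f}"
    proof
      fix f assume f: "f \<in> faces_on r"
      then obtain x where fF: "f \<in> F" and x: "x \<in> P.H f" "x \<in> sphere o1 r" unfolding faces_on_def by blast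
      have xr: "cmod (x - o1) = r" using x(2) by (simp add: dist_norm norm_minus_commute)
      have "x \<in> cball o1 (2 * R)" using x(2) r by auto
      hence M: "f \<in> faces_near (2 * R)" unfolding faces_near_def using fF x(1) by blast
      have "\<not> f \<subseteq> verts_in R"
      proof
        assume "f \<subseteq> verts_in R"
        hence "P.H f \<subseteq> ball o1 R" unfolding verts_in_def
          by (intro hull_minimal) (auto simp: dist_norm norm_minus_commute)
        thus False using x r by auto
      qed
      thus "f \<in> {f \<in> I. P.rlo o1 f \<le> r \<and> r \<le> P.rhi o1 f}"
        unfolding I_def using M P.radial_range(1,2)[OF fF x(1), of o1] xr by simp
    qed
    have "energy e R \<le> energy e r" unfolding energy_def using faces_in(1)[of r] faces_in(3)[of R r] r by (intro sum_mono2) auto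
    also have "\<dots> \<le> 72 * C0 / c0 * (\<Sum>f\<in>faces_on r. osc_w e f)\<^sup>2" using r R by (intro energy_le_boundary[OF e]) simp
    finally have "q\<^sup>2 \<le> (\<Sum>f\<in>faces_on r. osc_w e f)\<^sup>2" unfolding q0 pos_divide_le_eq[OF kp] by (simp only: mult.commute)
    hence "q \<le> (\<Sum>f\<in>faces_on r. osc_w e f)"
      by (rule power2_le_imp_le) (intro sum_nonneg osc_w_faces_on)
    also have "\<dots> \<le> (\<Sum>f\<in>{f \<in> I. P.rlo o1 f \<le> r \<and> r \<le> P.rhi o1 f}. osc_w e f)"
      by (rule sum_mono2[OF _ Sp_sub]) (use I osc_w_nonneg in auto)
    finally show "q \<le> (\<Sum>f\<in>{f \<in> I. P.rlo o1 f \<le> r \<and> r \<le> P.rhi o1 f}. osc_w e f)" .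
  qed (use R in auto)
  also have "\<dots> \<le> (\<Sum>f\<in>I. osc_w e f * P.dm f)"
    using I osc_w_nonneg P.radial_range(4) by (intro sum_mono mult_left_mono) auto
  finally have "q * R \<le> (\<Sum>f\<in>I. osc_w e f * P.dm f)" by simp
  hence "(q * R)\<^sup>2 \<le> (\<Sum>f\<in>I. osc_w e f * P.dm f)\<^sup>2" using q0 R by (intro power_mono) auto
  also have "\<dots> \<le> (\<Sum>f\<in>I. (osc_w e f)\<^sup>2) * (\<Sum>f\<in>I. (P.dm f)\<^sup>2)" by (rule Cauchy_Schwarz_ineq_sum)
  also have "\<dots> \<le> (\<Sum>f\<in>I. (osc_w e f)\<^sup>2) * (pack_const * (2 * R)\<^sup>2)"
  proof (rule mult_left_mono)
    have "(\<Sum>f\<in>I. (P.dm f)\<^sup>2) \<le> (\<Sum>f\<in>faces_near (2 * R). (P.dm f)\<^sup>2)" using I faces_near(1) by (intro sum_mono2) auto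
    also have "\<dots> \<le> pack_const * (2 * R)\<^sup>2" using R by (intro faces_near_packing) simp
    finally show "(\<Sum>f\<in>I. (P.dm f)\<^sup>2) \<le> pack_const * (2 * R)\<^sup>2" .
  qed (auto intro: sum_nonneg)
  finally have "q\<^sup>2 * R\<^sup>2 \<le> (4 * pack_const * (\<Sum>f\<in>I. (osc_w e f)\<^sup>2)) * R\<^sup>2" by (simp add: power_mult_distrib mult_ac)
  hence "q\<^sup>2 \<le> 4 * pack_const * (\<Sum>f\<in>I. (osc_w e f)\<^sup>2)" using R by (simp add: mult_le_cancel_right_pos)
  hence "energy e R \<le> fill_const * (\<Sum>f\<in>I. (osc_w e f)\<^sup>2)"
    unfolding q0 fill_const_def pos_divide_le_eq[OF kp] by (simp add: field_simps)
  hence 1: "1 / fill_const * energy e R \<le> (\<Sum>f\<in>I. (osc_w e f)\<^sup>2)" using fill_const_pos by (simp add: field_simps)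
  \<comment> \<open>Faces of the annulus lie within radius \<open>2 * reach * R\<close>; the factor
    3 makes the inequality strict, as \<open>verts_in\<close> demands.\<close>
  have Isub: "I \<subseteq> faces_in (3 * reach * R) - faces_in R"
  proof
    fix f assume f: "f \<in> I"
    have sub: "P.H f \<subseteq> cball o1 (reach * (2 * R))" using f I R by (intro faces_near_subset) auto
    have lt: "reach * (2 * R) < 3 * reach * R" using reach_ge R by simp
    have "cmod (z v - o1) < 3 * reach * R" if "v \<in> f" for v
    proof -
      have "z v \<in> cball o1 (reach * (2 * R))" using vertex_in_H[OF that] sub by blast
      hence "cmod (z v - o1) \<le> reach * (2 * R)" by (simp add: dist_norm norm_minus_commute)
      thus ?thesis using lt by linarith
    qed
    hence "f \<in> faces_in (3 * reach * R)" unfolding faces_in_def verts_in_def using f I by auto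
    moreover have "f \<notin> faces_in R" using f unfolding I_def faces_in_def by auto
    ultimately show "f \<in> faces_in (3 * reach * R) - faces_in R" by blast
  qed
  have in_sub: "faces_in R \<subseteq> faces_in (3 * reach * R)"
  proof (rule faces_in(3))
    have "1 * R \<le> (3 * reach) * R" using reach_ge R by (intro mult_right_mono) auto
    thus "R \<le> 3 * reach * R" by simp
  qed
  have "(\<Sum>f\<in>I. (osc_w e f)\<^sup>2) \<le> (\<Sum>f\<in>faces_in (3 * reach * R) - faces_in R. (osc_w e f)\<^sup>2)"
    using Isub faces_in(1) by (intro sum_mono2) auto
  also have "\<dots> = energy e (3 * reach * R) - energy e R"
    unfolding energy_def using sum.subset_diff[OF in_sub faces_in(1), of "\<lambda>f. (osc_w e f)\<^sup>2"] by simp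
  finally show ?thesis using 1 by (simp add: algebra_simps)
qed

end

section \<open>Upper energy bound and vanishing of the energy\<close>

text \<open>After shifting \<open>x\<close> by \<open>ln K\<close>, an exponential of exponent
  between 0 and 2 is at most the sum of the two extreme ones. With \<open>K\<close> the radius of
  the image, the area bound makes the second summand harmless on average and leaves only
  \<open>K powr e\<close>.\<close>

lemma exp_interpolate:
  fixes K e x :: real
  assumes "0 < K" "0 < e" "e \<le> 2"
  shows "exp (e * x) \<le> K powr e * (1 + exp (2 * x) / K\<^sup>2)"
proof -
  let ?y = "x - ln K"
  have "exp (e * ?y) \<le> 1 + exp (2 * ?y)"
  proof (cases "?y \<le> 0")
    case True
    hence "exp (e * ?y) \<le> 1" using assms by (simp add: mult_nonneg_nonpos)
    thus ?thesis by (smt (verit) exp_gt_zero)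
  next
    case False
    hence "e * ?y \<le> 2 * ?y" using assms by (intro mult_right_mono) auto
    hence "exp (e * ?y) \<le> exp (2 * ?y)" by (simp only: exp_le_cancel_iff)
    thus ?thesis by linarith
  qed
  moreover have "exp (e * x) = K powr e * exp (e * ?y)"
  proof -
    have "e * x = e * ln K + e * ?y" by (simp add: algebra_simps)
    hence "exp (e * x) = exp (e * ln K) * exp (e * ?y)" by (simp only: exp_add)
    thus ?thesis unfolding powr_def using assms(1) by simp
  qed
  moreover have "exp (2 * ?y) = exp (2 * x) / K\<^sup>2"
  proof -
    have "exp (2 * ln K) = K\<^sup>2" by (simp only: power2_eq_square mult_2 exp_add exp_ln[OF assms(1)])
    moreover have "2 * ?y = 2 * x - 2 * ln K" by simp
    ultimately show ?thesis by (simp only: exp_diff)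
  qed
  ultimately show ?thesis by (simp only: mult_left_mono powr_ge_zero)
qed

context plane_pair
begin

lemma osc_u: "f \<in> F \<Longrightarrow> osc u f \<le> M0"
  using angle_var_face unfolding angle_var_def by blast

lemma Max_w: "small e \<Longrightarrow> f \<in> F \<Longrightarrow> (Max (w e ` f))\<^sup>2 = exp (e * Max (u ` f))"
proof -
  assume e: "small e" and f: "f \<in> F"
  have "Max (w e ` f) = exp (e / 2 * Max (u ` f))"
    unfolding w_def using e P.fin[OF f] unfolding small_def by (intro Max_Min_exp(1)) auto
  thus ?thesis by (simp flip: exp_of_nat_mult)
qed

text \<open>\<open>exp u\<close> is the local scale factor between the two metrics: the left side is
  comparable to the area of the image face. \<open>M0\<close> pays for moving from the maximal
  vertex to the other end of an edge, \<open>sin \<epsilon>\<close> for comparing edge and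
  diameter.\<close>

lemma dm_exp_le:
  assumes f: "f \<in> F"
  shows "exp (2 * Max (u ` f)) * (P.dm f)\<^sup>2 \<le> exp (2 * M0) / (sin \<epsilon>)\<^sup>2 * (Q.dm f)\<^sup>2"
proof -
  have fin: "finite f" "f \<noteq> {}" using P.fin[OF f] by auto
  have "Max (u ` f) \<in> u ` f" using fin by (intro Max_in) auto
  then obtain i where i: "i \<in> f" "u i = Max (u ` f)" by auto
  obtain j k where jk: "f = {i, j, k}" "i \<noteq> j" using face_others[OF P.card3[OF f] i(1)] by metis
  have j: "j \<in> f" unfolding jk(1) by simp
  have uj: "Max (u ` f) - M0 \<le> u j"
    using abs_diff_le_osc[OF fin(1) i(1) j, of u] osc_u[OF f] i(2) by linarith
  have "exp (Max (u ` f) - M0) * (sin \<epsilon> * P.dm f) \<le> exp ((u i + u j) / 2) * cmod (z i - z j)"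
    using uj i(2) const_pos(3) P.dm_edge[OF f i(1) j jk(2)] s_pos P.dm_pos[OF f] by (intro mult_mono) auto
  also have "\<dots> = cmod (z' i - z' j)" using conf[OF f i(1) j jk(2)] by simp
  also have "\<dots> \<le> Q.dm f" by (rule fdiam_ge[OF fin(1) i(1) j])
  finally have "(exp (Max (u ` f) - M0) * (sin \<epsilon> * P.dm f))\<^sup>2 \<le> (Q.dm f)\<^sup>2"
    using s_pos P.dm_pos[OF f] by (intro power_mono) auto
  moreover have "(exp (Max (u ` f) - M0))\<^sup>2 = exp (2 * Max (u ` f)) / exp (2 * M0)"
    by (simp add: exp_diff power_divide flip: exp_of_nat_mult)
  ultimately have "exp (2 * Max (u ` f)) / exp (2 * M0) * ((sin \<epsilon>)\<^sup>2 * (P.dm f)\<^sup>2) \<le> (Q.dm f)\<^sup>2"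
    by (simp only: power_mult_distrib)
  thus ?thesis using s_pos by (simp add: field_simps)
qed

text \<open>Sum the Caccioppoli inequality over faces with a cutoff of slope \<open>1 / R\<close>;
  \<open>green\<close> removes the right side. What remains is the average of
  \<open>exp (e * u)\<close> over a disc, and packing in the source and in the image bounds it after
  interpolation.\<close>

lemma energy_upper:
  assumes e: "small e" "e \<le> 2"
  obtains K where "0 \<le> K" "\<And>R. 1 \<le> R \<Longrightarrow> energy e R \<le> K * D (2 * reach * R) powr e"
proof -
  have e0: "0 < e" using e unfolding small_def by simp
  define K3 where "K3 = 3 * C0 * M0 + 1296 * C0\<^sup>2 / (c0 * e)"
  have K30: "0 \<le> K3" unfolding K3_def using const_pos e0 by simp
  define q where "q = exp (2 * M0) / (sin \<epsilon>)\<^sup>2"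
  have q0: "0 < q" unfolding q_def using s_pos by simp
  define K where "K = K3 * (4 * e / c0) * (4 * pack_const + q * (9 / (sin \<epsilon>)^6))"
  show ?thesis
  proof (rule that[of K])
    show "0 \<le> K" unfolding K_def using K30 q0 pack_const_pos const_pos e0 s_pos by simp
    fix R :: real assume R: "1 \<le> R"
    \<comment> \<open>Equal to 1 on the disc of radius \<open>R\<close>, 0 outside radius
      \<open>2 * R\<close>, linear in the distance between; its finite support makes
      \<open>green\<close> applicable.\<close>
    define \<zeta> where "\<zeta> v = max 0 (min 1 (2 - cmod (z v - o1) / R))" for v
    let ?W = "verts_in (2 * R)"
    let ?T = "{f \<in> F. f \<inter> ?W \<noteq> {}}"
    have TM: "?T \<subseteq> faces_near (2 * R)" using touch_faces_near by blast
    hence finT: "finite ?T" using faces_near(1) finite_subset by blast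
    have z_out: "\<zeta> v = 0" if "f \<in> F" "v \<in> f" "v \<notin> ?W" for f v
    proof -
      have "2 * R \<le> cmod (z v - o1)" using that unfolding verts_in_def by force
      hence "2 \<le> cmod (z v - o1) / R" using R by (simp add: field_simps)
      thus ?thesis unfolding \<zeta>_def by simp
    qed
    have "(\<Sum>f\<in>?T. \<Sum>v\<in>f. ang_diff f v * (\<zeta> v)\<^sup>2 * exp (e * u v)) = (\<Sum>f\<in>?T. \<Sum>v\<in>f \<inter> ?W. ang_diff f v * ((\<zeta> v)\<^sup>2 * exp (e * u v)))"
    proof (rule sum.cong[OF refl])
      fix f assume f: "f \<in> ?T"
      show "(\<Sum>v\<in>f. ang_diff f v * (\<zeta> v)\<^sup>2 * exp (e * u v)) = (\<Sum>v\<in>f \<inter> ?W. ang_diff f v * ((\<zeta> v)\<^sup>2 * exp (e * u v)))"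
        using f P.fin(1)[of f] z_out[of f] by (intro sum.mono_neutral_cong_right) (auto simp: mult.assoc)
    qed
    also have "\<dots> = 0" by (rule green[OF verts_in])
    finally have g0: "(\<Sum>f\<in>?T. - (\<Sum>v\<in>f. ang_diff f v * (\<zeta> v)\<^sup>2 * exp (e * u v))) = 0" by (simp add: sum_negf)
    have "(\<Sum>f\<in>?T. c0 / (4 * e) * (Min (\<zeta> ` f))\<^sup>2 * (osc_w e f)\<^sup>2 - K3 * (osc \<zeta> f)\<^sup>2 * (Max (w e ` f))\<^sup>2)
        \<le> (\<Sum>f\<in>?T. - (\<Sum>v\<in>f. ang_diff f v * (\<zeta> v)\<^sup>2 * exp (e * u v)))"
    proof (rule sum_mono)
      fix f assume "f \<in> ?T"
      hence f: "f \<in> F" by blast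
      show "c0 / (4 * e) * (Min (\<zeta> ` f))\<^sup>2 * (osc_w e f)\<^sup>2 - K3 * (osc \<zeta> f)\<^sup>2 * (Max (w e ` f))\<^sup>2
        \<le> - (\<Sum>v\<in>f. ang_diff f v * (\<zeta> v)\<^sup>2 * exp (e * u v))"
        unfolding K3_def by (rule energy_face_cutoff[OF e(1) f]) (simp add: \<zeta>_def)
    qed
    hence cac: "(\<Sum>f\<in>?T. c0 / (4 * e) * (Min (\<zeta> ` f))\<^sup>2 * (osc_w e f)\<^sup>2) \<le> (\<Sum>f\<in>?T. K3 * (osc \<zeta> f)\<^sup>2 * (Max (w e ` f))\<^sup>2)"
      unfolding g0 sum_subtractf by simp
    have in_touch: "faces_in R \<subseteq> ?T"
    proof
      fix f assume "f \<in> faces_in R"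
      hence f: "f \<in> F" "f \<subseteq> verts_in R" unfolding faces_in_def by auto
      have "verts_in R \<subseteq> ?W" unfolding verts_in_def using R by force
      hence "f \<inter> ?W = f" using f by blast
      thus "f \<in> ?T" using f(1) P.fin(2)[OF f(1)] by simp
    qed
    have "c0 / (4 * e) * energy e R = (\<Sum>f\<in>faces_in R. c0 / (4 * e) * (Min (\<zeta> ` f))\<^sup>2 * (osc_w e f)\<^sup>2)"
      unfolding energy_def sum_distrib_left
    proof (rule sum.cong[OF refl])
      fix f assume "f \<in> faces_in R"
      hence f: "f \<in> F" "f \<subseteq> verts_in R" unfolding faces_in_def by auto
      have "\<zeta> v = 1" if "v \<in> f" for v
      proof -
        have "cmod (z v - o1) < R" using that f unfolding verts_in_def by blast
        hence "cmod (z v - o1) / R \<le> 1" using R by (simp add: field_simps)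
        thus ?thesis unfolding \<zeta>_def by simp
      qed
      hence "\<zeta> ` f = {1}" using P.fin(2)[OF f(1)] by (auto simp: image_iff)
      thus "c0 / (4 * e) * (osc_w e f)\<^sup>2 = c0 / (4 * e) * (Min (\<zeta> ` f))\<^sup>2 * (osc_w e f)\<^sup>2" by simp
    qed
    also have "\<dots> \<le> (\<Sum>f\<in>?T. c0 / (4 * e) * (Min (\<zeta> ` f))\<^sup>2 * (osc_w e f)\<^sup>2)"
      by (rule sum_mono2[OF finT in_touch]) (use const_pos e0 in simp)
    also have "\<dots> \<le> (\<Sum>f\<in>?T. K3 * (osc \<zeta> f)\<^sup>2 * (Max (w e ` f))\<^sup>2)" by (rule cac)
    also have "\<dots> \<le> (\<Sum>f\<in>?T. K3 * (P.dm f / R)\<^sup>2 * exp (e * Max (u ` f)))"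
    proof (rule sum_mono)
      fix f assume "f \<in> ?T"
      hence f: "f \<in> F" by blast
      have "osc \<zeta> f \<le> P.dm f / R"
      proof (rule osc_le[OF P.fin[OF f]])
        fix i j assume ij: "i \<in> f" "j \<in> f"
        have "\<bar>\<zeta> i - \<zeta> j\<bar> \<le> \<bar>cmod (z i - o1) / R - cmod (z j - o1) / R\<bar>" unfolding \<zeta>_def by linarith
        also have "\<dots> = \<bar>cmod (z i - o1) - cmod (z j - o1)\<bar> / R" using R by (simp add: diff_divide_distrib[symmetric])
        also have "\<dots> \<le> cmod (z i - z j) / R" using cmod_diff_lipschitz R by (intro divide_right_mono) auto
        also have "\<dots> \<le> P.dm f / R" using fdiam_ge[OF P.fin(1)[OF f] ij] R by (intro divide_right_mono) auto
        finally show "\<bar>\<zeta> i - \<zeta> j\<bar> \<le> P.dm f / R" .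
      qed
      hence "(osc \<zeta> f)\<^sup>2 \<le> (P.dm f / R)\<^sup>2" using osc_nonneg[OF P.fin[OF f]] by (intro power_mono) auto
      thus "K3 * (osc \<zeta> f)\<^sup>2 * (Max (w e ` f))\<^sup>2 \<le> K3 * (P.dm f / R)\<^sup>2 * exp (e * Max (u ` f))"
        unfolding Max_w[OF e(1) f] using K30 by (intro mult_right_mono mult_left_mono) auto
    qed
    also have "\<dots> \<le> (\<Sum>f\<in>faces_near (2 * R). K3 * (P.dm f / R)\<^sup>2 * exp (e * Max (u ` f)))"
      by (rule sum_mono2[OF faces_near(1) TM]) (use K30 in simp)
    also have "\<dots> = K3 / R\<^sup>2 * (\<Sum>f\<in>faces_near (2 * R). (P.dm f)\<^sup>2 * exp (e * Max (u ` f)))"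
      by (simp add: sum_distrib_left power_divide mult_ac)
    finally have 1: "c0 / (4 * e) * energy e R \<le> K3 / R\<^sup>2 * (\<Sum>f\<in>faces_near (2 * R). (P.dm f)\<^sup>2 * exp (e * Max (u ` f)))" .
    define Dk where "Dk = D (2 * reach * R)"
    have Dk0: "0 < Dk" unfolding Dk_def using reach_ge R by (intro D_pos) auto
    have qs: "(\<Sum>f\<in>faces_near (2 * R). (Q.dm f)\<^sup>2) \<le> 9 / (sin \<epsilon>)^6 * Dk\<^sup>2"
    proof -
      have "(sin \<epsilon>)^6 / 9 * (\<Sum>f\<in>faces_near (2 * R). (Q.dm f)\<^sup>2) \<le> Dk\<^sup>2"
      proof (rule Q.packing[OF faces_near(1,2)])
        fix f assume f: "f \<in> faces_near (2 * R)"
        hence fF: "f \<in> F" using faces_near(2) by blast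
        have sub: "P.H f \<subseteq> cball o1 (reach * (2 * R))" using f R by (intro faces_near_subset) auto
        have "cmod (h x - o2) \<le> Dk" if "x \<in> P.H f" for x
        proof -
          have "x \<in> cball o1 (2 * reach * R)" using sub that by (auto simp: mult_ac)
          thus ?thesis unfolding Dk_def by (rule D_ge)
        qed
        hence "h ` P.H f \<subseteq> cball o2 Dk" by (auto simp: dist_norm norm_minus_commute)
        thus "Q.H f \<subseteq> cball o2 Dk" unfolding maps[OF fF] .
      qed (use Dk0 in simp)
      thus ?thesis using s_pos by (simp add: field_simps)
    qed
    have "(\<Sum>f\<in>faces_near (2 * R). (P.dm f)\<^sup>2 * exp (e * Max (u ` f)))
        \<le> (\<Sum>f\<in>faces_near (2 * R). Dk powr e * ((P.dm f)\<^sup>2 + q / Dk\<^sup>2 * (Q.dm f)\<^sup>2))"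
    proof (rule sum_mono)
      fix f assume "f \<in> faces_near (2 * R)"
      hence f: "f \<in> F" using faces_near(2) by blast
      \<comment> \<open>Interpolating at scale \<open>Dk\<close> matches the area bound
        \<open>Dk\<^sup>2\<close> for the image faces, so the second summand costs only a constant
        after summation.\<close>
      have "(P.dm f)\<^sup>2 * exp (e * Max (u ` f)) \<le> (P.dm f)\<^sup>2 * (Dk powr e * (1 + exp (2 * Max (u ` f)) / Dk\<^sup>2))"
        using Dk0 e0 e(2) by (intro mult_left_mono exp_interpolate) auto
      also have "\<dots> = Dk powr e * ((P.dm f)\<^sup>2 + (exp (2 * Max (u ` f)) * (P.dm f)\<^sup>2) / Dk\<^sup>2)"
        by (simp add: algebra_simps)
      also have "\<dots> \<le> Dk powr e * ((P.dm f)\<^sup>2 + (q * (Q.dm f)\<^sup>2) / Dk\<^sup>2)"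
        using dm_exp_le[OF f] unfolding q_def by (intro mult_left_mono add_left_mono divide_right_mono) auto
      finally show "(P.dm f)\<^sup>2 * exp (e * Max (u ` f)) \<le> Dk powr e * ((P.dm f)\<^sup>2 + q / Dk\<^sup>2 * (Q.dm f)\<^sup>2)" by simp
    qed
    also have "\<dots> = Dk powr e * ((\<Sum>f\<in>faces_near (2 * R). (P.dm f)\<^sup>2) + q / Dk\<^sup>2 * (\<Sum>f\<in>faces_near (2 * R). (Q.dm f)\<^sup>2))"
      by (simp only: sum_distrib_left[symmetric] sum.distrib)
    also have "\<dots> \<le> Dk powr e * (pack_const * (2 * R)\<^sup>2 + q / Dk\<^sup>2 * (9 / (sin \<epsilon>)^6 * Dk\<^sup>2))"
      using qs faces_near_packing[of "2 * R"] R q0 by (intro mult_left_mono add_mono) auto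
    also have "\<dots> = Dk powr e * (4 * pack_const * R\<^sup>2 + q * (9 / (sin \<epsilon>)^6) * 1)" using Dk0 by (simp add: power_mult_distrib)
    also have "\<dots> \<le> Dk powr e * (4 * pack_const * R\<^sup>2 + q * (9 / (sin \<epsilon>)^6) * R\<^sup>2)"
      using q0 s_pos one_le_power[OF R, of 2] by (intro mult_left_mono add_left_mono) auto
    also have "\<dots> = (4 * pack_const + q * (9 / (sin \<epsilon>)^6)) * Dk powr e * R\<^sup>2" by (simp add: algebra_simps)
    finally have "K3 / R\<^sup>2 * (\<Sum>f\<in>faces_near (2 * R). (P.dm f)\<^sup>2 * exp (e * Max (u ` f)))
        \<le> K3 / R\<^sup>2 * ((4 * pack_const + q * (9 / (sin \<epsilon>)^6)) * Dk powr e * R\<^sup>2)"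
      using K30 by (intro mult_left_mono) auto
    also have "\<dots> = K3 * (4 * pack_const + q * (9 / (sin \<epsilon>)^6)) * Dk powr e" using R by simp
    finally have "c0 / (4 * e) * energy e R \<le> K3 * (4 * pack_const + q * (9 / (sin \<epsilon>)^6)) * Dk powr e" using 1 by simp
    hence "c0 / (4 * e) * energy e R * (4 * e / c0) \<le> K3 * (4 * pack_const + q * (9 / (sin \<epsilon>)^6)) * Dk powr e * (4 * e / c0)"
      using const_pos e0 by (intro mult_right_mono) auto
    moreover have "c0 / (4 * e) * energy e R * (4 * e / c0) = energy e R" using const_pos e0 by simp
    ultimately show "energy e R \<le> K * D (2 * reach * R) powr e" unfolding K_def Dk_def by (simp only: mult_ac)
  qed
qed

lemma D_pow:
  assumes N: "1 \<le> N" "\<And>R. 1 \<le> R \<Longrightarrow> D (2 * R) \<le> N * D R"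
  shows "D (2 ^ n) \<le> N ^ n * D 1"
proof (induction n)
  case (Suc n)
  have "D (2 ^ Suc n) \<le> N * D (2 ^ n)" using N(2)[of "2 ^ n"] by simp
  also have "\<dots> \<le> N * (N ^ n * D 1)" using Suc N(1) by (intro mult_left_mono) auto
  finally show ?case by (simp add: mult_ac)
qed simp

lemma energy_lower:
  assumes e: "small e" and R: "1 \<le> R"
  shows "(1 + 1 / fill_const) ^ k * energy e R \<le> energy e ((3 * reach) ^ k * R)"
proof (induction k)
  case (Suc k)
  have "1 * 1 \<le> (3 * reach) ^ k * R" using reach_ge R by (intro mult_mono one_le_power) auto
  hence "(1 + 1 / fill_const) * energy e ((3 * reach) ^ k * R) \<le> energy e (3 * reach * ((3 * reach) ^ k * R))"
    by (intro hole_filling[OF e]) simp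
  moreover have "(1 + 1 / fill_const) * ((1 + 1 / fill_const) ^ k * energy e R) \<le> (1 + 1 / fill_const) * energy e ((3 * reach) ^ k * R)"
    using Suc fill_const_pos by (intro mult_left_mono) auto
  ultimately show ?case by (simp add: mult_ac)
qed simp

text \<open>Each dilation by \<open>3 * reach\<close> multiplies a positive energy by at least
  \<open>1 + 1 / fill_const\<close>, whereas the upper bound grows by at most
  \<open>(N ^ p) powr e\<close>. For small \<open>e\<close> the second factor is below the first,
  which contradicts positivity after enough dilations.\<close>

lemma energy_zero:
  obtains e where "small e" "\<And>R. 1 \<le> R \<Longrightarrow> energy e R = 0"
proof -
  obtain N where N: "1 \<le> N" "\<And>R. 1 \<le> R \<Longrightarrow> D (2 * R) \<le> N * D R" using growth by blast
  obtain p :: nat where p: "3 * reach \<le> 2 ^ p"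
    using real_arch_pow[of 2 "3 * reach"] by (auto intro: less_imp_le)
  \<comment> \<open>Strictly between 1 and the growth factor of \<open>hole_filling\<close>, leaving
    room for the upper growth.\<close>
  define \<rho> where "\<rho> = 1 + 1 / (2 * fill_const)"
  have \<rho>: "1 < \<rho>" "\<rho> < 1 + 1 / fill_const" unfolding \<rho>_def using fill_const_pos by (auto simp: field_simps)
  \<comment> \<open>The added 1 keeps \<open>L\<close> positive when \<open>N = 1\<close>.\<close>
  define L where "L = real p * ln N + 1"
  have L1: "1 \<le> L" unfolding L_def using N(1) by simp
  \<comment> \<open>The first two entries give \<open>small e\<close>, the entry 2 permits
    interpolation, and the last one forces \<open>(N ^ p) powr e \<le> \<rho>\<close>.\<close>
  define e where "e = min (min (1 / M0) (c0 / (6 * C0 * M0))) (min 2 (ln \<rho> / L))"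
  have e0: "0 < e" unfolding e_def using const_pos \<rho> L1 by (simp add: min_def)
  have "e \<le> 1 / M0" "e \<le> c0 / (6 * C0 * M0)" "e \<le> 2" "e \<le> ln \<rho> / L" unfolding e_def by auto
  hence e: "e * M0 \<le> 1" "6 * C0 * e * M0 \<le> c0" "e \<le> 2" "e * L \<le> ln \<rho>"
    using const_pos L1 by (auto simp: field_simps)
  have sm: "small e" unfolding small_def using e e0 by simp
  obtain K where K: "0 \<le> K" "\<And>R. 1 \<le> R \<Longrightarrow> energy e R \<le> K * D (2 * reach * R) powr e"
    using energy_upper[OF sm e(3)] by blast
  have Np: "(N ^ p) powr e \<le> \<rho>"
  proof -
    have "(N ^ p) powr e = exp (e * (real p * ln N))" using N(1) by (simp add: powr_def ln_realpow)
    also have "\<dots> \<le> exp (ln \<rho>)"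
    proof -
      have "e * (real p * ln N) \<le> e * L" unfolding L_def using e0 by (intro mult_left_mono) auto
      thus ?thesis using e(4) by simp
    qed
    finally show ?thesis using \<rho> by simp
  qed
  have "energy e R = 0" if R: "1 \<le> R" for R
  proof (rule ccontr)
    assume "energy e R \<noteq> 0"
    hence En0: "0 < energy e R" using energy_nonneg[of e R] by simp
    obtain m :: nat where m: "R \<le> 2 ^ m" using real_arch_pow[of 2 R] by (auto intro: less_imp_le)
    define B where "B = K * (N ^ (p + m) * D 1) powr e"
    have bound: "(1 + 1 / fill_const) ^ k * energy e R \<le> B * \<rho> ^ k" for k
    proof -
      have R1: "1 \<le> (3 * reach) ^ k * R"
      proof -
        have "1 * 1 \<le> (3 * reach) ^ k * R" using reach_ge R by (intro mult_mono one_le_power) auto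
        thus ?thesis by simp
      qed
      have "2 * reach * ((3 * reach) ^ k * R) \<le> 2 ^ p * ((2 ^ p) ^ k * 2 ^ m)"
        using p reach_ge R m by (intro mult_mono power_mono) auto
      also have "\<dots> = 2 ^ (p + m + p * k)" by (simp add: power_add power_mult)
      finally have "D (2 * reach * ((3 * reach) ^ k * R)) \<le> D (2 ^ (p + m + p * k))"
        using reach_ge R by (intro D_mono) auto
      also have "\<dots> \<le> N ^ (p + m + p * k) * D 1" by (rule D_pow[OF N])
      also have "N ^ (p + m + p * k) = N ^ (p + m) * (N ^ p) ^ k" by (simp only: power_add power_mult)
      also have "N ^ (p + m) * (N ^ p) ^ k * D 1 = (N ^ (p + m) * D 1) * (N ^ p) ^ k" by (simp only: mult_ac)
      finally have Dle: "D (2 * reach * ((3 * reach) ^ k * R)) \<le> (N ^ (p + m) * D 1) * (N ^ p) ^ k" .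
      have "(1 + 1 / fill_const) ^ k * energy e R \<le> energy e ((3 * reach) ^ k * R)" by (rule energy_lower[OF sm R])
      also have "\<dots> \<le> K * D (2 * reach * ((3 * reach) ^ k * R)) powr e" by (rule K(2)[OF R1])
      also have "\<dots> \<le> K * ((N ^ (p + m) * D 1) * (N ^ p) ^ k) powr e"
      proof (rule mult_left_mono[OF powr_mono2 K(1)])
        show "0 \<le> D (2 * reach * ((3 * reach) ^ k * R))"
          using D_pos[of "2 * reach * ((3 * reach) ^ k * R)"] reach_ge R by simp
      qed (use Dle e0 in auto)
      also have "\<dots> = B * (((N ^ p) powr e) ^ k)"
      proof -
        have N0: "0 \<le> N" using N(1) by simp
        have "((N ^ p) ^ k) powr e = ((N ^ p) powr e) ^ k"
          using N0 by (induction k) (simp_all add: powr_mult)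
        thus ?thesis unfolding B_def using N0 D_pos[of 1] by (subst powr_mult) auto
      qed
      also have "\<dots> \<le> B * \<rho> ^ k"
        unfolding B_def using Np K(1) by (intro mult_left_mono power_mono) auto
      finally show ?thesis .
    qed
    \<comment> \<open>Ratio of lower to upper growth factor; its powers are unbounded, yet
      \<open>bound\<close> keeps them below a constant.\<close>
    define \<sigma> where "\<sigma> = (1 + 1 / fill_const) / \<rho>"
    have \<sigma>: "1 < \<sigma>" unfolding \<sigma>_def using \<rho> by simp
    have "\<sigma> ^ k \<le> B / energy e R" for k
    proof -
      have "\<sigma> ^ k * \<rho> ^ k * energy e R \<le> B * \<rho> ^ k"
        using bound[of k] \<rho> unfolding \<sigma>_def by (simp add: power_divide)
      hence "(\<sigma> ^ k * energy e R) * \<rho> ^ k \<le> B * \<rho> ^ k" by (simp add: mult_ac)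
      hence "\<sigma> ^ k * energy e R \<le> B" using \<rho> by (simp add: mult_le_cancel_right_pos)
      thus ?thesis using En0 by (simp add: field_simps)
    qed
    moreover obtain k where "B / energy e R < \<sigma> ^ k" using real_arch_pow[OF \<sigma>] by blast
    ultimately show False by (meson not_less)
  qed
  thus ?thesis using that sm by blast
qed

lemma u_const_face:
  assumes f: "f \<in> F"
  shows "osc u f = 0"
proof -
  obtain e where e: "small e" "\<And>R. 1 \<le> R \<Longrightarrow> energy e R = 0" using energy_zero by blast
  have e0: "0 < e" using e unfolding small_def by simp
  have fin: "finite f" "f \<noteq> {}" using P.fin[OF f] by auto
  define R where "R = 2 + (\<Sum>v\<in>f. cmod (z v - o1))"
  have R1: "1 \<le> R" unfolding R_def by (simp add: sum_nonneg add_increasing2)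
  have "cmod (z v - o1) < R" if "v \<in> f" for v
    using member_le_sum[OF that, of "\<lambda>v. cmod (z v - o1)"] fin unfolding R_def by simp
  hence fI: "f \<in> faces_in R" unfolding faces_in_def verts_in_def using f by blast
  have "(osc_w e f)\<^sup>2 = 0"
    using e(2)[OF R1] fI faces_in(1)[of R] unfolding energy_def by (subst (asm) sum_nonneg_eq_0_iff) auto
  hence o: "osc_w e f = 0" by simp
  obtain i j where ij: "i \<in> f" "j \<in> f" "osc u f = u i - u j" using osc_attained[OF fin] by metis
  have "\<bar>w e i - w e j\<bar> \<le> 0" using abs_diff_le_osc[OF fin(1) ij(1,2), of "w e"] o by simp
  hence "exp (e / 2 * u i) = exp (e / 2 * u j)" unfolding w_def by simp
  thus ?thesis using ij(3) e0 by simp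
qed

text \<open>Connectedness of a disc containing both vertices replaces a chain of adjacent faces:
  \<open>connected_cover_oscillation\<close> with all face oscillations zero compares the two
  values.\<close>

theorem u_constant:
  assumes "a \<in> \<Union>F" "b \<in> \<Union>F"
  shows "u a = u b"
proof -
  have "u a \<le> u b" if ab: "a \<in> \<Union>F" "b \<in> \<Union>F" for a b
  proof -
    obtain f g where f: "f \<in> F" "a \<in> f" and g: "g \<in> F" "b \<in> g" using ab by blast
    let ?R = "cmod (z a - o1) + cmod (z b - o1)"
    have za: "z a \<in> cball o1 ?R" "z b \<in> cball o1 ?R" by (simp_all add: dist_norm norm_minus_commute)
    have M: "f \<in> faces_near ?R" "g \<in> faces_near ?R" unfolding faces_near_def using f g za vertex_in_H by blast+
    have "Max (u ` f) - Min (u ` g) \<le> (\<Sum>i\<in>faces_near ?R. Max (u ` i) - Min (u ` i))"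
    proof (rule connected_cover_oscillation[where X = "cball o1 ?R" and A = P.H])
      show "cball o1 ?R \<subseteq> (\<Union>i\<in>faces_near ?R. P.H i)"
      proof
        fix x assume x: "x \<in> cball o1 ?R"
        obtain i where "i \<in> F" "x \<in> P.H i" by (rule face_at)
        thus "x \<in> (\<Union>i\<in>faces_near ?R. P.H i)" using x unfolding faces_near_def by blast
      qed
      show "closed (P.H i)" if "i \<in> faces_near ?R" for i using P.closed_H(1) that faces_near(2) by blast
      show "Min (u ` i) \<le> Max (u ` i)" if "i \<in> faces_near ?R" for i
      proof -
        have "i \<in> F" using that faces_near(2) by blast
        thus ?thesis using osc_nonneg[OF P.fin[of i], of u] unfolding osc_def by simp
      qed
      show "Min (u ` i) \<le> Max (u ` j)" if ij: "i \<in> faces_near ?R" "j \<in> faces_near ?R" "P.H i \<inter> P.H j \<inter> cball o1 ?R \<noteq> {}" for i j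
      proof -
        have F: "i \<in> F" "j \<in> F" using ij faces_near(2) by auto
        then obtain v where v: "v \<in> i" "v \<in> j" using P.share_vertex ij(3) by blast
        have "Min (u ` i) \<le> u v" "u v \<le> Max (u ` j)" using v F P.fin(1) by auto
        thus ?thesis by simp
      qed
      show "P.H f \<inter> cball o1 ?R \<noteq> {}" "P.H g \<inter> cball o1 ?R \<noteq> {}" using M unfolding faces_near_def by blast+
    qed (use M faces_near(1) in auto)
    also have "\<dots> = 0"
    proof (rule sum.neutral, rule ballI)
      fix i assume "i \<in> faces_near ?R"
      hence "i \<in> F" using faces_near(2) by blast
      thus "Max (u ` i) - Min (u ` i) = 0" using u_const_face unfolding osc_def by blast
    qed
    finally have "Max (u ` f) \<le> Min (u ` g)" by simp
    moreover have "u a \<le> Max (u ` f)" "Min (u ` g) \<le> u b" using f g P.fin(1) by auto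
    ultimately show ?thesis by simp
  qed
  thus ?thesis using assms by (meson order_antisym)
qed

end

section \<open>From geodesic embeddings to planar triangulations\<close>

text \<open>The image of the interior is open and relatively closed in the complement of the
  frontier, hence a bounded component of that complement.\<close>

lemma image_eq_of_frontier:
  fixes S :: "complex set"
  assumes S: "compact S" "convex S" "interior S \<noteq> {}"
    and k: "continuous_on S k" "inj_on k S" "k ` frontier S = frontier S"
  shows "k ` S = S"
proof -
  have clS: "closed S" using S by (simp add: compact_imp_closed)
  have Sdec: "S = interior S \<union> frontier S" "interior S \<inter> frontier S = {}" "frontier S \<subseteq> S" "interior S \<subseteq> S"
    using clS interior_subset[of S] by (auto simp: frontier_def closure_closed)
  define U where "U = k ` interior S"
  have opU: "open U" unfolding U_def
    using k Sdec by (intro invariance_of_domain) (auto intro: continuous_on_subset inj_on_subset)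
  have conU: "connected U" unfolding U_def
    using k Sdec S by (intro connected_continuous_image convex_connected convex_interior) (auto intro: continuous_on_subset)
  have neU: "U \<noteq> {}" unfolding U_def using S by simp
  have kS: "k ` S = U \<union> frontier S" unfolding U_def using Sdec(1) k(3) by (metis image_Un)
  have UF: "U \<inter> frontier S = {}"
  proof -
    have "k ` interior S \<inter> k ` frontier S = k ` (interior S \<inter> frontier S)"
      using k(2) Sdec by (intro inj_on_image_Int[symmetric]) auto
    thus ?thesis unfolding U_def k(3) Sdec(2) by simp
  qed
  have cpk: "compact (k ` S)" using k S by (intro compact_continuous_image)
  hence clk: "closed (k ` S)" by (rule compact_imp_closed)
  have fill: "C \<subseteq> U" if C: "connected C" "open C" "C \<inter> frontier S = {}" "U \<inter> C \<noteq> {}" for C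
  proof -
    have "C \<subseteq> U \<union> (- (k ` S))" using C(3) kS by blast
    moreover have "open (- (k ` S))" by (rule open_Compl[OF clk])
    moreover have "U \<inter> - (k ` S) \<inter> C = {}" using kS by blast
    ultimately have "- (k ` S) \<inter> C = {}" using connectedD[OF C(1) opU, of "- (k ` S)"] C(4) by blast
    thus ?thesis using kS C(3) by blast
  qed
  have "U \<subseteq> interior S \<union> - S" using UF Sdec(1) by blast
  hence "U \<inter> interior S \<noteq> {} \<or> U \<inter> - S \<noteq> {}" using neU by blast
  moreover have "U \<inter> - S = {}"
  \<comment> \<open>If \<open>U\<close> met the outside it would contain all of it, and the plane
    would be a union of two bounded sets.\<close>
  proof (rule ccontr)
    assume "U \<inter> - S \<noteq> {}"
    hence "- S \<subseteq> U"
    proof (intro fill)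
      show "connected (- S)" using S by (intro connected_complement_bounded_convex compact_imp_bounded) auto
      show "open (- S)" by (rule open_Compl[OF clS])
      show "- S \<inter> frontier S = {}" using Sdec by blast
    qed
    hence "- S \<subseteq> k ` S" using kS by blast
    hence "bounded (S \<union> k ` S)" "S \<union> k ` S = UNIV" using S(1) cpk compact_imp_bounded by blast+
    thus False by (metis not_bounded_UNIV)
  qed
  ultimately have "interior S \<subseteq> U"
    using S Sdec by (intro fill convex_connected convex_interior) auto
  moreover have "U \<subseteq> interior S" using \<open>U \<subseteq> interior S \<union> - S\<close> \<open>U \<inter> - S = {}\<close> by blast
  ultimately have "U = interior S" by blast
  thus ?thesis using kS Sdec(1) by simp
qed

lemma open_coord_pos: "open {x :: 'v \<Rightarrow> real. 0 < x v}"
proof -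
  have "open ((\<lambda>x :: 'v \<Rightarrow> real. x v) -` {0<..})"
    using continuous_on_product_coordinates by (intro open_vimage) auto
  moreover have "(\<lambda>x :: 'v \<Rightarrow> real. x v) -` {0<..} = {x. 0 < x v}" by auto
  ultimately show ?thesis by simp
qed

abbreviation supp :: "('v \<Rightarrow> real) \<Rightarrow> 'v set" where "supp x \<equiv> {v. x v \<noteq> 0}"

text \<open>Only the images of edges are prescribed, and only as sets: \<open>\<phi>\<close> need
  not be affine on any simplex. \<open>opn\<close> records that images of open sets are open in the
  plane.\<close>

locale embedded =
  fixes F :: "'v set set" and \<phi> :: "('v \<Rightarrow> real) \<Rightarrow> complex" and \<epsilon> :: real
  assumes card3: "\<And>f. f \<in> F \<Longrightarrow> card f = 3"
    and edges: "\<And>f i j. f \<in> F \<Longrightarrow> i \<in> f \<Longrightarrow> j \<in> f \<Longrightarrow> i \<noteq> j \<Longrightarrow>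
      \<phi> ` edge_realization F i j = closed_segment (\<phi> (vert i)) (\<phi> (vert j))"
    and cont: "continuous_on (realization F) \<phi>"
    and inj: "inj_on \<phi> (realization F)"
    and opn: "\<And>U. openin (top_of_set (realization F)) U \<Longrightarrow> open (\<phi> ` U)"
    and eps: "0 < \<epsilon>"
    and fat: "\<And>f v. f \<in> F \<Longrightarrow> v \<in> f \<Longrightarrow> \<epsilon> \<le> fang (\<lambda>v. \<phi> (vert v)) f v"
begin

abbreviation X where "X \<equiv> realization F"
abbreviation z where "z \<equiv> (\<lambda>v. \<phi> (vert v))"
definition \<Delta> :: "'v set \<Rightarrow> ('v \<Rightarrow> real) set" where "\<Delta> g = {x \<in> X. supp x \<subseteq> g}"

lemma vert_in: "f \<in> F \<Longrightarrow> v \<in> f \<Longrightarrow> vert v \<in> X"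
proof -
  assume f: "f \<in> F" "v \<in> f"
  have "finite f" using card3[OF f(1)] by (auto intro: card_ge_0_finite)
  hence "sum (vert v) f = 1" unfolding vert_def using f by (simp add: sum.delta)
  moreover have "supp (vert v) \<subseteq> f" using f unfolding vert_def by auto
  ultimately show ?thesis unfolding realization_def using f by (auto simp: vert_def)
qed

lemma inj_z: "inj_on z (\<Union>F)"
proof (rule inj_onI)
  fix a b assume ab: "a \<in> \<Union>F" "b \<in> \<Union>F" "z a = z b"
  have "vert a \<in> X" "vert b \<in> X" using ab vert_in by blast+
  hence "vert a = vert b" using inj ab(3) by (auto dest: inj_onD)
  hence "vert a a = vert b a" by simp
  thus "a = b" unfolding vert_def by (auto split: if_splits)
qed

lemma face: "f \<in> F \<Longrightarrow> fat_face z f \<epsilon>"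
proof
  assume f: "f \<in> F"
  show "card f = 3" by (rule card3[OF f])
  show "inj_on z f" using inj_z f by (rule inj_on_subset[OF _ Union_upper])
  show "0 < \<epsilon>" by (rule eps)
  show "\<epsilon> \<le> fang z f v" if "v \<in> f" for v by (rule fat[OF f that])
qed

lemma sum_supp:
  assumes "x \<in> X" "supp x \<subseteq> g" "finite g"
  shows "sum x g = 1"
proof -
  obtain f where f: "f \<in> F" "supp x \<subseteq> f" "sum x f = 1" using assms(1) unfolding realization_def by blast
  have "finite f" using card3[OF f(1)] by (auto intro: card_ge_0_finite)
  hence "sum x f = sum x (supp x)" using f by (intro sum.mono_neutral_right) auto
  moreover have "sum x g = sum x (supp x)" using assms by (intro sum.mono_neutral_right) auto
  ultimately show ?thesis using f by simp
qed

text \<open>Inverse of the affine parametrisation of the straight triangle, with values in the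
  realization.\<close>

definition \<psi> :: "'v set \<Rightarrow> complex \<Rightarrow> 'v \<Rightarrow> real" where
  "\<psi> f p = (\<lambda>v. if v \<in> f then bary z f v p else 0)"

lemma \<psi>_cont: "continuous_on S (\<psi> f)"
proof (rule continuous_on_coordinatewise_then_product)
  fix v
  show "continuous_on S (\<lambda>p. \<psi> f p v)"
    unfolding \<psi>_def bary_def cross_def by (cases "v \<in> f") (auto simp: divide_inverse intro!: continuous_intros)
qed

lemma \<psi>_image:
  assumes f: "f \<in> F" and g: "g \<subseteq> f"
  shows "\<psi> f ` (convex hull (z ` g)) = \<Delta> g"
proof -
  interpret fat_face z f \<epsilon> by (rule face[OF f])
  have fing: "finite g" "inj_on z g" using g fin inj finite_subset inj_on_subset by blast+
  show ?thesis
  proof (intro subset_antisym subsetI)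
    fix x assume "x \<in> \<psi> f ` (convex hull (z ` g))"
    then obtain p where p: "p \<in> convex hull (z ` g)" "x = \<psi> f p" by blast
    then obtain c where c: "\<forall>v\<in>g. 0 \<le> c v" "sum c g = 1" "(\<Sum>v\<in>g. c v *\<^sub>R z v) = p"
      using mem_hull_image_iff[OF fing] by blast
    have x: "x v = (if v \<in> g then c v else 0)" for v
      unfolding p(2) \<psi>_def using bary_subface[OF g c, of v] g by auto
    have "sum x f = 1"
    proof -
      have "sum x f = sum x g" using g fin(1) x by (intro sum.mono_neutral_right) auto
      also have "\<dots> = sum c g" using x by (intro sum.cong) auto
      finally show ?thesis using c by simp
    qed
    moreover have "supp x \<subseteq> g" using x by auto
    moreover have "0 \<le> x v" for v using x c by auto
    ultimately show "x \<in> \<Delta> g" unfolding \<Delta>_def realization_def using f g by blast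
  next
    fix x assume x: "x \<in> \<Delta> g"
    hence xX: "x \<in> X" "supp x \<subseteq> g" unfolding \<Delta>_def by auto
    have x0: "\<forall>v\<in>g. 0 \<le> x v" using xX(1) unfolding realization_def by blast
    have x1: "sum x g = 1" by (rule sum_supp[OF xX fing(1)])
    define p where "p = (\<Sum>v\<in>g. x v *\<^sub>R z v)"
    have "p \<in> convex hull (z ` g)" unfolding mem_hull_image_iff[OF fing] p_def using x0 x1 by blast
    moreover have "\<psi> f p = x"
    proof
      fix v show "\<psi> f p v = x v"
        unfolding \<psi>_def using bary_subface[OF g x0 x1 p_def[symmetric], of v] xX(2) g by auto
    qed
    ultimately show "x \<in> \<psi> f ` (convex hull (z ` g))" by blast
  qed
qed

lemma \<psi>_inj:
  assumes f: "f \<in> F"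
  shows "inj_on (\<psi> f) S"
proof (rule inj_onI)
  fix p q assume "\<psi> f p = \<psi> f q"
  hence "bary z f v p = bary z f v q" if "v \<in> f" for v using that unfolding \<psi>_def by (metis (mono_tags))
  hence "(\<Sum>v\<in>f. bary z f v p *\<^sub>R z v) = (\<Sum>v\<in>f. bary z f v q *\<^sub>R z v)" by (intro sum.cong) auto
  thus "p = q" using fat_face.bary_sum(2)[OF face[OF f]] by metis
qed

lemma \<Delta>_edge: "\<Delta> {i, j} = edge_realization F i j"
  unfolding \<Delta>_def edge_realization_def by blast

text \<open>Although \<open>\<phi>\<close> is unconstrained inside a face,
  \<open>\<phi> \<circ> \<psi> f\<close> is continuous and injective on the straight triangle and
  maps each side onto itself, so \<open>image_eq_of_frontier\<close> identifies its image.\<close>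

lemma face_image:
  assumes f: "f \<in> F"
  shows "\<phi> ` \<Delta> f = convex hull (z ` f)"
proof -
  interpret fat_face z f \<epsilon> by (rule face[OF f])
  let ?S = "convex hull (z ` f)" and ?k = "\<phi> \<circ> \<psi> f"
  have \<psi>X: "\<psi> f ` ?S \<subseteq> X" using \<psi>_image[OF f subset_refl] unfolding \<Delta>_def by blast
  have "?k ` ?S = ?S"
  proof (rule image_eq_of_frontier)
    show "compact ?S" using fin by (intro finite_imp_compact_convex_hull) auto
    show "convex ?S" by simp
    show "interior ?S \<noteq> {}"
    proof -
      obtain g where g: "ball g ((sin \<epsilon>)^3 * fdiam z f / 3) \<subseteq> ?S" using inscribed_ball .
      have "g \<in> ball g ((sin \<epsilon>)^3 * fdiam z f / 3)" using sin_eps_pos fdiam_pos by simp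
      thus ?thesis using g interior_maximal[OF g open_ball] by blast
    qed
    show "continuous_on ?S ?k" using \<psi>X by (intro continuous_on_compose \<psi>_cont continuous_on_subset[OF cont])
    show "inj_on ?k ?S" using \<psi>X by (intro comp_inj_on \<psi>_inj[OF f] inj_on_subset[OF embedded.inj[OF embedded_axioms]])
    obtain a b c where abc: "f = {a, b, c}" "a \<noteq> b" "a \<noteq> c" "b \<noteq> c" using card3 by (auto simp: card_3_iff)
    have in_f: "a \<in> f" "b \<in> f" "c \<in> f" unfolding abc(1) by auto
    have fr: "frontier ?S = closed_segment (z a) (z b) \<union> closed_segment (z b) (z c) \<union> closed_segment (z c) (z a)"
      unfolding abc(1) using frontier_of_triangle[of "z a" "z b" "z c"] by simp
    have seg: "?k ` closed_segment (z i) (z j) = closed_segment (z i) (z j)" if "i \<in> f" "j \<in> f" "i \<noteq> j" for i j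
    proof -
      have "?k ` closed_segment (z i) (z j) = \<phi> ` (\<psi> f ` (convex hull (z ` {i, j})))"
        by (simp add: segment_convex_hull image_comp)
      also have "\<psi> f ` (convex hull (z ` {i, j})) = \<Delta> {i, j}" using that by (intro \<psi>_image[OF f]) auto
      also have "\<phi> ` \<Delta> {i, j} = closed_segment (z i) (z j)" unfolding \<Delta>_edge using edges[OF f that] .
      finally show ?thesis .
    qed
    show "?k ` frontier ?S = frontier ?S"
      unfolding fr image_Un using seg[of a b] seg[of b c] seg[of c a] in_f abc(2-4) by simp
  qed
  moreover have "?k ` ?S = \<phi> ` \<Delta> f" unfolding image_comp[symmetric] \<psi>_image[OF f subset_refl] ..
  ultimately show ?thesis by simp
qed

lemma mem_face_iff:
  assumes "f \<in> F" "x \<in> X"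
  shows "\<phi> x \<in> convex hull (z ` f) \<longleftrightarrow> supp x \<subseteq> f"
proof
  assume "\<phi> x \<in> convex hull (z ` f)"
  then obtain y where y: "y \<in> \<Delta> f" "\<phi> x = \<phi> y" unfolding face_image[OF assms(1), symmetric] by blast
  hence "x = y" using inj assms(2) unfolding \<Delta>_def by (auto dest: inj_onD)
  thus "supp x \<subseteq> f" using y unfolding \<Delta>_def by blast
next
  assume "supp x \<subseteq> f"
  hence "x \<in> \<Delta> f" unfolding \<Delta>_def using assms(2) by blast
  thus "\<phi> x \<in> convex hull (z ` f)" unfolding face_image[OF assms(1), symmetric] by blast
qed

text \<open>The common carrier of two distinct faces has one or two vertices. These cases have to be
  treated through vertices and edges, since a convex combination is not preserved by
  \<open>\<phi>\<close>.\<close>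

lemma planar: "planar F z \<epsilon>"
proof
  show "\<And>f. f \<in> F \<Longrightarrow> card f = 3" by (rule card3)
  show "inj_on z (\<Union>F)" by (rule inj_z)
  show "0 < \<epsilon>" by (rule eps)
  show "\<And>f v. f \<in> F \<Longrightarrow> v \<in> f \<Longrightarrow> \<epsilon> \<le> fang z f v" by (rule fat)
next
  fix f g p assume f: "f \<in> F" and g: "g \<in> F" and p: "p \<in> convex hull (z ` f)" "p \<in> convex hull (z ` g)"
  obtain x where x: "x \<in> X" "p = \<phi> x" using p(1) unfolding face_image[OF f, symmetric] \<Delta>_def by blast
  have sx: "supp x \<subseteq> f \<inter> g" using mem_face_iff[OF f x(1)] mem_face_iff[OF g x(1)] p x(2) by blast
  have finf: "finite f" "finite g" using card3[OF f] card3[OF g] by (auto intro: card_ge_0_finite)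
  show "p \<in> convex hull (z ` (f \<inter> g))"
  proof (cases "f = g")
    case True thus ?thesis using p by simp
  next
    case False
    hence "f \<inter> g \<subset> f" using card_subset_eq[OF finf(2), of f] card3[OF f] card3[OF g] by auto
    hence c: "card (f \<inter> g) < 3" using psubset_card_mono[OF finf(1)] card3[OF f] by metis
    have s1: "sum x (f \<inter> g) = 1" using finf by (intro sum_supp[OF x(1) sx]) auto
    hence ne: "f \<inter> g \<noteq> {}" by auto
    hence "card (f \<inter> g) \<noteq> 0" using finf by simp
    hence "card (f \<inter> g) = 1 \<or> card (f \<inter> g) = 2" using c by linarith
    thus ?thesis
    proof
      assume "card (f \<inter> g) = 1"
      then obtain i where i: "f \<inter> g = {i}" by (auto simp: card_1_singleton_iff)
      have "x = vert i"
      proof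
        fix v show "x v = vert i v" using s1 sx unfolding i vert_def by (cases "v = i") auto
      qed
      thus ?thesis unfolding i x(2) by simp
    next
      assume "card (f \<inter> g) = 2"
      then obtain i j where ij: "f \<inter> g = {i, j}" "i \<noteq> j" by (auto simp: card_2_iff)
      hence ijf: "i \<in> f" "j \<in> f" by blast+
      have "x \<in> edge_realization F i j" unfolding edge_realization_def using x(1) sx ij(1) by blast
      hence "p \<in> closed_segment (z i) (z j)" unfolding x(2) edges[OF f ijf ij(2), symmetric] by blast
      thus ?thesis unfolding ij(1) by (simp add: segment_convex_hull)
    qed
  qed
next
  fix f p assume f: "f \<in> F" and p: "p \<in> convex hull (z ` f)"
  obtain x where x: "x \<in> X" "p = \<phi> x" using p unfolding face_image[OF f, symmetric] \<Delta>_def by blast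
  have sx: "supp x \<subseteq> f" using mem_face_iff[OF f x(1)] p x(2) by blast
  have "finite f" using card3[OF f] by (auto intro: card_ge_0_finite)
  hence fins: "finite (supp x)" using sx by (rule finite_subset[rotated])
  \<comment> \<open>Open star of the smallest simplex containing \<open>x\<close>: any face that
    contains a point of it also contains that simplex.\<close>
  define U where "U = X \<inter> (\<Inter>v\<in>supp x. {y. 0 < y v})"
  have "open (\<Inter>v\<in>supp x. {y :: 'v \<Rightarrow> real. 0 < y v})" using fins open_coord_pos by (intro open_INT) auto
  hence "openin (top_of_set X) U" unfolding U_def by (rule openin_open_Int)
  hence "open (\<phi> ` U)" by (rule opn)
  moreover have "x \<in> U"
  proof -
    have "0 \<le> x v" for v using x(1) unfolding realization_def by blast
    hence "0 < x v" if "v \<in> supp x" for v using that by (simp add: order_less_le)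
    thus ?thesis unfolding U_def using x(1) by blast
  qed
  ultimately obtain r where r: "r > 0" "ball p r \<subseteq> \<phi> ` U" unfolding x(2) by (metis imageI open_contains_ball)
  have "\<phi> ` U \<subseteq> (\<Union>g\<in>{g\<in>F. p \<in> convex hull (z ` g)}. convex hull (z ` g))"
  proof
    fix q assume "q \<in> \<phi> ` U"
    then obtain y where y: "y \<in> X" "\<And>v. v \<in> supp x \<Longrightarrow> 0 < y v" "q = \<phi> y" unfolding U_def by blast
    obtain g where g: "g \<in> F" "supp y \<subseteq> g" using y(1) unfolding realization_def by blast
    have "supp x \<subseteq> supp y" using y(2) by force
    hence "p \<in> convex hull (z ` g)" unfolding x(2) mem_face_iff[OF g(1) x(1)] using g(2) by blast
    moreover have "q \<in> convex hull (z ` g)" unfolding y(3) mem_face_iff[OF g(1) y(1)] by (rule g(2))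
    ultimately show "q \<in> (\<Union>g\<in>{g\<in>F. p \<in> convex hull (z ` g)}. convex hull (z ` g))" using g(1) by blast
  qed
  thus "\<exists>r>0. ball p r \<subseteq> (\<Union>g\<in>{g\<in>F. p \<in> convex hull (z ` g)}. convex hull (z ` g))"
    using r by (meson subset_trans)
qed

text \<open>The images of the open vertex stars cover \<open>K\<close>. Finitely many suffice, and a
  face meeting the star of \<open>v\<close> has \<open>v\<close> as a vertex, so finite degree
  concludes.\<close>

lemma locally_finite:
  assumes K: "compact K" "K \<subseteq> \<phi> ` X"
  shows "finite {f \<in> F. convex hull (z ` f) \<inter> K \<noteq> {}}"
proof -
  interpret P: planar F z \<epsilon> by (rule planar)
  define St where "St v = \<phi> ` (X \<inter> {y. 0 < y v})" for v
  have opSt: "open (St v)" for v unfolding St_def by (intro opn openin_open_Int open_coord_pos)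
  have cov: "K \<subseteq> (\<Union>v\<in>UNIV. St v)"
  proof
    fix p assume "p \<in> K"
    then obtain x where x: "x \<in> X" "p = \<phi> x" using K(2) by blast
    obtain f where f: "sum x f = 1" using x(1) unfolding realization_def by blast
    have "\<exists>v. x v \<noteq> 0"
    proof (rule ccontr)
      assume "\<not> ?thesis"
      hence "sum x f = 0" by (intro sum.neutral) auto
      thus False using f by simp
    qed
    then obtain v where "x v \<noteq> 0" by blast
    moreover have "0 \<le> x v" using x(1) unfolding realization_def by blast
    ultimately have "p \<in> St v" unfolding St_def x(2) using x(1) by force
    thus "p \<in> (\<Union>v\<in>UNIV. St v)" by blast
  qed
  obtain D where "D \<subseteq> UNIV" and D: "finite D" "K \<subseteq> (\<Union>v\<in>D. St v)"
    by (rule compactE_image[OF K(1) opSt cov])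
  have "{f \<in> F. convex hull (z ` f) \<inter> K \<noteq> {}} \<subseteq> (\<Union>v\<in>D. P.star v)"
  proof
    fix f assume "f \<in> {f \<in> F. convex hull (z ` f) \<inter> K \<noteq> {}}"
    then obtain p where f: "f \<in> F" and p: "p \<in> convex hull (z ` f)" "p \<in> K" by blast
    then obtain v where v: "v \<in> D" "p \<in> St v" using D by blast
    then obtain x where x: "x \<in> X" "0 < x v" "p = \<phi> x" unfolding St_def by blast
    have "supp x \<subseteq> f" using p(1) mem_face_iff[OF f x(1)] x(3) by blast
    moreover have "v \<in> supp x" using x(2) by simp
    ultimately show "f \<in> (\<Union>v\<in>D. P.star v)" using f v(1) by blast
  qed
  moreover have "finite (\<Union>v\<in>D. P.star v)" using D(1) P.star_finite(1) by blast
  ultimately show ?thesis by (rule finite_subset)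
qed

end

section \<open>From the given PL metrics to a pair of planar triangulations\<close>

lemma uniformly_nondegenerate_fang:
  assumes "uniformly_nondegenerate F (induced_metric \<phi>)" "\<And>f. f \<in> F \<Longrightarrow> card f = 3"
  obtains \<epsilon> where "0 < \<epsilon>" "\<And>f v. f \<in> F \<Longrightarrow> v \<in> f \<Longrightarrow> \<epsilon> \<le> fang (\<lambda>v. \<phi> (vert v)) f v"
proof -
  obtain \<epsilon> where e: "0 < \<epsilon>" "\<And>i j k. {i, j, k} \<in> F \<Longrightarrow> i \<noteq> j \<Longrightarrow> j \<noteq> k \<Longrightarrow> i \<noteq> k \<Longrightarrow>
      \<epsilon> \<le> inner_angle (induced_metric \<phi>) i j k"
    using assms(1) unfolding uniformly_nondegenerate_def by blast
  have m: "induced_metric \<phi> = (\<lambda>i j. cmod (\<phi> (vert i) - \<phi> (vert j)))"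
    by (intro ext) (simp add: induced_metric_def)
  show ?thesis
  proof (rule that[OF e(1)])
    fix f v assume f: "f \<in> F" "v \<in> f"
    obtain j k where jk: "f = {v, j, k}" "v \<noteq> j" "v \<noteq> k" "j \<noteq> k" using face_others[OF assms(2)[OF f(1)] f(2)] by metis
    have "\<epsilon> \<le> inner_angle (induced_metric \<phi>) v j k" using e(2)[of v j k] f(1) jk by metis
    thus "\<epsilon> \<le> fang (\<lambda>v. \<phi> (vert v)) f v"
      unfolding m fang_eq[OF jk] using inner_angle_eq_vangle[of "\<lambda>v. \<phi> (vert v)" v j k] by simp
  qed
qed

theorem mainTheorem1:
  fixes V :: "'v set" and E F :: "'v set set"
    and \<phi> \<phi>' :: "('v \<Rightarrow> real) \<Rightarrow> complex" and u :: "'v \<Rightarrow> real"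
  assumes "surface_triangulation V E F"
    and "geodesic_homeomorphism V E F \<phi>"
    and "geodesic_embedding V E F \<phi>'"
    and "uniformly_nondegenerate F (induced_metric \<phi>)"
    and "uniformly_nondegenerate F (induced_metric \<phi>')"
    and "uniformly_delaunay F (induced_metric \<phi>)"
    and "delaunay F (induced_metric \<phi>')"
    and "\<forall>i j. {i, j} \<in> E \<longrightarrow> induced_metric \<phi>' i j = conf_action u (induced_metric \<phi>) i j"
  shows "\<exists>c. \<forall>v\<in>V. u v = c"
proof -
  have sc: "simplicial_complex2 V E F" using assms(1) unfolding surface_triangulation_def by blast
  have c3: "card f = 3" if "f \<in> F" for f using sc that unfolding simplicial_complex2_def by blast
  have VF: "V = \<Union>F" using sc unfolding simplicial_complex2_def by blast
  have edge: "{i, j} \<in> E" if "f \<in> F" "i \<in> f" "j \<in> f" "i \<noteq> j" for f i j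
  proof -
    have "E = {e. card e = 2 \<and> (\<exists>f\<in>F. e \<subseteq> f)}" using sc unfolding simplicial_complex2_def by blast
    thus ?thesis using that by auto
  qed
  obtain \<epsilon>1 where e1: "0 < \<epsilon>1" "\<And>f v. f \<in> F \<Longrightarrow> v \<in> f \<Longrightarrow> \<epsilon>1 \<le> fang (\<lambda>v. \<phi> (vert v)) f v"
    using uniformly_nondegenerate_fang[OF assms(4) c3] by blast
  obtain \<epsilon>2 where e2: "0 < \<epsilon>2" "\<And>f v. f \<in> F \<Longrightarrow> v \<in> f \<Longrightarrow> \<epsilon>2 \<le> fang (\<lambda>v. \<phi>' (vert v)) f v"
    using uniformly_nondegenerate_fang[OF assms(5) c3] by blast
  define \<epsilon> where "\<epsilon> = min \<epsilon>1 \<epsilon>2"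
  let ?X = "realization F"
  have sur: "\<phi> ` ?X = UNIV" and emb: "geodesic_embedding V E F \<phi>"
    using assms(2) unfolding geodesic_homeomorphism_def by auto
  obtain g where g: "homeomorphism ?X UNIV \<phi> g" using emb sur unfolding geodesic_embedding_def by auto
  obtain g' where g': "homeomorphism ?X (\<phi>' ` ?X) \<phi>' g'" using assms(3) unfolding geodesic_embedding_def by auto
  have gX: "g y \<in> ?X" "\<phi> (g y) = y" for y using g unfolding homeomorphism_def by auto
  have g\<phi>: "g (\<phi> x) = x" if "x \<in> ?X" for x using g that unfolding homeomorphism_def by auto
  have inj: "inj_on \<phi> ?X" "inj_on \<phi>' ?X" using g g' unfolding homeomorphism_def by (metis inj_onI)+
  have cont: "continuous_on ?X \<phi>" "continuous_on ?X \<phi>'" "continuous_on UNIV g"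
    using g g' unfolding homeomorphism_def by auto
  define h where "h = \<phi>' \<circ> g"
  have h_cont: "continuous_on UNIV h" unfolding h_def
    using gX by (intro continuous_on_compose cont(3) continuous_on_subset[OF cont(2)]) auto
  have h_inj: "inj h"
  proof (rule injI)
    fix x y assume "h x = h y"
    hence "g x = g y" unfolding h_def using inj(2) gX by (auto dest: inj_onD)
    thus "x = y" using gX(2) by metis
  qed
  have h\<phi>: "h ` \<phi> ` S = \<phi>' ` S" if "S \<subseteq> ?X" for S
  proof -
    have "h (\<phi> x) = \<phi>' x" if "x \<in> S" for x unfolding h_def using g\<phi> \<open>S \<subseteq> ?X\<close> that by auto
    thus ?thesis unfolding image_image by (rule image_cong[OF refl])
  qed
  have op: "open (\<phi> ` U)" if "openin (top_of_set ?X) U" for U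
    using homeomorphism_imp_open_map[OF g that] by simp
  have op': "open (\<phi>' ` U)" if U: "openin (top_of_set ?X) U" for U
  proof -
    have "open (h ` \<phi> ` U)"
      using op[OF U] h_cont h_inj by (intro invariance_of_domain) (auto intro: continuous_on_subset inj_on_subset)
    thus ?thesis using h\<phi> openin_imp_subset[OF U] by simp
  qed
  interpret A: embedded F \<phi> \<epsilon>
  proof
    show "\<phi> ` edge_realization F i j = closed_segment (\<phi> (vert i)) (\<phi> (vert j))"
      if "f \<in> F" "i \<in> f" "j \<in> f" "i \<noteq> j" for f i j
      using emb edge[OF that] unfolding geodesic_embedding_def by blast
    show "\<epsilon> \<le> fang (\<lambda>v. \<phi> (vert v)) f v" if "f \<in> F" "v \<in> f" for f v
      using e1(2)[OF that] unfolding \<epsilon>_def by simp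
  qed (use c3 cont inj op e1(1) e2(1) in \<open>auto simp: \<epsilon>_def\<close>)
  interpret B: embedded F \<phi>' \<epsilon>
  proof
    show "\<phi>' ` edge_realization F i j = closed_segment (\<phi>' (vert i)) (\<phi>' (vert j))"
      if "f \<in> F" "i \<in> f" "j \<in> f" "i \<noteq> j" for f i j
      using assms(3) edge[OF that] unfolding geodesic_embedding_def by blast
    show "\<epsilon> \<le> fang (\<lambda>v. \<phi>' (vert v)) f v" if "f \<in> F" "v \<in> f" for f v
      using e2(2)[OF that] unfolding \<epsilon>_def by simp
  qed (use c3 cont inj op' e1(1) e2(1) in \<open>auto simp: \<epsilon>_def\<close>)
  show ?thesis
  proof (cases "V = {}")
    case True thus ?thesis by simp
  next
    case False
    then obtain v0 where v0: "v0 \<in> \<Union>F" using VF by blast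
    interpret PA: planar F A.z \<epsilon> by (rule A.planar)
    interpret PB: planar F B.z \<epsilon> by (rule B.planar)
    interpret plane_pair F A.z B.z \<epsilon> h u v0
    proof
      show "v0 \<in> \<Union>F" by (rule v0)
      show "(\<Union>f\<in>F. convex hull (A.z ` f)) = UNIV"
      proof -
        have "y \<in> (\<Union>f\<in>F. convex hull (A.z ` f))" for y
        proof -
          obtain f where f: "f \<in> F" "supp (g y) \<subseteq> f" using gX(1)[of y] unfolding realization_def by blast
          hence "\<phi> (g y) \<in> convex hull (A.z ` f)" using A.mem_face_iff[OF f(1) gX(1)] by blast
          thus ?thesis using f(1) gX(2) by auto
        qed
        thus ?thesis by blast
      qed
      show "finite {f \<in> F. convex hull (A.z ` f) \<inter> cball (A.z v0) R \<noteq> {}}" for R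
        by (rule A.locally_finite) (simp_all add: sur)
      show "continuous_on UNIV h" "inj h" by (rule h_cont, rule h_inj)
      show "h ` (convex hull (A.z ` f)) = convex hull (B.z ` f)" if "f \<in> F" for f
        unfolding A.face_image[OF that, symmetric] B.face_image[OF that, symmetric] A.\<Delta>_def B.\<Delta>_def by (rule h\<phi>) blast
      show "h (A.z v) = B.z v" if "v \<in> \<Union>F" for v
      proof -
        have "vert v \<in> ?X" using that A.vert_in by blast
        thus ?thesis unfolding h_def using g\<phi> by simp
      qed
      show "cmod (B.z i - B.z j) = exp ((u i + u j) / 2) * cmod (A.z i - A.z j)"
        if "f \<in> F" "i \<in> f" "j \<in> f" "i \<noteq> j" for f i j
        using assms(8) edge[OF that] unfolding induced_metric_def conf_action_def by blast
    qed
    show ?thesis unfolding VF using u_constant[OF _ v0] by blast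
  qed
qed

end
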